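(* Let $p>1$. (i) Let $w\in\mathcal H_0$ be a complex-valued solution on $(-1,1)$ of $$\frac1\rho\big(\rho(1-y^2)w'\big)'-\frac{2(p+1)}{(p-1)^2}w+|w|^{p-1}w=0 .$$ Then either $w\equiv0$ or there exist $\delta\in(-1,1)$ and $\theta\in\mathbb R$ such that $w(y)=e^{i\theta}\kappa(\delta,y)$ for all $y\in(-1,1)$. (ii) It holds that $$E(0,0)=0\quad\text{and}\quad \forall\delta\in(-1,1),\ \forall\theta\in\mathbb R,\quad E(e^{i\theta}\kappa(\delta,\cdot),0)=E(\kappa_0,0)>0 .$$
   Context: Notation: $\rho(y)=(1-y^2)^{\frac2{p-1}}$ on $(-1,1)$; $$\mathcal H_0=\Big\{r\in H^1_{loc}((-1,1),\mathbb C)\ \Big|\ \|r\|_{\mathcal H_0}^2\equiv\int_{-1}^1\big(|r'|^2(1-y^2)+|r|^2\big)\rho\,dy<+\infty\Big\};$$ $$\kappa(\delta,y)=\kappa_0\frac{(1-\delta^2)^{\frac1{p-1}}}{(1+\delta y)^{\frac2{p-1}}},\qquad \kappa_0=\Big(\frac{2(p+1)}{(p-1)^2}\Big)^{\frac1{p-1}};$$ $$E(w,v)=\int_{-1}^1\Big(\tfrac12|v|^2+\tfrac12|\partial_yw|^2(1-y^2)+\tfrac{p+1}{(p-1)^2}|w|^2-\tfrac1{p+1}|w|^{p+1}\Big)\rho\,dy .$$ The equation in (i) is understood in the sense of distributions on $(-1,1)$. It is the stationary version of the equation $\partial_s^2w=\frac1\rho\partial_y(\rho(1-y^2)\partial_yw)-\frac{2(p+1)}{(p-1)^2}w+|w|^{p-1}w-\frac{p+3}{p-1}\partial_sw-2y\partial_{ys}w$.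 *)

theory Defs
  imports "HOL-Analysis.Analysis"
begin

abbreviation Iv :: "real set" where
  "Iv \<equiv> {-1<..<1}"

text \<open>Distributions on \<open>(-1,1)\<close> are represented as functionals on real-valued test functions
  (a complex distribution is determined by its values on these). Since all derivatives are
  required on the whole line, a test function is one extended by \<open>0\<close> outside \<open>(-1,1)\<close>.\<close>

definition test_fun :: "(real \<Rightarrow> real) set" where
  "test_fun = {\<phi>. (\<forall>k y. (deriv ^^ k) \<phi> differentiable at y) \<and>
     compact (closure {y. \<phi> y \<noteq> 0}) \<and> closure {y. \<phi> y \<noteq> 0} \<subseteq> Iv}"

type_synonym distr = "(real \<Rightarrow> real) \<Rightarrow> complex"

definition regular :: "(real \<Rightarrow> complex) \<Rightarrow> distr" where
  "regular f = (\<lambda>\<phi>. LINT y:Iv|lebesgue. \<phi> y *\<^sub>R f y)"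

definition distr_deriv :: "distr \<Rightarrow> distr" where
  "distr_deriv T = (\<lambda>\<phi>. - T (deriv \<phi>))"

text \<open>Multiplication by a function that is smooth on \<open>(-1,1)\<close>; its values elsewhere are
  irrelevant, as test functions vanish there.\<close>

definition distr_mult :: "(real \<Rightarrow> real) \<Rightarrow> distr \<Rightarrow> distr" where
  "distr_mult a T = (\<lambda>\<phi>. T (\<lambda>y. a y * \<phi> y))"

definition L1_loc :: "(real \<Rightarrow> complex) set" where
  "L1_loc = {f. \<forall>K. compact K \<and> K \<subseteq> Iv \<longrightarrow> set_integrable lebesgue K f}"

definition L2_loc :: "(real \<Rightarrow> complex) set" where
  "L2_loc = {f. f \<in> borel_measurable (lebesgue_on Iv) \<and>
     (\<forall>K. compact K \<and> K \<subseteq> Iv \<longrightarrow> set_integrable lebesgue K (\<lambda>y. (cmod (f y))\<^sup>2))}"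

definition has_weak_deriv :: "(real \<Rightarrow> complex) \<Rightarrow> (real \<Rightarrow> complex) \<Rightarrow> bool" where
  "has_weak_deriv w g \<longleftrightarrow> w \<in> L1_loc \<and> g \<in> L1_loc \<and>
     (\<forall>\<phi>\<in>test_fun. distr_deriv (regular w) \<phi> = regular g \<phi>)"

text \<open>The weak derivative is unique up to a null set, so the choice made here does not
  influence any of the integrals below.\<close>

definition weak_deriv :: "(real \<Rightarrow> complex) \<Rightarrow> real \<Rightarrow> complex" where
  "weak_deriv w = (SOME g. has_weak_deriv w g)"

definition H1_loc :: "(real \<Rightarrow> complex) set" where
  "H1_loc = {w. w \<in> L2_loc \<and> (\<exists>g\<in>L2_loc. has_weak_deriv w g)}"

definition rho :: "real \<Rightarrow> real \<Rightarrow> real" where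
  "rho p y = (1 - y\<^sup>2) powr (2 / (p - 1))"

definition H0_norm_sq :: "real \<Rightarrow> (real \<Rightarrow> complex) \<Rightarrow> ennreal" where
  "H0_norm_sq p r = (\<integral>\<^sup>+ y \<in> Iv.
     ennreal (((cmod (weak_deriv r y))\<^sup>2 * (1 - y\<^sup>2) + (cmod (r y))\<^sup>2) * rho p y) \<partial>lebesgue)"

text \<open>The elements are representatives, not classes modulo null sets.\<close>

definition H0 :: "real \<Rightarrow> (real \<Rightarrow> complex) set" where
  "H0 p = {r \<in> H1_loc. H0_norm_sq p r < \<infinity>}"

definition kappa0 :: "real \<Rightarrow> real" where
  "kappa0 p = (2 * (p + 1) / (p - 1)\<^sup>2) powr (1 / (p - 1))"

definition kappa :: "real \<Rightarrow> real \<Rightarrow> real \<Rightarrow> real" where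
  "kappa p \<delta> y = kappa0 p * ((1 - \<delta>\<^sup>2) powr (1 / (p - 1)) / (1 + \<delta> * y) powr (2 / (p - 1)))"

definition energy :: "real \<Rightarrow> (real \<Rightarrow> complex) \<Rightarrow> (real \<Rightarrow> complex) \<Rightarrow> real" where
  "energy p w v = (LINT y:Iv|lebesgue.
     (1 / 2 * (cmod (v y))\<^sup>2 + 1 / 2 * (cmod (weak_deriv w y))\<^sup>2 * (1 - y\<^sup>2)
      + (p + 1) / (p - 1)\<^sup>2 * (cmod (w y))\<^sup>2
      - 1 / (p + 1) * cmod (w y) powr (p + 1)) * rho p y)"

definition stationary_solution :: "real \<Rightarrow> (real \<Rightarrow> complex) \<Rightarrow> bool" where
  "stationary_solution p w \<longleftrightarrow> (\<forall>\<phi>\<in>test_fun.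
     distr_mult (\<lambda>y. 1 / rho p y)
       (distr_deriv (regular (\<lambda>y. (rho p y * (1 - y\<^sup>2)) *\<^sub>R weak_deriv w y))) \<phi>
     - (2 * (p + 1) / (p - 1)\<^sup>2) *\<^sub>R regular w \<phi>
     + regular (\<lambda>y. (cmod (w y) powr (p - 1)) *\<^sub>R w y) \<phi> = 0)"

end

(* A weak solution w satisfies, weakly, ((1 - y^2) w')' = 2 a y w' + a (a + 1) w - |w|^(p-1) w with
   a = 2/(p-1), so two applications of the du Bois-Reymond lemma give a C^2 representative W.
   With y = tanh x and W = (1 - y^2)^(-a/2) u the equation is autonomous, u'' = a^2 u - |u|^(p-1) u,
   and conserves an energy and an angular momentum; in the variable y these are
   rho (1 - y^2) S and rho (1 - y^2) m. A Hardy inequality deduced from the H0 bound shows that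
   |u|^2 + |u'|^2 is integrable in x, so both conserved quantities vanish. Then |W'| is bounded by
   2 a |W| / (1 - y^2), hence W vanishes identically or nowhere. In the latter case its phase is constant
   (m = 0), and S = 0 makes |W|^(-(p-1)/2) an affine function of y, which is exactly the kappa family.
   The Moebius maps y -> (y + delta) / (1 + delta y) carry the potential part of the energy density of
   kappa(delta) to that of kappa(0), up to an exact derivative. *)
theory Submission
  imports Defs
begin

subsection \<open>Smooth bump functions and test functions\<close>

text \<open>The substitution y = tanh x is only a guide; every computation is done in y. With q = 1
  - y^2 it gives |u|^2 = rho |W|^2, u_x = rho^(1/2) (q W' - a y W) and dx = dy/q. The norm of
  \<open>H0 p\<close> controls the y-integrals of rho |W|^2 and rho q |W'|^2, while square
  integrability of u in x asks for rho |W|^2 / q, larger by a factor that is unbounded at the end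
  points. This is the gap that Hardy's inequality closes. As the two invariants are constant, single
  points with small |u|^2 + |u_x|^2 are enough, so the inequality enters only as the statement that
  this sum cannot stay above a positive level near y = 1.

  The other difficulty is that a solution and its weak derivative are known only up to null sets,
  and that local integrability of the nonlinear term has to be derived. Both are settled by passing
  to a continuous representative W with continuous derivative V; the differential equation is then
  studied for W and V alone. The modulus is handled through |W|^2, which is differentiable also at
  zeros of W.\<close>

primrec ndiff :: "nat \<Rightarrow> (real \<Rightarrow> real) \<Rightarrow> bool" where
  "ndiff 0 f = True"
| "ndiff (Suc n) f \<longleftrightarrow> (\<forall>y. f differentiable at y) \<and> ndiff n (deriv f)"

lemma ndiff_SucD: "ndiff (Suc n) f \<Longrightarrow> ndiff n f"
  by (induction n arbitrary: f) auto

lemma ndiff_Suc_DERIV: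
  assumes "\<And>x. (f has_real_derivative f' x) (at x)"
  shows "ndiff (Suc n) f \<longleftrightarrow> ndiff n f'"
proof -
  have "deriv f = f'"
    using assms by (auto intro!: DERIV_imp_deriv)
  then show ?thesis
    using assms by (auto simp: real_differentiable_def)
qed

lemma ndiff_Suc_has_deriv:
  "ndiff (Suc n) f \<Longrightarrow> (f has_real_derivative deriv f x) (at x)"
  by (simp add: DERIV_deriv_iff_real_differentiable)

lemma ndiff_const: "ndiff n (\<lambda>_. c)"
proof (induction n arbitrary: c)
  case (Suc n)
  have "((\<lambda>_. c) has_real_derivative 0) (at x)" for x :: real
    by simp
  then show ?case
    using ndiff_Suc_DERIV[of "\<lambda>_. c" "\<lambda>_. 0"] Suc by blast
qed simp

lemma ndiff_add: "ndiff n f \<Longrightarrow> ndiff n g \<Longrightarrow> ndiff n (\<lambda>x. f x + g x)"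
proof (induction n arbitrary: f g)
  case (Suc n)
  have "((\<lambda>x. f x + g x) has_real_derivative deriv f x + deriv g x) (at x)" for x
    using Suc.prems by (intro DERIV_add ndiff_Suc_has_deriv)
  then show ?case
    using Suc by (subst ndiff_Suc_DERIV) auto
qed simp

lemma ndiff_mult: "ndiff n f \<Longrightarrow> ndiff n g \<Longrightarrow> ndiff n (\<lambda>x. f x * g x)"
proof (induction n arbitrary: f g)
  case (Suc n)
  have "((\<lambda>x. f x * g x) has_real_derivative deriv f x * g x + deriv g x * f x) (at x)" for x
    using Suc.prems by (intro DERIV_mult ndiff_Suc_has_deriv)
  moreover have "ndiff n (\<lambda>x. deriv f x * g x + deriv g x * f x)"
    using Suc.prems ndiff_SucD[OF Suc.prems(1)] ndiff_SucD[OF Suc.prems(2)]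
    by (intro ndiff_add Suc.IH) simp_all
  ultimately show ?case
    by (subst ndiff_Suc_DERIV) auto
qed simp

lemma ndiff_affine: "ndiff n f \<Longrightarrow> ndiff n (\<lambda>x. f (c * x + d))"
proof (induction n arbitrary: f)
  case (Suc n)
  have "((\<lambda>x. f (c * x + d)) has_real_derivative c * deriv f (c * x + d)) (at x)" for x
  proof -
    have "((\<lambda>x. c * x + d) has_real_derivative c) (at x)"
      by (auto intro!: derivative_eq_intros)
    from DERIV_chain2[OF ndiff_Suc_has_deriv[OF Suc.prems] this] show ?thesis
      by (simp add: mult.commute)
  qed
  moreover have "ndiff n (\<lambda>x. c * deriv f (c * x + d))"
    using Suc by (intro ndiff_mult ndiff_const Suc.IH) auto
  ultimately show ?case
    by (subst ndiff_Suc_DERIV) auto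
qed simp

text \<open>The classical function exp(-1/x) for x > 0, divided by powers of x so that the family is
  closed under differentiation: each derivative is a combination of two later members.\<close>

definition flat :: "nat \<Rightarrow> real \<Rightarrow> real" where
  "flat k x = (if x > 0 then exp (- 1 / x) / x ^ k else 0)"

text \<open>With t = 1/x the right-hand limit becomes that of t^k / exp t at infinity.\<close>

lemma flat_tendsto_0: "(flat k \<longlongrightarrow> 0) (at 0)"
proof -
  have "((\<lambda>x::real. x ^ k / exp x) \<longlongrightarrow> 0) at_top"
    by (rule tendsto_power_div_exp_0)
  then have "((\<lambda>x::real. (inverse x) ^ k / exp (inverse x)) \<longlongrightarrow> 0) (at_right 0)"
    by (rule filterlim_compose[OF _ filterlim_inverse_at_top_right])
  moreover have "\<forall>\<^sub>F x in at_right 0. (inverse x) ^ k / exp (inverse x) = flat k x"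
    unfolding eventually_at_right[OF zero_less_one] 
    by (intro exI[of _ 1]) (auto simp: flat_def exp_minus field_simps)
  ultimately have "(flat k \<longlongrightarrow> 0) (at_right 0)"
    using Lim_transform_eventually by blast
  moreover have "(flat k \<longlongrightarrow> 0) (at_left 0)"
  proof (rule Lim_transform_eventually[OF tendsto_const])
    show "\<forall>\<^sub>F x in at_left 0. 0 = flat k x"
      unfolding eventually_at_left[of "-1" "0::real", simplified]
      by (intro exI[of _ "-1"]) (auto simp: flat_def)
  qed
  ultimately show ?thesis
    by (simp add: filterlim_split_at)
qed

lemma flat_has_deriv:
  "(flat k has_real_derivative - real k * flat (Suc k) x + flat (Suc (Suc k)) x) (at x)"
proof -
  consider "x > 0" | "x < 0" | "x = 0" by linarith
  then show ?thesis
  proof cases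
    case 1
    have "((\<lambda>x. exp (- 1 / x) / x ^ k) has_real_derivative
        - real k * flat (Suc k) x + flat (Suc (Suc k)) x) (at x)"
    proof (cases k)
      case 0
      then show ?thesis using 1
        by (auto intro!: derivative_eq_intros simp: flat_def field_simps power2_eq_square)
    next
      case (Suc m)
      have pow: "((\<lambda>x. x ^ Suc m) has_real_derivative real (Suc m) * x ^ m) (at x)"
        using DERIV_pow[of "Suc m" x] by simp
      have exp: "((\<lambda>x. exp (- 1 / x)) has_real_derivative exp (- 1 / x) / x\<^sup>2) (at x)"
        using 1 by (auto intro!: derivative_eq_intros simp: power2_eq_square)
      have "((\<lambda>x. exp (- 1 / x) / x ^ Suc m) has_real_derivative
          (exp (- 1 / x) / x\<^sup>2 * x ^ Suc m - exp (- 1 / x) * (real (Suc m) * x ^ m)) / (x ^ Suc m * x ^ Suc m)) (at x)"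
        by (rule DERIV_divide[OF exp pow]) (use 1 in simp)
      also have "(exp (- 1 / x) / x\<^sup>2 * x ^ Suc m - exp (- 1 / x) * (real (Suc m) * x ^ m)) / (x ^ Suc m * x ^ Suc m)
          = - real k * flat (Suc k) x + flat (Suc (Suc k)) x"
        using 1 Suc by (simp add: flat_def field_simps power2_eq_square)
      finally show ?thesis
        by (simp add: Suc)
    qed
    then show ?thesis
      by (rule has_field_derivative_transform_within_open[where S="{0<..}"])
         (use 1 in \<open>auto simp: flat_def\<close>)
  next
    case 2
    have "((\<lambda>x. 0) has_real_derivative - real k * flat (Suc k) x + flat (Suc (Suc k)) x) (at x)"
      using 2 by (auto simp: flat_def)
    then show ?thesis
      by (rule has_field_derivative_transform_within_open[where S="{..<0}"])
         (use 2 in \<open>auto simp: flat_def\<close>)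
  next
    case 3
    \<comment> \<open>The difference quotient at 0 is itself the next member of the family, so its
      limit is already known.\<close>
    have "(\<lambda>h. (flat k (0 + h) - flat k 0) / h) = flat (Suc k)"
      by (auto simp: flat_def fun_eq_iff)
    then have "(flat k has_real_derivative 0) (at 0)"
      using flat_tendsto_0[of "Suc k"] unfolding DERIV_def by simp
    then show ?thesis
      using 3 by (simp add: flat_def)
  qed
qed

lemma ndiff_flat: "ndiff n (flat k)"
proof (induction n arbitrary: k)
  case (Suc n)
  show ?case
    unfolding ndiff_Suc_DERIV[OF flat_has_deriv]
    by (intro ndiff_add ndiff_mult ndiff_const Suc)
qed simp

text \<open>Stretching the argument by \<open>Suc n\<close> moves each factor exp(-1/(c t)) towards
  1 while the support stays in [a,b]. A fixed interval thus carries smooth functions with values in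
  [0,1] that converge pointwise to the indicator of its interior, which takes the place of
  mollification.\<close>

definition bump :: "nat \<Rightarrow> real \<Rightarrow> real \<Rightarrow> real \<Rightarrow> real" where
  "bump n a b x = flat 0 (real (Suc n) * (x - a)) * flat 0 (real (Suc n) * (b - x))"

lemma ndiff_bump: "ndiff k (bump n a b)"
proof -
  have "bump n a b = (\<lambda>x. flat 0 (real (Suc n) * x + - real (Suc n) * a) *
      flat 0 (- real (Suc n) * x + real (Suc n) * b))"
    by (auto simp: bump_def algebra_simps)
  then show ?thesis
    by (simp only:) (intro ndiff_mult ndiff_affine ndiff_flat)
qed

lemma flat_0_bounds: "0 \<le> flat 0 x" "flat 0 x \<le> 1"
  by (auto simp: flat_def)

lemma bump_bounds: "0 \<le> bump n a b x" "bump n a b x \<le> 1"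
  by (auto simp: bump_def flat_0_bounds mult_le_one)

lemma bump_outside: "x \<notin> {a<..<b} \<Longrightarrow> bump n a b x = 0"
  by (auto simp: bump_def flat_def zero_less_mult_iff)

lemma bump_pos: "x \<in> {a<..<b} \<Longrightarrow> bump n a b x > 0"
  by (auto simp: bump_def flat_def zero_less_mult_iff)

lemma bump_tendsto: "(\<lambda>n. bump n a b x) \<longlonglongrightarrow> indicat_real {a<..<b} x"
proof (cases "x \<in> {a<..<b}")
  case True
  have *: "(\<lambda>n. flat 0 (real (Suc n) * t)) \<longlonglongrightarrow> 1" if "t > 0" for t
  proof -
    have "(\<lambda>n. - 1 / t * inverse (real (Suc n))) \<longlonglongrightarrow> - 1 / t * 0"
      by (intro tendsto_intros LIMSEQ_inverse_real_of_nat)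
    then have "(\<lambda>n. exp (- 1 / t * inverse (real (Suc n)))) \<longlonglongrightarrow> exp (- 1 / t * 0)"
      by (rule tendsto_exp)
    moreover have "exp (- 1 / t * inverse (real (Suc n))) = flat 0 (real (Suc n) * t)" for n
      using that by (simp add: flat_def zero_less_mult_iff divide_inverse mult.commute)
    ultimately show ?thesis by simp
  qed
  have "(\<lambda>n. bump n a b x) \<longlonglongrightarrow> 1 * 1"
    unfolding bump_def using True by (intro tendsto_mult *) auto
  then show ?thesis using True by simp
next
  case False
  then show ?thesis by (simp add: bump_outside)
qed

section \<open>Test functions and their primitives\<close>

lemma ndiff_higher_deriv: "(\<forall>n. ndiff n f) \<longleftrightarrow> (\<forall>k y. (deriv ^^ k) f differentiable at y)"
proof
  assume "\<forall>n. ndiff n f"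
  moreover have "ndiff (Suc k) f \<Longrightarrow> (deriv ^^ k) f differentiable at y" for k y
    by (induction k arbitrary: f) (auto simp: funpow_swap1)
  ultimately show "\<forall>k y. (deriv ^^ k) f differentiable at y" by blast
next
  assume *: "\<forall>k y. (deriv ^^ k) f differentiable at y"
  have "\<forall>k y. (deriv ^^ k) f differentiable at y \<Longrightarrow> ndiff n f" for n f
  proof (induction n arbitrary: f)
    case (Suc n)
    have "f differentiable at y" for y
      using Suc.prems[rule_format, of 0 y] by simp
    moreover have "(deriv ^^ k) (deriv f) differentiable at y" for k y
      using Suc.prems[rule_format, of "Suc k" y] by (simp add: funpow_swap1)
    ultimately show ?case using Suc.IH by simp
  qed simp
  then show "\<forall>n. ndiff n f" using * by blast
qed

text \<open>Trades the topological support for an explicit interval between its least and greatest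
  points, the form in which integrals over (-1,1) reduce to integrals over compact
  intervals.\<close>

lemma test_fun_iff:
  "\<phi> \<in> test_fun \<longleftrightarrow> (\<forall>n. ndiff n \<phi>) \<and> (\<exists>a b. -1 < a \<and> a < b \<and> b < 1 \<and> (\<forall>x. x \<notin> {a..b} \<longrightarrow> \<phi> x = 0))"
proof
  assume \<phi>: "\<phi> \<in> test_fun"
  let ?K = "closure {y. \<phi> y \<noteq> 0}"
  have K: "compact ?K" "?K \<subseteq> Iv" and "\<forall>n. ndiff n \<phi>"
    using \<phi> by (auto simp: test_fun_def ndiff_higher_deriv)
  moreover have "\<exists>a b. -1 < a \<and> a < b \<and> b < 1 \<and> (\<forall>x. x \<notin> {a..b} \<longrightarrow> \<phi> x = 0)"
  proof (cases "?K = {}")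
    case True
    then have "\<phi> x = 0" for x
      using closure_subset[of "{y. \<phi> y \<noteq> 0}"] by blast
    then show ?thesis
      by (intro exI[of _ "-1/2"] exI[of _ "1/2"]) simp
  next
    case False
    obtain s where s: "s \<in> ?K" "\<forall>t\<in>?K. t \<le> s"
      using compact_attains_sup[OF K(1) False] by blast
    obtain r where r: "r \<in> ?K" "\<forall>t\<in>?K. r \<le> t"
      using compact_attains_inf[OF K(1) False] by blast
    have rs: "-1 < r" "r \<le> s" "s < 1"
      using subsetD[OF K(2) r(1)] subsetD[OF K(2) s(1)] bspec[OF s(2) r(1)] by (simp_all only: greaterThanLessThan_iff)
    \<comment> \<open>The right end is moved from \<open>s\<close> half way to 1, which secures a
      nondegenerate interval without excluding \<open>r = s\<close>.\<close>
    have "\<phi> x = 0" if "x \<notin> {r..(s + 1) / 2}" for x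
    proof (rule ccontr)
      assume "\<phi> x \<noteq> 0"
      then have "x \<in> ?K" using closure_subset[of "{y. \<phi> y \<noteq> 0}"] by (metis (mono_tags) mem_Collect_eq subsetD)
      then have "r \<le> x" "x \<le> s" using bspec[OF r(2)] bspec[OF s(2)] by simp_all
      then show False using that rs by simp
    qed
    then show ?thesis
      using rs by (intro exI[of _ r] exI[of _ "(s+1)/2"]) auto
  qed
  ultimately show "(\<forall>n. ndiff n \<phi>) \<and> (\<exists>a b. -1 < a \<and> a < b \<and> b < 1 \<and> (\<forall>x. x \<notin> {a..b} \<longrightarrow> \<phi> x = 0))"
    by blast
next
  assume "(\<forall>n. ndiff n \<phi>) \<and> (\<exists>a b. -1 < a \<and> a < b \<and> b < 1 \<and> (\<forall>x. x \<notin> {a..b} \<longrightarrow> \<phi> x = 0))"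
  then obtain a b where *: "\<forall>n. ndiff n \<phi>" "-1 < a" "a < b" "b < 1" "\<And>x. x \<notin> {a..b} \<Longrightarrow> \<phi> x = 0"
    by blast
  have sub: "closure {y. \<phi> y \<noteq> 0} \<subseteq> {a..b}"
    by (rule closure_minimal) (use *(5) in blast, simp)
  have "compact (closure {y. \<phi> y \<noteq> 0})"
    using compact_Int_closed[of "{a..b}" "closure {y. \<phi> y \<noteq> 0}"] sub
    by (simp add: Int_absorb1)
  then show "\<phi> \<in> test_fun"
    using * sub by (auto simp: test_fun_def ndiff_higher_deriv)
qed

lemma test_fun_supportE:
  assumes "\<phi> \<in> test_fun"
  obtains a b where "-1 < a" "a < b" "b < 1" "\<forall>x. x \<notin> {a..b} \<longrightarrow> \<phi> x = 0"
  using assms unfolding test_fun_iff by blast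

lemma test_funI:
  assumes "\<And>n. ndiff n \<phi>" "-1 < a" "a < b" "b < 1" "\<And>x. x \<notin> {a..b} \<Longrightarrow> \<phi> x = 0"
  shows "\<phi> \<in> test_fun"
  unfolding test_fun_iff
  using assms by (intro conjI allI exI[of _ a] exI[of _ b] impI)

lemma test_fun_ndiff: "\<phi> \<in> test_fun \<Longrightarrow> ndiff n \<phi>"
  by (simp add: test_fun_iff)

lemma test_fun_has_deriv:
  "\<phi> \<in> test_fun \<Longrightarrow> (\<phi> has_real_derivative deriv \<phi> x) (at x)"
  by (rule ndiff_Suc_has_deriv[OF test_fun_ndiff])

lemma test_fun_continuous: "\<phi> \<in> test_fun \<Longrightarrow> continuous_on S \<phi>"
  by (intro continuous_at_imp_continuous_on ballI DERIV_isCont[OF test_fun_has_deriv])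

lemma deriv_0_outside:
  fixes \<phi> :: "real \<Rightarrow> real"
  assumes "\<forall>x. x \<notin> {a..b} \<longrightarrow> \<phi> x = 0" "x \<notin> {a..b}"
  shows "deriv \<phi> x = 0"
proof (rule DERIV_imp_deriv)
  have "((\<lambda>_. 0) has_real_derivative 0) (at x)" by simp
  then show "(\<phi> has_real_derivative 0) (at x)"
    by (rule has_field_derivative_transform_within_open[where S="-{a..b}"])
      (simp_all add: open_Compl assms del: atLeastAtMost_iff)
qed

lemma test_fun_deriv: "\<phi> \<in> test_fun \<Longrightarrow> deriv \<phi> \<in> test_fun"
proof -
  assume \<phi>: "\<phi> \<in> test_fun"
  obtain a b where ab: "-1 < a" "a < b" "b < 1" "\<forall>x. x \<notin> {a..b} \<longrightarrow> \<phi> x = 0"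
    by (rule test_fun_supportE[OF \<phi>])
  have "ndiff n (deriv \<phi>)" for n
  proof -
    have "ndiff (Suc n) \<phi>"
      using \<phi> by (rule test_fun_ndiff)
    then show ?thesis by simp
  qed
  then show ?thesis
    by (rule test_funI[OF _ ab(1-3)]) (rule deriv_0_outside[OF ab(4)])
qed

lemma bump_test_fun: "-1 < a \<Longrightarrow> a < b \<Longrightarrow> b < 1 \<Longrightarrow> bump n a b \<in> test_fun"
  by (rule test_funI[of _ a b, OF ndiff_bump]) (auto intro: bump_outside)

lemma test_fun_lincomb:
  assumes "\<phi> \<in> test_fun" "\<psi> \<in> test_fun"
  shows "(\<lambda>x. \<phi> x + c * \<psi> x) \<in> test_fun"
proof -
  obtain a b where ab: "-1 < a" "a < b" "b < 1" "\<forall>x. x \<notin> {a..b} \<longrightarrow> \<phi> x = 0"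
    by (rule test_fun_supportE[OF assms(1)])
  obtain a' b' where ab': "-1 < a'" "a' < b'" "b' < 1" "\<forall>x. x \<notin> {a'..b'} \<longrightarrow> \<psi> x = 0"
    by (rule test_fun_supportE[OF assms(2)])
  have "ndiff n (\<lambda>x. \<phi> x + c * \<psi> x)" for n
    using assms by (intro ndiff_add ndiff_mult ndiff_const) (auto intro: test_fun_ndiff)
  moreover have "\<phi> x + c * \<psi> x = 0" if "x \<notin> {min a a'..max b b'}" for x
  proof -
    have "x \<notin> {a..b}" "x \<notin> {a'..b'}"
      using that by auto
    then show ?thesis
      using ab(4) ab'(4) by simp
  qed
  moreover have "-1 < min a a'" "min a a' < max b b'" "max b b' < 1"
    using ab(1-3) ab'(1-3) by auto
  ultimately show ?thesis
    by (intro test_funI)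
qed

text \<open>The primitive starting at -1 is constant to the right of the support, and that constant
  is the integral; it has compact support because the integral vanishes.\<close>

lemma test_fun_primitive:
  assumes \<psi>: "\<psi> \<in> test_fun" and zero: "integral {-1..1} \<psi> = 0"
  obtains \<phi> where "\<phi> \<in> test_fun" "deriv \<phi> = \<psi>"
proof -
  obtain a b where ab: "-1 < a" "a < b" "b < 1" and supp: "\<forall>x. x \<notin> {a..b} \<longrightarrow> \<psi> x = 0"
    by (rule test_fun_supportE[OF \<psi>])
  define \<phi> where "\<phi> x = integral {-1..x} \<psi>" for x
  have cont: "continuous_on S \<psi>" for S
    using \<psi> by (rule test_fun_continuous)
  have out: "\<phi> x = 0" if x: "x \<notin> {a..b}" for x
  proof (cases "x < a")
    case True
    have "integral {-1..x} \<psi> = integral {-1..x} (\<lambda>_. 0::real)"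
      by (rule integral_cong) (use True supp in auto)
    then show ?thesis by (simp add: \<phi>_def)
  next
    case False
    then have "x > b" using x by auto
    have "integral {-1..x} \<psi> = integral {-1..1} \<psi>"
    proof (rule integral_spike_set)
      have *: "{y \<in> {-1..x} - {-1..1}. \<psi> y \<noteq> 0} = {}" "{y \<in> {-1..1} - {-1..x}. \<psi> y \<noteq> 0} = {}"
        using \<open>x > b\<close> ab supp by force+
      show "negligible {y \<in> {-1..x} - {-1..1}. \<psi> y \<noteq> 0}" "negligible {y \<in> {-1..1} - {-1..x}. \<psi> y \<noteq> 0}"
        unfolding * by simp_all
    qed
    then show ?thesis using zero by (simp add: \<phi>_def)
  qed
  have D: "(\<phi> has_real_derivative \<psi> x) (at x)" for x
  proof (cases "x \<in> {-1<..<2}")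
    case True
    have "(\<phi> has_vector_derivative \<psi> x) (at x within {-1..2})"
      unfolding \<phi>_def using True by (intro integral_has_vector_derivative cont) auto
    then show ?thesis
      using True at_within_Icc_at[of "-1" x 2]
      by (auto simp: has_real_derivative_iff_has_vector_derivative)
  next
    case False
    then have "x \<le> -1 \<or> 2 \<le> x"
      by (meson greaterThanLessThan_iff not_less)
    then have x: "x \<notin> {a..b}"
      using ab by auto
    have "((\<lambda>_. 0) has_real_derivative 0) (at x)" by simp
    then have "(\<phi> has_real_derivative 0) (at x)"
      by (rule has_field_derivative_transform_within_open[where S="-{a..b}"])
        (use x in \<open>simp_all add: open_Compl out\<close>)
    moreover have "\<psi> x = 0"
      using x supp by blast
    ultimately show ?thesis by simp
  qed
  then have d: "deriv \<phi> = \<psi>" by (auto intro!: DERIV_imp_deriv)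
  have "ndiff n \<phi>" for n
    using test_fun_ndiff[OF \<psi>] ndiff_Suc_DERIV[OF D] ndiff_SucD by blast
  then have "\<phi> \<in> test_fun"
    by (rule test_funI[OF _ ab out])
  then show ?thesis using d by (rule that)
qed

subsection \<open>The fundamental lemma of the calculus of variations\<close>

lemma Iv_Icc: "-1 < a \<Longrightarrow> b < 1 \<Longrightarrow> {a..b} \<subseteq> Iv"
  by auto

lemma compact_subset_Iv:
  assumes "compact K" "K \<subseteq> Iv"
  obtains a b where "-1 < a" "a < b" "b < 1" "K \<subseteq> {a..b}"
proof (cases "K = {}")
  case True
  then show ?thesis using that[of "-1/2" "1/2"] by auto
next
  case False
  obtain s where s: "s \<in> K" "\<forall>t\<in>K. t \<le> s"
    using compact_attains_sup[OF assms(1) False] by blast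
  obtain r where r: "r \<in> K" "\<forall>t\<in>K. r \<le> t"
    using compact_attains_inf[OF assms(1) False] by blast
  have "-1 < r" "s < 1" "r \<le> s"
    using subsetD[OF assms(2) r(1)] subsetD[OF assms(2) s(1)] bspec[OF s(2) r(1)] by simp_all
  moreover have "K \<subseteq> {r..(s+1)/2}"
    using r(2) s(2) \<open>s < 1\<close> by force
  ultimately show ?thesis
    using that[of r "(s+1)/2"] by auto
qed

lemma L1_loc_iff:
  "f \<in> L1_loc \<longleftrightarrow> (\<forall>a b. -1 < a \<longrightarrow> b < 1 \<longrightarrow> f absolutely_integrable_on {a..b})"
proof
  assume "f \<in> L1_loc"
  then show "\<forall>a b. -1 < a \<longrightarrow> b < 1 \<longrightarrow> f absolutely_integrable_on {a..b}"
    unfolding L1_loc_def using Iv_Icc by simp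
next
  assume *: "\<forall>a b. -1 < a \<longrightarrow> b < 1 \<longrightarrow> f absolutely_integrable_on {a..b}"
  have "f absolutely_integrable_on K" if K: "compact K" "K \<subseteq> Iv" for K
  proof -
    obtain a b where ab: "-1 < a" "a < b" "b < 1" "K \<subseteq> {a..b}"
      using compact_subset_Iv[OF K] by blast
    then have "f absolutely_integrable_on {a..b}"
      using * by blast
    then show ?thesis
      by (rule set_integrable_subset) (use ab K in \<open>auto simp: lmeasurable_compact fmeasurableD\<close>)
  qed
  then show "f \<in> L1_loc"
    unfolding L1_loc_def by blast
qed

lemma L1_locD: "f \<in> L1_loc \<Longrightarrow> -1 < a \<Longrightarrow> b < 1 \<Longrightarrow> f absolutely_integrable_on {a..b}"
  unfolding L1_loc_iff by blast

lemma absolutely_integrable_scaleR_continuous: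
  fixes f :: "real \<Rightarrow> complex" and \<phi> :: "real \<Rightarrow> real"
  assumes "continuous_on {a..b} \<phi>" "f absolutely_integrable_on {a..b}"
  shows "(\<lambda>y. \<phi> y *\<^sub>R f y) absolutely_integrable_on {a..b}"
proof (rule absolutely_integrable_bounded_measurable_product[of "(*\<^sub>R)"])
  show "bilinear ((*\<^sub>R) :: real \<Rightarrow> complex \<Rightarrow> complex)"
    by (simp add: bilinear_conv_bounded_bilinear bounded_bilinear_scaleR)
  show "\<phi> \<in> borel_measurable (lebesgue_on {a..b})"
    using assms(1) by (intro continuous_imp_measurable_on_sets_lebesgue) auto
  show "bounded (\<phi> ` {a..b})"
    by (intro compact_imp_bounded compact_continuous_image assms) simp
qed (use assms in auto)

lemma continuous_L1_loc: "continuous_on Iv f \<Longrightarrow> f \<in> L1_loc"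
  unfolding L1_loc_iff
  by (auto intro!: absolutely_integrable_continuous_real elim: continuous_on_subset)

lemma L1_loc_add: "f \<in> L1_loc \<Longrightarrow> g \<in> L1_loc \<Longrightarrow> (\<lambda>y. f y + g y) \<in> L1_loc"
  unfolding L1_loc_iff by (blast intro: set_integral_add(1))

lemma L1_loc_diff: "f \<in> L1_loc \<Longrightarrow> g \<in> L1_loc \<Longrightarrow> (\<lambda>y. f y - g y) \<in> L1_loc"
  unfolding L1_loc_iff by (blast intro: set_integral_diff(1))

lemma L1_loc_scaleR:
  "continuous_on Iv c \<Longrightarrow> f \<in> L1_loc \<Longrightarrow> (\<lambda>y. c y *\<^sub>R f y) \<in> L1_loc"
  unfolding L1_loc_iff
  by (auto intro!: absolutely_integrable_scaleR_continuous elim: continuous_on_subset)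

lemma regular_eq_integral:
  assumes "\<forall>x. x \<notin> {a..b} \<longrightarrow> \<phi> x = 0" "-1 < a" "b < 1" "continuous_on {a..b} \<phi>" "f \<in> L1_loc"
  shows "set_integrable lebesgue Iv (\<lambda>y. \<phi> y *\<^sub>R f y)"
    "regular f \<phi> = integral {a..b} (\<lambda>y. \<phi> y *\<^sub>R f y)"
proof -
  have int: "(\<lambda>y. \<phi> y *\<^sub>R f y) absolutely_integrable_on {a..b}"
    using assms by (intro absolutely_integrable_scaleR_continuous L1_locD)
  have eq: "(\<lambda>y. indicator Iv y *\<^sub>R \<phi> y *\<^sub>R f y) = (\<lambda>y. indicator {a..b} y *\<^sub>R \<phi> y *\<^sub>R f y)"
  proof
    fix y show "indicator Iv y *\<^sub>R \<phi> y *\<^sub>R f y = indicator {a..b} y *\<^sub>R \<phi> y *\<^sub>R f y"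
      using assms(1-3) by (cases "y \<in> {a..b}") (auto simp: indicator_def)
  qed
  show "set_integrable lebesgue Iv (\<lambda>y. \<phi> y *\<^sub>R f y)"
    using int unfolding set_integrable_def eq .
  show "regular f \<phi> = integral {a..b} (\<lambda>y. \<phi> y *\<^sub>R f y)"
    using set_lebesgue_integral_eq_integral(2)[OF int]
    unfolding regular_def set_lebesgue_integral_def eq by simp
qed

lemma test_fun_mult_integrable:
  assumes "\<phi> \<in> test_fun" "f \<in> L1_loc"
  shows "set_integrable lebesgue Iv (\<lambda>y. \<phi> y *\<^sub>R f y)"
proof -
  obtain a b where "-1 < a" "a < b" "b < 1" "\<forall>x. x \<notin> {a..b} \<longrightarrow> \<phi> x = 0"
    by (rule test_fun_supportE[OF assms(1)])
  then show ?thesis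
    using assms by (intro regular_eq_integral(1)[where a=a and b=b] test_fun_continuous)
qed

lemma regular_add:
  assumes "\<phi> \<in> test_fun" "f \<in> L1_loc" "g \<in> L1_loc"
  shows "regular (\<lambda>y. f y + g y) \<phi> = regular f \<phi> + regular g \<phi>"
  using set_integral_add(2)[OF test_fun_mult_integrable[OF assms(1,2)] test_fun_mult_integrable[OF assms(1,3)]]
  by (simp add: regular_def scaleR_add_right)

lemma regular_diff:
  assumes "\<phi> \<in> test_fun" "f \<in> L1_loc" "g \<in> L1_loc"
  shows "regular (\<lambda>y. f y - g y) \<phi> = regular f \<phi> - regular g \<phi>"
  using set_integral_diff(2)[OF test_fun_mult_integrable[OF assms(1,2)] test_fun_mult_integrable[OF assms(1,3)]]
  by (simp add: regular_def scaleR_diff_right)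

lemma regular_scaleR: "regular (\<lambda>y. c *\<^sub>R f y) \<phi> = c *\<^sub>R regular f \<phi>"
  unfolding regular_def set_integral_scaleR_right[symmetric] by (simp add: mult.commute)

lemma regular_lincomb:
  assumes "\<phi> \<in> test_fun" "\<psi> \<in> test_fun" "f \<in> L1_loc"
  shows "regular f (\<lambda>x. \<phi> x + c * \<psi> x) = regular f \<phi> + c *\<^sub>R regular f \<psi>"
proof -
  have "set_integrable lebesgue Iv (\<lambda>y. c *\<^sub>R (\<psi> y *\<^sub>R f y))"
    using test_fun_mult_integrable[OF assms(2,3)] by (rule set_integrable_scaleR_right)
  from set_integral_add(2)[OF test_fun_mult_integrable[OF assms(1,3)] this] show ?thesis
    by (simp add: regular_def scaleR_add_left del: scaleR_scaleR set_integral_scaleR_right)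
       (simp add: set_integral_scaleR_right[symmetric])
qed

lemma regular_const:
  assumes "\<phi> \<in> test_fun"
  shows "regular (\<lambda>_. c) \<phi> = integral {-1..1} \<phi> *\<^sub>R c"
proof -
  obtain a b where ab: "-1 < a" "a < b" "b < 1" and supp: "\<forall>x. x \<notin> {a..b} \<longrightarrow> \<phi> x = 0"
    by (rule test_fun_supportE[OF assms])
  have c: "continuous_on {a..b} \<phi>"
    using assms by (rule test_fun_continuous)
  have "regular (\<lambda>_. c) \<phi> = integral {a..b} (\<lambda>y. \<phi> y *\<^sub>R c)"
    using ab supp c by (intro regular_eq_integral(2)) (auto intro: continuous_L1_loc)
  also have "\<dots> = integral {a..b} \<phi> *\<^sub>R c"
    using c by (intro integral_unique has_integral_scaleR_left integrable_integral integrable_continuous_real)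
  also have "integral {a..b} \<phi> = integral {-1..1} \<phi>"
  proof (rule integral_spike_set)
    have *: "{y \<in> {a..b} - {-1..1}. \<phi> y \<noteq> 0} = {}" "{y \<in> {-1..1} - {a..b}. \<phi> y \<noteq> 0} = {}"
      using ab supp by force+
    show "negligible {y \<in> {a..b} - {-1..1}. \<phi> y \<noteq> 0}" "negligible {y \<in> {-1..1} - {a..b}. \<phi> y \<noteq> 0}"
      unfolding * by simp_all
  qed
  finally show ?thesis .
qed

lemma regular_cong_AE:
  assumes "AE y in lebesgue. y \<in> Iv \<longrightarrow> f y = g y" "\<phi> \<in> test_fun" "f \<in> L1_loc" "g \<in> L1_loc"
  shows "regular f \<phi> = regular g \<phi>"
  unfolding regular_def set_lebesgue_integral_def
proof (rule integral_cong_AE)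
  show "AE x in lebesgue. indicat_real Iv x *\<^sub>R \<phi> x *\<^sub>R f x = indicat_real Iv x *\<^sub>R \<phi> x *\<^sub>R g x"
    using assms(1) by eventually_elim (auto simp: indicator_def)
qed (use test_fun_mult_integrable[OF assms(2)] assms(3,4) in
    \<open>auto simp: set_integrable_def intro: borel_measurable_integrable\<close>)

text \<open>Lebesgue differentiation: at almost every x the value \<open>f x\<close> is the limit of
  the means over [x, x+h], all of which are zero.\<close>

lemma AE_zero_if_integral_Icc_zero:
  fixes f :: "real \<Rightarrow> complex"
  assumes int: "\<And>a b. f integrable_on {a..b}" and zero: "\<And>a b. integral {a..b} f = 0"
  shows "AE y in lebesgue. f y = 0"
proof -
  obtain N where N: "negligible N" and
    *: "\<And>x e. \<lbrakk>x \<notin> N; 0 < e\<rbrakk> \<Longrightarrow> \<exists>d>0. \<forall>h. 0 < h \<and> h < d \<longrightarrow>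
       norm (integral (cbox x (x + h *\<^sub>R One)) f /\<^sub>R h ^ DIM(real) - f x) < e"
    using integrable_ccontinuous_explicit[of f] int by (auto simp: box_real)
  have "f x = 0" if x: "x \<notin> N" for x
  proof (rule ccontr)
    assume "f x \<noteq> 0"
    then obtain d where "d > 0" and d: "\<forall>h. 0 < h \<and> h < d \<longrightarrow>
       norm (integral (cbox x (x + h *\<^sub>R One)) f /\<^sub>R h ^ DIM(real) - f x) < norm (f x)"
      using *[OF x, of "norm (f x)"] by auto
    from d[rule_format, of "d / 2"] \<open>d > 0\<close> zero show False by simp
  qed
  then have "{x. f x \<noteq> 0} \<subseteq> N" by blast
  then show ?thesis
    using N negligible_iff_null_sets negligible_subset
    by (intro AE_I'[of N]) auto
qed

lemma L1_loc_AE_zero: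
  assumes f: "f \<in> L1_loc" and zero: "\<And>a b. -1 < a \<Longrightarrow> a < b \<Longrightarrow> b < 1 \<Longrightarrow> integral {a..b} f = 0"
  shows "AE y in lebesgue. y \<in> Iv \<longrightarrow> f y = 0"
proof -
  \<comment> \<open>Exhaustion of (-1,1) by compact intervals: \<open>f\<close> is integrable only
    on these, so the result on the whole line is applied to each restriction, and countably many
    null sets are discarded.\<close>
  define J where "J n = {-1 + 1 / real (Suc n)..1 - 1 / real (Suc n)}" for n
  have "AE y in lebesgue. (if y \<in> J n then f y else 0) = 0" for n
  proof (rule AE_zero_if_integral_Icc_zero)
    fix a b :: real
    define a' b' where "a' = max a (-1 + 1 / real (Suc n))" and "b' = min b (1 - 1 / real (Suc n))"
    have J: "J n \<inter> {a..b} = {a'..b'}"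
      by (auto simp: J_def a'_def b'_def)
    have ab': "-1 < a'" "b' < 1"
      by (auto simp: a'_def b'_def less_max_iff_disj min_less_iff_disj)
    then have "f absolutely_integrable_on {a'..b'}"
      by (intro L1_locD f)
    then have "f integrable_on (J n \<inter> {a..b})"
      unfolding J by (rule set_lebesgue_integral_eq_integral(1))
    then show "(\<lambda>y. if y \<in> J n then f y else 0) integrable_on {a..b}"
      by (subst integrable_restrict_Int)
    have "integral {a'..b'} f = 0"
      using zero[OF ab'(1) _ ab'(2)] by (cases a' b' rule: linorder_cases) auto
    then show "integral {a..b} (\<lambda>y. if y \<in> J n then f y else 0) = 0"
      unfolding integral_restrict_Int J by simp
  qed
  then have "AE y in lebesgue. \<forall>n. (if y \<in> J n then f y else 0) = 0"
    by (subst AE_all_countable) blast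
  then show ?thesis
  proof eventually_elim
    case (elim y)
    show ?case
    proof
      assume "y \<in> Iv"
      then have "0 < min (y + 1) (1 - y)" by auto
      then obtain n where "1 / real (Suc n) < min (y + 1) (1 - y)"
        using nat_approx_posE by blast
      then have "y \<in> J n" by (auto simp: J_def)
      then show "f y = 0" using elim[rule_format, of n] by simp
    qed
  qed
qed

text \<open>The bumps converge boundedly to the indicator of (a,b), so dominated convergence turns
  vanishing pairings into vanishing integrals over all compact subintervals.\<close>

lemma fundamental_lemma_cov:
  assumes f: "f \<in> L1_loc" and zero: "\<And>\<phi>. \<phi> \<in> test_fun \<Longrightarrow> regular f \<phi> = 0"
  shows "AE y in lebesgue. y \<in> Iv \<longrightarrow> f y = 0"
proof (rule L1_loc_AE_zero[OF f])
  fix a b :: real assume ab: "-1 < a" "a < b" "b < 1"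
  have fi: "f absolutely_integrable_on {a..b}"
    using f ab by (intro L1_locD)
  have t: "bump n a b \<in> test_fun" for n
    using ab by (rule bump_test_fun)
  have "(\<lambda>n. integral {a..b} (\<lambda>y. bump n a b y *\<^sub>R f y)) \<longlonglongrightarrow>
      integral {a..b} (\<lambda>y. indicat_real {a<..<b} y *\<^sub>R f y)"
  proof (rule dominated_convergence(2)[where h="\<lambda>y. norm (f y)"])
    show "(\<lambda>y. bump n a b y *\<^sub>R f y) integrable_on {a..b}" for n
      using absolutely_integrable_scaleR_continuous[OF test_fun_continuous[OF t] fi]
      by (rule set_lebesgue_integral_eq_integral(1))
    show "(\<lambda>y. norm (f y)) integrable_on {a..b}"
      using fi by (simp add: absolutely_integrable_on_def)
    show "norm (bump n a b y *\<^sub>R f y) \<le> norm (f y)" for n y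
      using bump_bounds[of n a b y] by (simp add: mult_left_le_one_le)
    show "(\<lambda>n. bump n a b y *\<^sub>R f y) \<longlonglongrightarrow> indicat_real {a<..<b} y *\<^sub>R f y" for y
      by (intro tendsto_scaleR bump_tendsto tendsto_const)
  qed
  moreover have "integral {a..b} (\<lambda>y. bump n a b y *\<^sub>R f y) = 0" for n
  proof -
    have "regular f (bump n a b) = integral {a..b} (\<lambda>y. bump n a b y *\<^sub>R f y)"
      using ab f by (intro regular_eq_integral(2) test_fun_continuous[OF t]) (auto intro: bump_outside)
    then show ?thesis using zero[OF t] by simp
  qed
  ultimately have "integral {a..b} (\<lambda>y. indicat_real {a<..<b} y *\<^sub>R f y) = 0"
    by (simp add: LIMSEQ_const_iff)
  moreover have "integral {a..b} (\<lambda>y. indicat_real {a<..<b} y *\<^sub>R f y) = integral {a..b} f"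
    by (rule integral_spike[of "{a,b}"]) (auto simp: indicator_def)
  ultimately show "integral {a..b} f = 0" by simp
qed

text \<open>Fix one test function \<open>e\<close> with nonzero integral. Every other test function
  differs from a multiple of \<open>e\<close> by a function of integral zero, which is the
  derivative of a test function. The pairing with \<open>f\<close> therefore depends only on the
  integral of the test function, as it does for a constant.\<close>

lemma AE_const_if_weak_deriv_zero:
  assumes f: "f \<in> L1_loc" and zero: "\<And>\<phi>. \<phi> \<in> test_fun \<Longrightarrow> regular f (deriv \<phi>) = 0"
  shows "\<exists>C. AE y in lebesgue. y \<in> Iv \<longrightarrow> f y = C"
proof -
  define e where "e = bump 0 (-1/2) (1/2)"
  have e: "e \<in> test_fun"
    unfolding e_def by (rule bump_test_fun) auto
  define I where "I = integral {-1..1} e"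
  have ce: "continuous_on {-1..1} e"
    using e by (rule test_fun_continuous)
  have "I \<noteq> 0"
  proof
    assume "I = 0"
    have "e 0 = 0"
    proof (rule integral_eq_0_iff[OF ce, THEN iffD1, rule_format])
    qed (use bump_bounds bump_outside \<open>I = 0\<close> in \<open>auto simp: I_def e_def\<close>)
    moreover have "e 0 > 0"
      unfolding e_def by (rule bump_pos) auto
    ultimately show False by simp
  qed
  define C where "C = regular f e /\<^sub>R I"
  have "AE y in lebesgue. y \<in> Iv \<longrightarrow> f y - C = 0"
  proof (rule fundamental_lemma_cov)
    have C1: "(\<lambda>_. C) \<in> L1_loc" by (rule continuous_L1_loc) auto
    then show "(\<lambda>y. f y - C) \<in> L1_loc"
      by (rule L1_loc_diff[OF f])
    fix \<psi> assume \<psi>: "\<psi> \<in> test_fun"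
    define c where "c = - (integral {-1..1} \<psi> / I)"
    have \<chi>: "(\<lambda>x. \<psi> x + c * e x) \<in> test_fun"
      using \<psi> e by (rule test_fun_lincomb)
    have "integral {-1..1} (\<lambda>x. \<psi> x + c * e x) = integral {-1..1} \<psi> + c * I"
      unfolding I_def using test_fun_continuous[OF \<psi>] ce
      by (subst integral_add) (auto intro!: integrable_continuous_real continuous_intros)
    also have "\<dots> = 0"
      using \<open>I \<noteq> 0\<close> by (simp add: c_def)
    finally obtain \<phi> where "\<phi> \<in> test_fun" "deriv \<phi> = (\<lambda>x. \<psi> x + c * e x)"
      using test_fun_primitive[OF \<chi>] by blast
    then have "0 = regular f \<psi> + c *\<^sub>R regular f e"
      using zero[of \<phi>] regular_lincomb[OF \<psi> e f] by simp
    then show "regular (\<lambda>y. f y - C) \<psi> = 0"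
      unfolding regular_diff[OF \<psi> f C1] regular_const[OF \<psi>]
      by (simp add: c_def C_def divide_inverse)
  qed
  then show ?thesis by (intro exI[of _ C]) auto
qed

lemma weak_deriv_unique:
  assumes "has_weak_deriv w g" "has_weak_deriv w h"
  shows "AE y in lebesgue. y \<in> Iv \<longrightarrow> g y = h y"
proof -
  have L: "g \<in> L1_loc" "h \<in> L1_loc"
    using assms by (auto simp: has_weak_deriv_def)
  have "AE y in lebesgue. y \<in> Iv \<longrightarrow> g y - h y = 0"
    using assms L
    by (intro fundamental_lemma_cov L1_loc_diff) (auto simp: regular_diff has_weak_deriv_def)
  then show ?thesis by simp
qed

lemma has_weak_derivI_C1:
  assumes d: "\<And>y. y \<in> Iv \<Longrightarrow> (f has_vector_derivative g y) (at y)" and g: "continuous_on Iv g"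
  shows "has_weak_deriv f g"
proof -
  have cf: "continuous_on Iv f"
    using d by (meson continuous_at_imp_continuous_on has_vector_derivative_continuous)
  have L: "f \<in> L1_loc" "g \<in> L1_loc"
    using cf g by (auto intro: continuous_L1_loc)
  have "- regular f (deriv \<phi>) = regular g \<phi>" if \<phi>: "\<phi> \<in> test_fun" for \<phi>
  proof -
    obtain a b where ab: "-1 < a" "a < b" "b < 1" and supp: "\<forall>x. x \<notin> {a..b} \<longrightarrow> \<phi> x = 0"
      by (rule test_fun_supportE[OF \<phi>])
    \<comment> \<open>The interval is enlarged because \<open>supp\<close> says nothing about the
      values at \<open>a\<close> and \<open>b\<close>; at the new end points \<open>\<phi>\<close>
      does vanish, so the boundary terms drop out.\<close>
    define a' b' where "a' = (a - 1) / 2" and "b' = (b + 1) / 2"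
    have ab': "-1 < a'" "a' < a" "b < b'" "b' < 1" "a' < b'"
      using ab by (auto simp: a'_def b'_def)
    have supp': "\<forall>x. x \<notin> {a'..b'} \<longrightarrow> \<phi> x = 0"
      using supp ab' by auto
    have z: "\<phi> a' = 0" "\<phi> b' = 0"
      using supp ab' by auto
    have "((\<lambda>y. \<phi> y *\<^sub>R g y + deriv \<phi> y *\<^sub>R f y) has_integral (\<phi> b' *\<^sub>R f b' - \<phi> a' *\<^sub>R f a')) {a'..b'}"
    proof (rule fundamental_theorem_of_calculus)
      fix x assume "x \<in> {a'..b'}"
      then have "x \<in> Iv" using ab' by auto
      have "((\<lambda>y. \<phi> y *\<^sub>R f y) has_vector_derivative \<phi> x *\<^sub>R g x + deriv \<phi> x *\<^sub>R f x) (at x)"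
        using has_vector_derivative_scaleR[OF test_fun_has_deriv[OF \<phi>] d[OF \<open>x \<in> Iv\<close>]] by simp
      then show "((\<lambda>y. \<phi> y *\<^sub>R f y) has_vector_derivative \<phi> x *\<^sub>R g x + deriv \<phi> x *\<^sub>R f x) (at x within {a'..b'})"
        by (rule has_vector_derivative_at_within)
    qed (use ab' in simp)
    then have "integral {a'..b'} (\<lambda>y. \<phi> y *\<^sub>R g y + deriv \<phi> y *\<^sub>R f y) = 0"
      using z by (simp add: integral_unique)
    moreover have "integral {a'..b'} (\<lambda>y. \<phi> y *\<^sub>R g y + deriv \<phi> y *\<^sub>R f y)
      = integral {a'..b'} (\<lambda>y. \<phi> y *\<^sub>R g y) + integral {a'..b'} (\<lambda>y. deriv \<phi> y *\<^sub>R f y)"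
      using ab' L \<phi>
      by (intro integral_add set_lebesgue_integral_eq_integral(1) absolutely_integrable_scaleR_continuous
          test_fun_continuous test_fun_deriv L1_locD)
    moreover have "regular g \<phi> = integral {a'..b'} (\<lambda>y. \<phi> y *\<^sub>R g y)"
      using ab' L \<phi> supp' by (intro regular_eq_integral(2) test_fun_continuous)
    moreover have "regular f (deriv \<phi>) = integral {a'..b'} (\<lambda>y. deriv \<phi> y *\<^sub>R f y)"
      using ab' L \<phi> deriv_0_outside[OF supp']
      by (intro regular_eq_integral(2) test_fun_continuous test_fun_deriv) blast
    ultimately show ?thesis
      by (simp add: add_eq_0_iff)
  qed
  then show ?thesis
    using L by (simp add: has_weak_deriv_def distr_deriv_def)
qed

subsection \<open>Primitives of locally integrable functions\<close>

text \<open>One of the two integrals always ranges over an empty or one-point interval.\<close>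

definition primitive :: "(real \<Rightarrow> complex) \<Rightarrow> real \<Rightarrow> complex" where
  "primitive g y = integral {0..y} g - integral {y..0} g"

lemma L1_loc_integrable: "g \<in> L1_loc \<Longrightarrow> -1 < a \<Longrightarrow> b < 1 \<Longrightarrow> g integrable_on {a..b}"
  by (rule set_lebesgue_integral_eq_integral(1)[OF L1_locD])

lemma L1_loc_norm_integrable:
  "g \<in> L1_loc \<Longrightarrow> -1 < a \<Longrightarrow> b < 1 \<Longrightarrow> (\<lambda>y. norm (g y)) integrable_on {a..b}"
  using L1_locD absolutely_integrable_on_def by blast

lemma primitive_diff:
  assumes "g \<in> L1_loc" "-1 < x" "x \<le> y" "y < 1"
  shows "primitive g y - primitive g x = integral {x..y} g"
proof -
  have *: "integral {u..v} g + integral {v..w} g = integral {u..w} g"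
    if "-1 < u" "u \<le> v" "v \<le> w" "w < 1" for u v w
    using that by (intro Henstock_Kurzweil_Integration.integral_combine L1_loc_integrable assms)
  have single: "integral {u..v} g = 0" if "v \<le> u" for u v
    using that by (cases "u = v") auto
  consider "0 \<le> x" | "y \<le> 0" | "x < 0" "0 < y" using assms by linarith
  then show ?thesis
  proof cases
    case 1
    then show ?thesis using *[of 0 x y] assms by (simp add: primitive_def single algebra_simps)
  next
    case 2
    then show ?thesis using *[of x y 0] assms by (simp add: primitive_def single algebra_simps)
  next
    case 3
    then show ?thesis using *[of x 0 y] assms by (simp add: primitive_def single algebra_simps)
  qed
qed

lemma continuous_on_IvI:
  fixes f :: "real \<Rightarrow> 'a::topological_space"
  assumes "\<And>a b. -1 < a \<Longrightarrow> a < b \<Longrightarrow> b < 1 \<Longrightarrow> continuous_on {a..b} f"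
  shows "continuous_on Iv f"
proof (rule continuous_at_imp_continuous_on, rule ballI)
  fix x assume "x \<in> Iv"
  then have "continuous_on {(x - 1) / 2..(x + 1) / 2} f" "x \<in> {(x - 1) / 2<..<(x + 1) / 2}"
    by (auto intro!: assms)
  then show "isCont f x"
    by (meson continuous_on_eq_continuous_at continuous_on_subset greaterThanLessThan_subseteq_atLeastAtMost_iff
        open_greaterThanLessThan order_refl)
qed

lemma primitive_continuous:
  assumes "g \<in> L1_loc"
  shows "continuous_on Iv (primitive g)"
proof (rule continuous_on_IvI)
  fix a b :: real assume ab: "-1 < a" "a < b" "b < 1"
  have "continuous_on {a..b} (\<lambda>x. primitive g a + integral {a..x} g)"
    by (intro continuous_intros indefinite_integral_continuous_1 L1_loc_integrable assms ab)
  moreover have "primitive g a + integral {a..x} g = primitive g x" if "x \<in> {a..b}" for x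
    using primitive_diff[OF assms ab(1), of x] that ab by (simp add: algebra_simps)
  ultimately show "continuous_on {a..b} (primitive g)"
    by (rule continuous_on_eq)
qed

lemma primitive_has_vector_derivative:
  assumes g: "continuous_on Iv g" and x: "x \<in> Iv"
  shows "(primitive g has_vector_derivative g x) (at x)"
proof -
  define a b where "a = (x - 1) / 2" and "b = (x + 1) / 2"
  have ab: "-1 < a" "a < x" "x < b" "b < 1"
    using x by (auto simp: a_def b_def)
  have L: "g \<in> L1_loc" using g by (rule continuous_L1_loc)
  have "((\<lambda>u. integral {a..u} g) has_vector_derivative g x) (at x within {a..b})"
    using ab g by (intro integral_has_vector_derivative) (auto elim: continuous_on_subset)
  then have "((\<lambda>u. integral {a..u} g) has_vector_derivative g x) (at x)"
    using ab by (simp add: at_within_Icc_at)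
  then have "((\<lambda>u. primitive g a + integral {a..u} g) has_vector_derivative g x) (at x)"
    by (auto intro!: derivative_eq_intros)
  then show ?thesis
  proof (rule has_vector_derivative_transform_within_open[where S="{a<..<b}"])
    fix u assume "u \<in> {a<..<b}"
    then show "primitive g a + integral {a..u} g = primitive g u"
      using primitive_diff[OF L ab(1), of u] ab by (simp add: algebra_simps)
  qed (use ab in auto)
qed

text \<open>Dividing by \<open>y - x\<close> leaves an increment of the continuous \<open>H\<close>,
  which tends to 0. So \<open>D\<close> has derivative 0 at every point and not merely at almost
  every one, which would not suffice for constancy.\<close>

lemma const_if_increment_small:
  fixes D :: "real \<Rightarrow> complex" and H :: "real \<Rightarrow> real"
  assumes H: "continuous_on {a..b} H" and ab: "a \<le> b"
    and le: "\<And>x y. a \<le> x \<Longrightarrow> x \<le> y \<Longrightarrow> y \<le> b \<Longrightarrow> norm (D y - D x) \<le> (y - x) * \<bar>H y - H x\<bar>"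
  shows "D b = D a"
proof -
  have "(D has_derivative (\<lambda>_. 0)) (at x within {a..b})" if x: "x \<in> {a..b}" for x
    unfolding has_derivative_iff_norm
  proof
    show "bounded_linear (\<lambda>_. 0 :: complex)" by (rule bounded_linear_zero)
    have "((\<lambda>y. \<bar>H y - H x\<bar>) \<longlongrightarrow> \<bar>H x - H x\<bar>) (at x within {a..b})"
      using H x by (intro tendsto_intros) (auto simp: continuous_on_def)
    moreover have "norm (norm (D y - D x - 0) / norm (y - x)) \<le> \<bar>H y - H x\<bar>" if "y \<in> {a..b}" "y \<noteq> x" for y
    proof -
      have "norm (D y - D x) \<le> \<bar>y - x\<bar> * \<bar>H y - H x\<bar>"
        using le[of x y] le[of y x] that x
        by (cases "x \<le> y") (auto simp: norm_minus_commute abs_minus_commute)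
      then show ?thesis
        using that by (simp add: divide_le_eq mult.commute)
    qed
    then have "\<forall>\<^sub>F y in at x within {a..b}. norm (norm (D y - D x - 0) / norm (y - x)) \<le> \<bar>H y - H x\<bar>"
      by (simp add: eventually_at_filter)
    ultimately show "((\<lambda>y. norm (D y - D x - 0) / norm (y - x)) \<longlongrightarrow> 0) (at x within {a..b})"
      by (simp add: Lim_null_comparison)
  qed
  then show ?thesis
    using ab by (intro has_derivative_zero_unique[of "{a..b}"]) auto
qed

lemma test_fun_Lipschitz:
  assumes "\<phi> \<in> test_fun"
  obtains L where "L \<ge> 0" "\<And>x. \<bar>deriv \<phi> x\<bar> \<le> L" "\<And>x y. \<bar>\<phi> y - \<phi> x\<bar> \<le> L * \<bar>y - x\<bar>"
proof -
  obtain a b where ab: "-1 < a" "a < b" "b < 1" and supp: "\<forall>x. x \<notin> {a..b} \<longrightarrow> deriv \<phi> x = 0"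
    by (rule test_fun_supportE[OF test_fun_deriv[OF assms]])
  have "bounded (deriv \<phi> ` {a..b})"
    by (intro compact_imp_bounded compact_continuous_image test_fun_continuous test_fun_deriv assms) simp
  then obtain L where L: "L > 0" "\<forall>x\<in>{a..b}. \<bar>deriv \<phi> x\<bar> \<le> L"
    by (auto simp: bounded_pos)
  have le: "\<bar>deriv \<phi> x\<bar> \<le> L" for x
    using L supp by (cases "x \<in> {a..b}") auto
  moreover have "\<bar>\<phi> y - \<phi> x\<bar> \<le> L * \<bar>y - x\<bar>" for x y
    using field_differentiable_bound[of UNIV \<phi> "deriv \<phi>" L y x] test_fun_has_deriv[OF assms] le
    by auto
  ultimately show ?thesis using that[of L] L by simp
qed

text \<open>Integration by parts when one factor is only a primitive of an integrable function.
  Freezing each factor at one end of a short interval makes the formula exact; the error is at most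
  its length times a constant times the integral of |g| over it, an increment of the kind treated in
  \<open>const_if_increment_small\<close>.\<close>

lemma primitive_weak_deriv:
  assumes g: "g \<in> L1_loc" and \<phi>: "\<phi> \<in> test_fun"
  shows "regular (primitive g) (deriv \<phi>) = - regular g \<phi>"
proof -
  let ?F = "primitive g"
  have F: "?F \<in> L1_loc"
    using primitive_continuous[OF g] by (rule continuous_L1_loc)
  obtain a0 b0 where ab0: "-1 < a0" "a0 < b0" "b0 < 1" and supp0: "\<forall>x. x \<notin> {a0..b0} \<longrightarrow> \<phi> x = 0"
    by (rule test_fun_supportE[OF \<phi>])
  define a b where "a = (a0 - 1) / 2" and "b = (b0 + 1) / 2"
  have ab: "-1 < a" "a < a0" "b0 < b" "b < 1" "a < b"
    using ab0 by (auto simp: a_def b_def)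
  have supp: "\<forall>x. x \<notin> {a..b} \<longrightarrow> \<phi> x = 0"
    using supp0 ab by auto
  have z: "\<phi> a = 0" "\<phi> b = 0"
    using supp0 ab by auto
  obtain L where L: "L \<ge> 0" "\<And>x. \<bar>deriv \<phi> x\<bar> \<le> L" "\<And>x y. \<bar>\<phi> y - \<phi> x\<bar> \<le> L * \<bar>y - x\<bar>"
    using test_fun_Lipschitz[OF \<phi>] by blast
  have d: "deriv \<phi> \<in> test_fun"
    using \<phi> by (rule test_fun_deriv)
  define k where "k t = deriv \<phi> t *\<^sub>R ?F t + \<phi> t *\<^sub>R g t" for t
  \<comment> \<open>\<open>D\<close> is the defect in the product rule. As \<open>\<phi>\<close>
    vanishes at both ends, \<open>D b = D a\<close> is the integration by parts formula.\<close>
  define D where "D x = integral {a..x} k - \<phi> x *\<^sub>R ?F x" for x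
  define G where "G x = integral {a..x} (\<lambda>t. norm (g t))" for x
  have int1: "(\<lambda>t. \<psi> t *\<^sub>R g t) integrable_on {x..y}" "(\<lambda>t. \<psi> t *\<^sub>R ?F t) integrable_on {x..y}"
    if "-1 < x" "y < 1" "\<psi> \<in> test_fun" for x y \<psi>
    using that
    by (auto intro!: set_lebesgue_integral_eq_integral(1) absolutely_integrable_scaleR_continuous
        test_fun_continuous L1_locD g F)
  have kint: "k integrable_on {x..y}" if "-1 < x" "y < 1" for x y
    unfolding k_def by (intro integrable_add int1 that \<phi> d)
  have "D b = D a"
  proof (rule const_if_increment_small[where H="\<lambda>x. 2 * L * G x"])
    show "continuous_on {a..b} (\<lambda>x. 2 * L * G x)"
      unfolding G_def using ab
      by (intro continuous_intros indefinite_integral_continuous_1 L1_loc_norm_integrable g)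
    fix x y assume xy: "a \<le> x" "x \<le> y" "y \<le> b"
    then have xy1: "-1 < x" "y < 1" using ab by auto
    have Gd: "G y - G x = integral {x..y} (\<lambda>t. norm (g t))"
      using Henstock_Kurzweil_Integration.integral_combine[OF xy(1,2) L1_loc_norm_integrable[OF g ab(1) xy1(2)]]
      unfolding G_def by linarith
    have G0: "0 \<le> G y - G x"
      unfolding Gd by (intro integral_nonneg L1_loc_norm_integrable g xy1) auto
    have Fd: "norm (?F y - ?F t) \<le> G y - G x" if "t \<in> {x..y}" for t
    proof -
      have "?F y - ?F t = integral {t..y} g"
        using that xy1 by (intro primitive_diff g) auto
      also have "norm \<dots> \<le> integral {t..y} (\<lambda>t. norm (g t))"
        using that xy1
        by (intro Henstock_Kurzweil_Integration.integral_norm_bound_integral L1_loc_integrable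
            L1_loc_norm_integrable g) auto
      also have "\<dots> \<le> G y - G x"
        unfolding Gd using that xy1
        by (intro integral_subset_le L1_loc_norm_integrable g) auto
      finally show ?thesis .
    qed
    have intD: "integral {a..y} k - integral {a..x} k = integral {x..y} k"
      using Henstock_Kurzweil_Integration.integral_combine[OF xy(1,2) kint[OF ab(1) xy1(2)]] by (simp add: algebra_simps)
    have "((deriv \<phi>) has_integral (\<phi> y - \<phi> x)) {x..y}"
      using test_fun_has_deriv[OF \<phi>] xy
      by (intro fundamental_theorem_of_calculus)
         (auto simp: has_real_derivative_iff_has_vector_derivative[symmetric] intro: has_field_derivative_at_within)
    then have i1: "((\<lambda>t. deriv \<phi> t *\<^sub>R ?F y) has_integral ((\<phi> y - \<phi> x) *\<^sub>R ?F y)) {x..y}"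
      by (rule has_integral_scaleR_left)
    have i2: "((\<lambda>t. \<phi> x *\<^sub>R g t) has_integral (\<phi> x *\<^sub>R (?F y - ?F x))) {x..y}"
      unfolding primitive_diff[OF g xy1(1) xy(2) xy1(2)]
      by (intro has_integral_cmul integrable_integral L1_loc_integrable g xy1)
    \<comment> \<open>With F frozen at \<open>y\<close> and \<open>\<phi>\<close> frozen at
      \<open>x\<close>, the integrals of the two products add up to
      \<open>\<phi> y *\<^sub>R ?F y - \<phi> x *\<^sub>R ?F x\<close>, so only the error of
      freezing remains in \<open>D y - D x\<close>.\<close>
    have "((\<lambda>t. k t - (deriv \<phi> t *\<^sub>R ?F y + \<phi> x *\<^sub>R g t)) has_integral
        (integral {x..y} k - ((\<phi> y - \<phi> x) *\<^sub>R ?F y + \<phi> x *\<^sub>R (?F y - ?F x)))) {x..y}"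
      by (intro has_integral_diff has_integral_add i1 i2 integrable_integral kint xy1)
    moreover have "integral {x..y} k - ((\<phi> y - \<phi> x) *\<^sub>R ?F y + \<phi> x *\<^sub>R (?F y - ?F x)) = D y - D x"
      unfolding D_def intD[symmetric] by (simp add: algebra_simps)
    ultimately have Dint: "((\<lambda>t. k t - (deriv \<phi> t *\<^sub>R ?F y + \<phi> x *\<^sub>R g t)) has_integral (D y - D x)) {x..y}"
      by simp
    have bd: "norm (k t - (deriv \<phi> t *\<^sub>R ?F y + \<phi> x *\<^sub>R g t))
       \<le> L * (G y - G x) + L * (y - x) * norm (g t)" if t: "t \<in> {x..y}" for t
    proof -
      have "k t - (deriv \<phi> t *\<^sub>R ?F y + \<phi> x *\<^sub>R g t)
          = (\<phi> t - \<phi> x) *\<^sub>R g t - deriv \<phi> t *\<^sub>R (?F y - ?F t)"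
        by (simp add: k_def algebra_simps)
      also have "norm \<dots> \<le> \<bar>\<phi> t - \<phi> x\<bar> * norm (g t) + \<bar>deriv \<phi> t\<bar> * norm (?F y - ?F t)"
        by (rule order_trans[OF norm_triangle_ineq4]) simp
      also have "\<dots> \<le> (L * (y - x)) * norm (g t) + L * (G y - G x)"
      proof (intro add_mono mult_right_mono mult_mono Fd t L)
        have "\<bar>\<phi> t - \<phi> x\<bar> \<le> L * \<bar>t - x\<bar>" by (rule L)
        also have "\<dots> \<le> L * (y - x)"
          using t L by (intro mult_left_mono) auto
        finally show "\<bar>\<phi> t - \<phi> x\<bar> \<le> L * (y - x)" .
      qed auto
      finally show ?thesis by simp
    qed
    have "((\<lambda>t. L * (G y - G x)) has_integral ((y - x) * (L * (G y - G x)))) {x..y}"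
      using has_integral_const_real[of "L * (G y - G x)" x y] xy by simp
    moreover have "((\<lambda>t. L * (y - x) * norm (g t)) has_integral (L * (y - x) * (G y - G x))) {x..y}"
      unfolding Gd by (intro has_integral_mult_right integrable_integral L1_loc_norm_integrable g xy1)
    ultimately have bd_int: "((\<lambda>t. L * (G y - G x) + L * (y - x) * norm (g t)) has_integral
        ((y - x) * (L * (G y - G x)) + L * (y - x) * (G y - G x))) {x..y}"
      by (rule has_integral_add)
    have "norm (D y - D x) \<le> integral {x..y} (\<lambda>t. L * (G y - G x) + L * (y - x) * norm (g t))"
      unfolding integral_unique[OF Dint, symmetric]
      using Dint bd_int bd
      by (intro Henstock_Kurzweil_Integration.integral_norm_bound_integral) blast+
    also have "\<dots> = (y - x) * (L * (G y - G x)) + L * (y - x) * (G y - G x)"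
      using bd_int by (rule integral_unique)
    also have "\<dots> = (y - x) * \<bar>2 * L * G y - 2 * L * G x\<bar>"
    proof -
      have "\<bar>2 * L * G y - 2 * L * G x\<bar> = 2 * L * (G y - G x)"
        unfolding right_diff_distrib[symmetric] using G0 L(1) by (intro abs_of_nonneg mult_nonneg_nonneg) auto
      then show ?thesis by (simp only:) (simp add: algebra_simps)
    qed
    finally show "norm (D y - D x) \<le> (y - x) * \<bar>2 * L * G y - 2 * L * G x\<bar>" .
  qed (use ab in auto)
  then have "integral {a..b} k = 0"
    by (simp add: D_def z)
  moreover have "integral {a..b} k = regular ?F (deriv \<phi>) + regular g \<phi>"
  proof -
    have "integral {a..b} k = integral {a..b} (\<lambda>t. deriv \<phi> t *\<^sub>R ?F t) + integral {a..b} (\<lambda>t. \<phi> t *\<^sub>R g t)"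
      unfolding k_def by (intro integral_add int1 ab \<phi> d)
    moreover have "regular g \<phi> = integral {a..b} (\<lambda>y. \<phi> y *\<^sub>R g y)"
      using ab g \<phi> supp by (intro regular_eq_integral(2) test_fun_continuous)
    moreover have "regular ?F (deriv \<phi>) = integral {a..b} (\<lambda>y. deriv \<phi> y *\<^sub>R ?F y)"
      using ab F d deriv_0_outside[OF supp]
      by (intro regular_eq_integral(2) test_fun_continuous) blast
    ultimately show ?thesis by simp
  qed
  ultimately show ?thesis
    by (simp add: add_eq_0_iff)
qed

text \<open>\<open>f - primitive g\<close> has weak derivative zero and is therefore constant almost
  everywhere.\<close>

lemma du_Bois_Reymond:
  assumes f: "f \<in> L1_loc" and g: "g \<in> L1_loc"
    and eq: "\<And>\<phi>. \<phi> \<in> test_fun \<Longrightarrow> regular f (deriv \<phi>) = - regular g \<phi>"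
  shows "\<exists>C. AE y in lebesgue. y \<in> Iv \<longrightarrow> f y = C + primitive g y"
proof -
  have F: "primitive g \<in> L1_loc"
    using primitive_continuous[OF g] by (rule continuous_L1_loc)
  have "\<exists>C. AE y in lebesgue. y \<in> Iv \<longrightarrow> f y - primitive g y = C"
    using f F
    by (intro AE_const_if_weak_deriv_zero L1_loc_diff)
      (simp_all add: regular_diff test_fun_deriv eq primitive_weak_deriv[OF g])
  then obtain C where "AE y in lebesgue. y \<in> Iv \<longrightarrow> f y - primitive g y = C" ..
  then have "AE y in lebesgue. y \<in> Iv \<longrightarrow> f y = C + primitive g y"
    by eventually_elim auto
  then show ?thesis ..
qed

subsection \<open>Regularity of stationary solutions\<close>

lemma AE_Iv_negligible:
  assumes "AE y in lebesgue. y \<in> Iv \<longrightarrow> P y"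
  obtains N where "negligible N" "\<And>y. y \<in> Iv \<Longrightarrow> y \<notin> N \<Longrightarrow> P y"
proof -
  from assms obtain N where N: "{y \<in> space lebesgue. \<not> (y \<in> Iv \<longrightarrow> P y)} \<subseteq> N" "emeasure lebesgue N = 0" "N \<in> sets lebesgue"
    by (rule AE_E)
  then have "negligible N"
    by (simp add: negligible_iff_null_sets null_setsI)
  then show ?thesis
    using N(1) by (intro that[of N]) auto
qed

lemma L1_loc_cong_AE:
  assumes "f \<in> L1_loc" "AE y in lebesgue. y \<in> Iv \<longrightarrow> f y = g y"
  shows "g \<in> L1_loc"
  unfolding L1_loc_iff
proof (intro allI impI)
  obtain N where N: "negligible N" "\<And>y. y \<in> Iv \<Longrightarrow> y \<notin> N \<Longrightarrow> f y = g y"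
    using AE_Iv_negligible[OF assms(2)] by blast
  fix a b :: real assume ab: "-1 < a" "b < 1"
  show "g absolutely_integrable_on {a..b}"
  proof (rule absolutely_integrable_spike[OF L1_locD[OF assms(1) ab] N(1)])
    show "g x = f x" if "x \<in> {a..b} - N" for x
      using N(2)[of x] that ab by auto
  qed
qed

lemma primitive_cong_AE:
  assumes "AE y in lebesgue. y \<in> Iv \<longrightarrow> f y = g y" "y \<in> Iv"
  shows "primitive f y = primitive g y"
proof -
  obtain N where N: "negligible N" "\<And>y. y \<in> Iv \<Longrightarrow> y \<notin> N \<Longrightarrow> f y = g y"
    using AE_Iv_negligible[OF assms(1)] by blast
  have "integral {a..b} f = integral {a..b} g" if "{a..b} \<subseteq> Iv" for a b
    using N that by (intro integral_spike[OF N(1)]) auto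
  then show ?thesis
    using assms(2) by (simp add: primitive_def subset_iff)
qed

section \<open>The weight and the weak equation without it\<close>

lemma one_minus_square_pos: "y \<in> Iv \<Longrightarrow> (0::real) < 1 - y\<^sup>2"
  by (simp add: abs_square_less_1 abs_less_iff)

lemma rho_pos: "y \<in> Iv \<Longrightarrow> rho p y > 0"
  using one_minus_square_pos[of y] by (simp add: rho_def)

lemma rho_has_deriv:
  assumes "y \<in> Iv"
  shows "(rho p has_real_derivative - (2 * (2 / (p - 1)) * y / (1 - y\<^sup>2)) * rho p y) (at y)"
proof -
  have "0 < 1 - y\<^sup>2" using assms by (rule one_minus_square_pos)
  then have "((\<lambda>y. (1 - y\<^sup>2) powr (2 / (p - 1))) has_real_derivative
      - (2 * (2 / (p - 1)) * y / (1 - y\<^sup>2)) * (1 - y\<^sup>2) powr (2 / (p - 1))) (at y)"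
    by (auto intro!: derivative_eq_intros simp: powr_diff)
  then show ?thesis by (simp add: rho_def[abs_def])
qed

lemma rho_continuous: "continuous_on Iv (rho p)"
  by (intro continuous_at_imp_continuous_on ballI DERIV_isCont[OF rho_has_deriv])

lemma rho_weight_has_deriv:
  assumes "y \<in> Iv"
  shows "((\<lambda>y. rho p y * (1 - y\<^sup>2)) has_real_derivative - (2 * (2 / (p - 1) + 1) * y) * rho p y) (at y)"
proof -
  have q: "1 - y\<^sup>2 \<noteq> 0" using one_minus_square_pos[OF assms] by simp
  have "((\<lambda>y. rho p y * (1 - y\<^sup>2)) has_real_derivative
      (- (2 * (2 / (p - 1)) * y / (1 - y\<^sup>2)) * rho p y) * (1 - y\<^sup>2) + (- 2 * y) * rho p y) (at y)"
    by (rule DERIV_mult[OF rho_has_deriv[OF assms]]) (auto intro!: derivative_eq_intros)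
  moreover have "(- (2 * (2 / (p - 1)) * y / (1 - y\<^sup>2)) * rho p y) * (1 - y\<^sup>2) = - (2 * (2 / (p - 1)) * y) * rho p y"
    using q by simp
  ultimately show ?thesis
    by (simp add: algebra_simps)
qed

lemma continuous_nonlinearity:
  fixes f :: "real \<Rightarrow> complex"
  assumes "continuous_on S f" "q > 0"
  shows "continuous_on S (\<lambda>y. (cmod (f y) powr q) *\<^sub>R f y)"
  using assms by (auto intro!: continuous_intros continuous_on_powr')

text \<open>The factor 1/rho and the derivative both pass to the test function, and (phi/rho)' =
  (phi' + 2 a y phi / (1 - y^2)) / rho with a = 2/(p-1). The weight cancels and polynomial
  coefficients remain. The identity is checked pointwise under the integral over (-1,1), so
  \<open>\<phi>\<close> divided by \<open>rho p\<close> never has to be a test function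
  itself.\<close>

lemma distr_operator_eq:
  assumes v: "v \<in> L1_loc" and \<phi>: "\<phi> \<in> test_fun"
  shows "distr_mult (\<lambda>y. 1 / rho p y) (distr_deriv (regular (\<lambda>y. (rho p y * (1 - y\<^sup>2)) *\<^sub>R v y))) \<phi>
    = - regular (\<lambda>y. (1 - y\<^sup>2) *\<^sub>R v y) (deriv \<phi>) - regular (\<lambda>y. (2 * (2 / (p - 1)) * y) *\<^sub>R v y) \<phi>"
proof -
  let ?a = "2 / (p - 1)"
  have L1: "(\<lambda>y. (1 - y\<^sup>2) *\<^sub>R v y) \<in> L1_loc"
    by (intro L1_loc_scaleR v continuous_intros)
  have L2: "(\<lambda>y. (2 * ?a * y) *\<^sub>R v y) \<in> L1_loc"
    by (intro L1_loc_scaleR v continuous_intros)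
  have d: "deriv (\<lambda>y. 1 / rho p y * \<phi> y) y = (deriv \<phi> y + 2 * ?a * y / (1 - y\<^sup>2) * \<phi> y) / rho p y"
    if "y \<in> Iv" for y
  proof (rule DERIV_imp_deriv)
    show "((\<lambda>y. 1 / rho p y * \<phi> y) has_real_derivative
        (deriv \<phi> y + 2 * ?a * y / (1 - y\<^sup>2) * \<phi> y) / rho p y) (at y)"
      using rho_pos[OF that, of p]
      by (auto intro!: derivative_eq_intros rho_has_deriv[OF that] test_fun_has_deriv[OF \<phi>]
          simp: add_divide_distrib mult_ac)
  qed
  have "regular (\<lambda>y. (rho p y * (1 - y\<^sup>2)) *\<^sub>R v y) (deriv (\<lambda>y. 1 / rho p y * \<phi> y))
      = (LINT y:Iv|lebesgue. deriv \<phi> y *\<^sub>R ((1 - y\<^sup>2) *\<^sub>R v y) + \<phi> y *\<^sub>R ((2 * ?a * y) *\<^sub>R v y))"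
    unfolding regular_def
  proof (rule set_lebesgue_integral_cong)
    show "\<forall>y. y \<in> Iv \<longrightarrow> deriv (\<lambda>y. 1 / rho p y * \<phi> y) y *\<^sub>R (rho p y * (1 - y\<^sup>2)) *\<^sub>R v y =
        deriv \<phi> y *\<^sub>R ((1 - y\<^sup>2) *\<^sub>R v y) + \<phi> y *\<^sub>R ((2 * ?a * y) *\<^sub>R v y)"
    proof (intro allI impI)
      fix y assume y: "y \<in> Iv"
      have "deriv (\<lambda>y. 1 / rho p y * \<phi> y) y * (rho p y * (1 - y\<^sup>2))
          = deriv \<phi> y * (1 - y\<^sup>2) + \<phi> y * (2 * ?a * y)"
      proof -
        have *: "(d + A * y / q * f) / r * (r * q) = d * q + f * (A * y)" if "r \<noteq> 0" "q \<noteq> 0" for d A q f r :: real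
          using that by (simp add: field_simps)
        show ?thesis
          unfolding d[OF y] by (rule *) (use rho_pos[OF y, of p] one_minus_square_pos[OF y] in auto)
      qed
      then show "deriv (\<lambda>y. 1 / rho p y * \<phi> y) y *\<^sub>R (rho p y * (1 - y\<^sup>2)) *\<^sub>R v y =
          deriv \<phi> y *\<^sub>R ((1 - y\<^sup>2) *\<^sub>R v y) + \<phi> y *\<^sub>R ((2 * ?a * y) *\<^sub>R v y)"
        by (simp only: scaleR_scaleR scaleR_add_left[symmetric])
    qed
  qed simp
  also have "\<dots> = regular (\<lambda>y. (1 - y\<^sup>2) *\<^sub>R v y) (deriv \<phi>) + regular (\<lambda>y. (2 * ?a * y) *\<^sub>R v y) \<phi>"
    unfolding regular_def
    by (intro set_integral_add(2) test_fun_mult_integrable test_fun_deriv \<phi> L1 L2)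
  finally show ?thesis
    by (simp add: distr_mult_def distr_deriv_def)
qed

text \<open>A bootstrap in three stages: \<open>w\<close> has a continuous representative W, so the
  nonlinear term is continuous; then (1 - y^2) w' is a primitive of a locally integrable function,
  so w' has a continuous representative V; finally both primitives have continuous integrands and
  are differentiable at every point.\<close>

lemma stationary_regularity:
  fixes p :: real and w :: "real \<Rightarrow> complex"
  defines "a \<equiv> 2 / (p - 1)"
  assumes p: "p > 1" and w: "w \<in> H1_loc" and eq: "stationary_solution p w"
  obtains W V where
    "AE y in lebesgue. y \<in> Iv \<longrightarrow> w y = W y"
    "AE y in lebesgue. y \<in> Iv \<longrightarrow> weak_deriv w y = V y"
    "\<And>y. y \<in> Iv \<Longrightarrow> (W has_vector_derivative V y) (at y)"
    "\<And>y. y \<in> Iv \<Longrightarrow> ((\<lambda>y. (1 - y\<^sup>2) *\<^sub>R V y) has_vector_derivative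
       (2 * a * y) *\<^sub>R V y + (a * (a + 1)) *\<^sub>R W y - (cmod (W y) powr (p - 1)) *\<^sub>R W y) (at y)"
proof -
  define v where "v = weak_deriv w"
  have hv: "has_weak_deriv w v"
    using w someI_ex[of "has_weak_deriv w"] unfolding v_def weak_deriv_def H1_loc_def by blast
  then have wL: "w \<in> L1_loc" and vL: "v \<in> L1_loc"
    and wv: "\<And>\<phi>. \<phi> \<in> test_fun \<Longrightarrow> - regular w (deriv \<phi>) = regular v \<phi>"
    by (auto simp: has_weak_deriv_def distr_deriv_def)
  have "\<exists>C. AE y in lebesgue. y \<in> Iv \<longrightarrow> w y = C + primitive v y"
    using wv by (intro du_Bois_Reymond wL vL) (metis minus_minus)
  then obtain C where C: "AE y in lebesgue. y \<in> Iv \<longrightarrow> w y = C + primitive v y" ..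
  define W where "W y = C + primitive v y" for y
  have wW: "AE y in lebesgue. y \<in> Iv \<longrightarrow> w y = W y"
    using C by (simp add: W_def)
  have Wc: "continuous_on Iv W"
    unfolding W_def by (intro continuous_intros primitive_continuous vL)
  define N where "N f y = (cmod (f y) powr (p - 1)) *\<^sub>R f y" for f :: "real \<Rightarrow> complex" and y
  have Nc: "continuous_on Iv (N W)"
    unfolding N_def using Wc p by (intro continuous_nonlinearity) auto
  have WL: "W \<in> L1_loc" and NL: "N W \<in> L1_loc"
    using Wc Nc by (auto intro: continuous_L1_loc)
  have NwW: "AE y in lebesgue. y \<in> Iv \<longrightarrow> N w y = N W y"
    using wW by eventually_elim (simp add: N_def)
  \<comment> \<open>The notion of solution does not ask the nonlinear term to be locally integrable;
    this comes from the continuous representative.\<close>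
  have NwL: "N w \<in> L1_loc"
    using NwW by (intro L1_loc_cong_AE[OF NL]) (auto elim: eventually_mono)
  define c where "c = a * (a + 1)"
  have c: "2 * (p + 1) / (p - 1)\<^sup>2 = c"
    using p by (simp add: c_def a_def field_simps power2_eq_square)
  define g where "g V y = (2 * a * y) *\<^sub>R V y + c *\<^sub>R W y - N W y" for V :: "real \<Rightarrow> complex" and y
  have L1: "(\<lambda>y. (2 * a * y) *\<^sub>R v y) \<in> L1_loc" and L2: "(\<lambda>y. c *\<^sub>R W y) \<in> L1_loc"
    and L3: "(\<lambda>y. (1 - y\<^sup>2) *\<^sub>R v y) \<in> L1_loc"
    by (intro L1_loc_scaleR vL WL continuous_intros)+
  have gL: "g v \<in> L1_loc"
    unfolding g_def by (intro L1_loc_diff L1_loc_add L1 L2 NL)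
  have "regular (\<lambda>y. (1 - y\<^sup>2) *\<^sub>R v y) (deriv \<phi>) = - regular (g v) \<phi>" if \<phi>: "\<phi> \<in> test_fun" for \<phi>
  proof -
    have "- regular (\<lambda>y. (1 - y\<^sup>2) *\<^sub>R v y) (deriv \<phi>) - regular (\<lambda>y. (2 * a * y) *\<^sub>R v y) \<phi>
        - c *\<^sub>R regular w \<phi> + regular (N w) \<phi> = 0"
      using eq[unfolded stationary_solution_def c, rule_format, OF \<phi>]
        distr_operator_eq[OF vL \<phi>, of p]
      unfolding N_def[abs_def] v_def a_def by argo
    moreover have "regular w \<phi> = regular W \<phi>"
      using wW by (rule regular_cong_AE[OF _ \<phi> wL WL])
    moreover have "regular (N w) \<phi> = regular (N W) \<phi>"
      using NwW by (rule regular_cong_AE[OF _ \<phi> NwL NL])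
    moreover have "regular (g v) \<phi> = regular (\<lambda>y. (2 * a * y) *\<^sub>R v y) \<phi> + c *\<^sub>R regular W \<phi> - regular (N W) \<phi>"
      unfolding g_def using L1 L2 NL
      by (simp add: regular_diff[OF \<phi>] regular_add[OF \<phi>] L1_loc_add regular_scaleR)
    ultimately show ?thesis
      by (simp add: algebra_simps add_eq_0_iff)
  qed
  then have "\<exists>C. AE y in lebesgue. y \<in> Iv \<longrightarrow> (1 - y\<^sup>2) *\<^sub>R v y = C + primitive (g v) y"
    by (intro du_Bois_Reymond L3 gL)
  then obtain C' where C': "AE y in lebesgue. y \<in> Iv \<longrightarrow> (1 - y\<^sup>2) *\<^sub>R v y = C' + primitive (g v) y" ..
  define V where "V y = (C' + primitive (g v) y) /\<^sub>R (1 - y\<^sup>2)" for y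
  have vV: "AE y in lebesgue. y \<in> Iv \<longrightarrow> v y = V y"
    using C'
  proof eventually_elim
    case (elim y)
    show ?case
    proof
      assume y: "y \<in> Iv"
      then show "v y = V y"
        using elim one_minus_square_pos[OF y] unfolding V_def
        by (metis divideR_right less_irrefl)
    qed
  qed
  have Vc: "continuous_on Iv V"
    unfolding V_def using one_minus_square_pos
    by (intro continuous_intros primitive_continuous gL) force
  have gc: "continuous_on Iv (g V)"
    unfolding g_def by (intro continuous_intros Vc Wc Nc)
  \<comment> \<open>Replacing \<open>v\<close> by the continuous \<open>V\<close> leaves the
    primitive unchanged, and now the fundamental theorem holds at every point instead of almost
    every one.\<close>
  have W': "(W has_vector_derivative V y) (at y)" if y: "y \<in> Iv" for y
  proof (rule has_vector_derivative_transform_within_open[where S=Iv])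
    show "((\<lambda>y. C + primitive V y) has_vector_derivative V y) (at y)"
      using primitive_has_vector_derivative[OF Vc y] by (auto intro!: derivative_eq_intros)
  qed (use y primitive_cong_AE[OF vV] in \<open>auto simp: W_def\<close>)
  have gvV: "AE y in lebesgue. y \<in> Iv \<longrightarrow> g v y = g V y"
    using vV by eventually_elim (simp add: g_def)
  have V': "((\<lambda>y. (1 - y\<^sup>2) *\<^sub>R V y) has_vector_derivative g V y) (at y)" if y: "y \<in> Iv" for y
  proof (rule has_vector_derivative_transform_within_open[where S=Iv])
    show "((\<lambda>y. C' + primitive (g V) y) has_vector_derivative g V y) (at y)"
      using primitive_has_vector_derivative[OF gc y] by (auto intro!: derivative_eq_intros)
    show "C' + primitive (g V) u = (1 - u\<^sup>2) *\<^sub>R V u" if "u \<in> Iv" for u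
      using primitive_cong_AE[OF gvV that] one_minus_square_pos[OF that] by (simp add: V_def)
  qed (use y in auto)
  show ?thesis
    using that[OF wW vV[unfolded v_def] W' V'[unfolded g_def N_def c_def]] .
qed

subsection \<open>Conserved quantities of the stationary equation\<close>

text \<open>Covers the zeros of W, where the usual rule for powers of positive functions does not
  apply; the exponent needed later is (p + 1)/2 > 1.\<close>

lemma abs_powr_has_deriv_0:
  fixes s :: real
  assumes "s > 1"
  shows "((\<lambda>t. \<bar>t\<bar> powr s) has_real_derivative 0) (at 0)"
proof -
  have "((\<lambda>h. \<bar>h\<bar> powr (s - 1)) \<longlongrightarrow> \<bar>0::real\<bar> powr (s - 1)) (at 0)"
    using assms by (intro tendsto_powr' tendsto_rabs tendsto_ident_at tendsto_const) auto
  then have "((\<lambda>h::real. \<bar>h\<bar> powr (s - 1)) \<longlongrightarrow> 0) (at 0)"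
    using assms by simp
  moreover have "\<forall>\<^sub>F h in at 0. norm (\<bar>h\<bar> powr s / h) \<le> \<bar>h\<bar> powr (s - 1)"
    by (auto simp: eventually_at_filter powr_diff)
  ultimately have "((\<lambda>h. \<bar>h\<bar> powr s / h) \<longlongrightarrow> 0) (at 0)"
    by (rule Lim_null_comparison[rotated])
  then show ?thesis
    using assms by (simp add: DERIV_def)
qed

lemma powr_has_deriv_nonneg:
  fixes n :: "real \<Rightarrow> real"
  assumes n: "(n has_real_derivative n') (at y)" and nonneg: "\<And>x. n x \<ge> 0" and s: "s > 1"
  shows "((\<lambda>x. n x powr s) has_real_derivative s * n y powr (s - 1) * n') (at y)"
proof (cases "n y = 0")
  case True
  have "((\<lambda>x. \<bar>n x\<bar> powr s) has_real_derivative 0 * n') (at y)"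
    by (rule DERIV_chain2[OF _ n]) (use abs_powr_has_deriv_0[OF s] True in simp)
  then show ?thesis
    using True nonneg s by simp
next
  case False
  then have "n y > 0" using nonneg[of y] by simp
  then show ?thesis
    by (auto intro!: derivative_eq_intros n simp: powr_diff)
qed

lemma has_vector_derivative_Re_Im:
  assumes "(f has_vector_derivative f') (at y)"
  shows "((\<lambda>x. Re (f x)) has_real_derivative Re f') (at y)"
    and "((\<lambda>x. Im (f x)) has_real_derivative Im f') (at y)"
  using bounded_linear.has_vector_derivative[OF bounded_linear_Re assms]
    bounded_linear.has_vector_derivative[OF bounded_linear_Im assms]
  by (simp_all add: has_real_derivative_iff_has_vector_derivative)

locale stationary_ode =
  fixes p a :: real and W V :: "real \<Rightarrow> complex"
  assumes p: "p > 1" and a_def: "a = 2 / (p - 1)"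
    and W_deriv: "\<And>y. y \<in> Iv \<Longrightarrow> (W has_vector_derivative V y) (at y)"
    and V_deriv: "\<And>y. y \<in> Iv \<Longrightarrow> ((\<lambda>y. (1 - y\<^sup>2) *\<^sub>R V y) has_vector_derivative
       (2 * a * y) *\<^sub>R V y + (a * (a + 1)) *\<^sub>R W y - (cmod (W y) powr (p - 1)) *\<^sub>R W y) (at y)"
begin

abbreviation "u1 y \<equiv> Re (W y)"
abbreviation "u2 y \<equiv> Im (W y)"
abbreviation "v1 y \<equiv> Re (V y)"
abbreviation "v2 y \<equiv> Im (V y)"

text \<open>|W|^2, together with |W'|^2 and the real inner product of W and W' below: quadratic in
  the real coordinates, hence differentiable even where W vanishes. The inner product
  \<open>R\<close> is half the derivative of \<open>n\<close>.\<close>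

definition n where "n y = (u1 y)\<^sup>2 + (u2 y)\<^sup>2"
definition VV where "VV y = (v1 y)\<^sup>2 + (v2 y)\<^sup>2"
definition R where "R y = u1 y * v1 y + u2 y * v2 y"
definition f where "f y = cmod (W y) powr (p - 1)"

lemma a_pos: "a > 0"
  using p by (simp add: a_def)

lemma a_p: "(p + 1) / (p - 1) = a + 1" "2 / (p + 1) * (a + 1) = a" "(p - 1) / 2 * a = 1"
  "(p - 1) / 2 + 1 = (p - 1) / 2 * (a + 1)"
proof -
  show 1: "(p + 1) / (p - 1) = a + 1"
    using p by (simp add: a_def field_simps)
  have "2 / (p + 1) * ((p + 1) / (p - 1)) = a"
  proof -
    have "2 / x * (x / z) = 2 / z" if "x \<noteq> 0" for x z :: real
      using that by simp
    from this[of "p + 1" "p - 1"] show ?thesis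
      using p by (simp only: a_def)
  qed
  then show "2 / (p + 1) * (a + 1) = a"
    by (simp only: 1)
  show 3: "(p - 1) / 2 * a = 1"
    using p by (simp add: a_def)
  then show "(p - 1) / 2 + 1 = (p - 1) / 2 * (a + 1)"
    by (simp only: distrib_left)
qed

lemma cmod_W: "cmod (W y) = sqrt (n y)"
  by (simp add: n_def cmod_def)

lemma n_nonneg: "n y \<ge> 0"
  by (simp add: n_def)

lemma VV_nonneg: "VV y \<ge> 0"
  by (simp add: VV_def)

lemma cmod_W_powr: "cmod (W y) powr q = n y powr (q / 2)"
  using n_nonneg[of y] by (simp add: cmod_W powr_half_sqrt[symmetric] powr_powr)

lemma f_eq: "f y = n y powr ((p - 1) / 2)"
  by (simp add: f_def cmod_W_powr)

lemma f_nonneg: "f y \<ge> 0"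
  by (simp add: f_def)

lemma u_deriv:
  assumes "y \<in> Iv"
  shows "(u1 has_real_derivative v1 y) (at y)" "(u2 has_real_derivative v2 y) (at y)"
  using has_vector_derivative_Re_Im[OF W_deriv[OF assms]] by auto

lemma v_deriv:
  assumes y: "y \<in> Iv"
  shows "(v1 has_real_derivative (2 * (a + 1) * y * v1 y + a * (a + 1) * u1 y - f y * u1 y) / (1 - y\<^sup>2)) (at y)"
    and "(v2 has_real_derivative (2 * (a + 1) * y * v2 y + a * (a + 1) * u2 y - f y * u2 y) / (1 - y\<^sup>2)) (at y)"
proof -
  have *: "(v has_real_derivative (2 * (a + 1) * y * v y + a * (a + 1) * u - f y * u) / (1 - y\<^sup>2)) (at y)"
    if v: "((\<lambda>y. (1 - y\<^sup>2) * v y) has_real_derivative 2 * a * y * v y + a * (a + 1) * u - f y * u) (at y)"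
    for v :: "real \<Rightarrow> real" and u
  proof (rule has_field_derivative_transform_within_open[where S=Iv])
    have q: "1 - y\<^sup>2 \<noteq> 0" using one_minus_square_pos[OF y] by simp
    have "((\<lambda>x. ((1 - x\<^sup>2) * v x) / (1 - x\<^sup>2)) has_real_derivative
       ((2 * a * y * v y + a * (a + 1) * u - f y * u) * (1 - y\<^sup>2) - (1 - y\<^sup>2) * v y * (- 2 * y)) / ((1 - y\<^sup>2) * (1 - y\<^sup>2))) (at y)"
    proof (rule DERIV_divide[OF v])
      show "((\<lambda>y. 1 - y\<^sup>2) has_real_derivative - 2 * y) (at y)"
        by (auto intro!: derivative_eq_intros)
    qed (rule q)
    also have "((2 * a * y * v y + a * (a + 1) * u - f y * u) * (1 - y\<^sup>2) - (1 - y\<^sup>2) * v y * (- 2 * y)) / ((1 - y\<^sup>2) * (1 - y\<^sup>2))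
      = (2 * (a + 1) * y * v y + a * (a + 1) * u - f y * u) / (1 - y\<^sup>2)"
    proof -
      have "(A * q - q * v y * (- 2 * y)) / (q * q) = (A + 2 * y * v y) / q" if "q \<noteq> 0" for A q :: real
        using that by (simp add: field_simps)
      from this[OF q] show ?thesis
        by (simp only:) (rule arg_cong2[where f="(/)"], simp_all add: algebra_simps)
    qed
    finally show "((\<lambda>x. ((1 - x\<^sup>2) * v x) / (1 - x\<^sup>2)) has_real_derivative
        (2 * (a + 1) * y * v y + a * (a + 1) * u - f y * u) / (1 - y\<^sup>2)) (at y)" .
    show "(1 - x\<^sup>2) * v x / (1 - x\<^sup>2) = v x" if "x \<in> Iv" for x
      using one_minus_square_pos[OF that] by simp
  qed (use y in auto)
  show "(v1 has_real_derivative (2 * (a + 1) * y * v1 y + a * (a + 1) * u1 y - f y * u1 y) / (1 - y\<^sup>2)) (at y)"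
    by (rule *) (use has_vector_derivative_Re_Im(1)[OF V_deriv[OF y]] in \<open>simp add: f_def\<close>)
  show "(v2 has_real_derivative (2 * (a + 1) * y * v2 y + a * (a + 1) * u2 y - f y * u2 y) / (1 - y\<^sup>2)) (at y)"
    by (rule *) (use has_vector_derivative_Re_Im(2)[OF V_deriv[OF y]] in \<open>simp add: f_def\<close>)
qed

lemma n_deriv: "y \<in> Iv \<Longrightarrow> (n has_real_derivative 2 * R y) (at y)"
proof -
  assume y: "y \<in> Iv"
  have "((\<lambda>y. u1 y * u1 y + u2 y * u2 y) has_real_derivative
      (v1 y * u1 y + v1 y * u1 y) + (v2 y * u2 y + v2 y * u2 y)) (at y)"
    by (intro DERIV_add DERIV_mult u_deriv y)
  moreover have "(\<lambda>y. u1 y * u1 y + u2 y * u2 y) = n"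
    by (simp add: n_def fun_eq_iff power2_eq_square)
  ultimately show ?thesis
    by (simp add: R_def mult_ac)
qed

lemma R_deriv:
  assumes "y \<in> Iv"
  shows "(R has_real_derivative VV y + (2 * (a + 1) * y * R y + a * (a + 1) * n y - f y * n y) / (1 - y\<^sup>2)) (at y)"
proof -
  have q: "1 - y\<^sup>2 \<noteq> 0" using one_minus_square_pos[OF assms] by simp
  have d: "(R has_real_derivative
      (v1 y * v1 y + (2 * (a + 1) * y * v1 y + a * (a + 1) * u1 y - f y * u1 y) / (1 - y\<^sup>2) * u1 y)
    + (v2 y * v2 y + (2 * (a + 1) * y * v2 y + a * (a + 1) * u2 y - f y * u2 y) / (1 - y\<^sup>2) * u2 y)) (at y)"
    unfolding R_def[abs_def] by (intro DERIV_add DERIV_mult u_deriv v_deriv assms)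
  have e: "(v1 y * v1 y + (2 * (a + 1) * y * v1 y + a * (a + 1) * u1 y - f y * u1 y) / Q * u1 y)
    + (v2 y * v2 y + (2 * (a + 1) * y * v2 y + a * (a + 1) * u2 y - f y * u2 y) / Q * u2 y)
    = VV y + (2 * (a + 1) * y * R y + a * (a + 1) * n y - f y * n y) / Q" if "Q \<noteq> 0" for Q
    using that unfolding VV_def R_def n_def by (simp add: field_simps power2_eq_square)
  show ?thesis using d unfolding e[OF q] .
qed

lemma VV_deriv:
  assumes "y \<in> Iv"
  shows "(VV has_real_derivative 2 * (2 * (a + 1) * y * VV y + a * (a + 1) * R y - f y * R y) / (1 - y\<^sup>2)) (at y)"
proof -
  have q: "1 - y\<^sup>2 \<noteq> 0" using one_minus_square_pos[OF assms] by simp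
  let ?A1 = "2 * (a + 1) * y * v1 y + a * (a + 1) * u1 y - f y * u1 y"
  let ?A2 = "2 * (a + 1) * y * v2 y + a * (a + 1) * u2 y - f y * u2 y"
  have d: "((\<lambda>y. v1 y * v1 y + v2 y * v2 y) has_real_derivative
      (?A1 / (1 - y\<^sup>2) * v1 y + ?A1 / (1 - y\<^sup>2) * v1 y) + (?A2 / (1 - y\<^sup>2) * v2 y + ?A2 / (1 - y\<^sup>2) * v2 y)) (at y)"
    by (intro DERIV_add DERIV_mult u_deriv v_deriv assms)
  have e: "(?A1 / Q * v1 y + ?A1 / Q * v1 y) + (?A2 / Q * v2 y + ?A2 / Q * v2 y)
    = 2 * (2 * (a + 1) * y * VV y + a * (a + 1) * R y - f y * R y) / Q" if "Q \<noteq> 0" for Q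
    using that unfolding VV_def R_def by (simp add: field_simps power2_eq_square)
  have l: "(\<lambda>y. v1 y * v1 y + v2 y * v2 y) = VV"
    by (simp add: VV_def fun_eq_iff power2_eq_square)
  show ?thesis using d unfolding e[OF q] l .
qed

text \<open>This is |W|^(p+1); the product form is the one that appears when the equation is paired
  with W.\<close>

definition h where "h y = f y * n y"

lemma h_eq: "h y = n y powr ((p + 1) / 2)"
proof -
  have "(p + 1) / 2 = (p - 1) / 2 + 1" by (simp add: field_simps)
  then show ?thesis
    unfolding h_def f_eq using n_nonneg[of y] by (simp only: powr_add) simp
qed

lemma h_deriv:
  assumes "y \<in> Iv"
  shows "(h has_real_derivative (p + 1) * f y * R y) (at y)"
proof -
  have "((\<lambda>x. n x powr ((p + 1) / 2)) has_real_derivative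
      (p + 1) / 2 * n y powr ((p + 1) / 2 - 1) * (2 * R y)) (at y)"
    using p by (intro powr_has_deriv_nonneg n_deriv assms n_nonneg) auto
  moreover have "(p + 1) / 2 - 1 = (p - 1) / 2" by simp
  ultimately show ?thesis
    by (simp add: h_eq[abs_def] f_eq mult_ac)
qed

text \<open>With \<open>beta\<close> as prefactor this is |u_x|^2 - a^2 |u|^2 + 2/(p+1) |u|^(p+1),
  twice the mechanical energy of the autonomous equation, written in y; the common factor rho (1 -
  y^2) has been taken out.\<close>

definition S where
  "S y = (1 - y\<^sup>2) * VV y - 2 * a * y * R y - a\<^sup>2 * n y + 2 / (p + 1) * h y"

definition m where "m y = u1 y * v2 y - u2 y * v1 y"

definition beta where "beta y = rho p y * (1 - y\<^sup>2)"

lemma beta_pos: "y \<in> Iv \<Longrightarrow> beta y > 0"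
  using rho_pos one_minus_square_pos by (simp add: beta_def)

lemma beta_deriv:
  assumes "y \<in> Iv"
  shows "(beta has_real_derivative - (2 * (a + 1) * y) * rho p y) (at y)"
  unfolding beta_def[abs_def] a_def using assms by (rule rho_weight_has_deriv)

lemma beta_S_deriv:
  assumes y: "y \<in> Iv"
  shows "((\<lambda>y. beta y * S y) has_real_derivative 0) (at y)"
proof -
  have q: "1 - y\<^sup>2 \<noteq> 0" using one_minus_square_pos[OF y] by simp
  define Q where "Q = 1 - y\<^sup>2"
  define DVV where "DVV = 2 * (2 * (a + 1) * y * VV y + a * (a + 1) * R y - f y * R y) / Q"
  define DR where "DR = VV y + (2 * (a + 1) * y * R y + a * (a + 1) * n y - f y * n y) / Q"
  have dS: "(S has_real_derivative
      (- 2 * y) * VV y + Q * DVV - 2 * a * (R y + y * DR) - a\<^sup>2 * (2 * R y) + 2 / (p + 1) * ((p + 1) * f y * R y)) (at y)"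
    unfolding S_def[abs_def]
    apply (rule derivative_eq_intros VV_deriv[OF y] R_deriv[OF y] n_deriv[OF y] h_deriv[OF y] refl)+
    apply (simp add: DVV_def DR_def Q_def algebra_simps)
    done
  have "((\<lambda>y. beta y * S y) has_real_derivative
     (- (2 * (a + 1) * y) * rho p y) * S y +
     ((- 2 * y) * VV y + Q * DVV - 2 * a * (R y + y * DR) - a\<^sup>2 * (2 * R y) + 2 / (p + 1) * ((p + 1) * f y * R y)) * beta y) (at y)"
    by (rule DERIV_mult[OF beta_deriv[OF y] dS])
  moreover have "(- (2 * (a + 1) * y) * rho p y) * S y +
     ((- 2 * y) * VV y + Q * DVV - 2 * a * (R y + y * DR) - a\<^sup>2 * (2 * R y) + 2 / (p + 1) * ((p + 1) * f y * R y)) * beta y = 0"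
  proof -
    have 1: "Q * DVV = 2 * (2 * (a + 1) * y * VV y + a * (a + 1) * R y - f y * R y)"
      using q by (simp add: DVV_def Q_def)
    have 2: "Q * DR = Q * VV y + (2 * (a + 1) * y * R y + a * (a + 1) * n y - f y * n y)"
      using q by (simp add: DR_def Q_def distrib_left)
    have 3: "2 / (p + 1) * ((p + 1) * f y * R y) = 2 * f y * R y"
      using p by simp
    define t where "t = 2 / (p + 1)"
    \<comment> \<open>The derivative of \<open>beta\<close> contributes the factor a + 1, which
      clears the coefficient 2/(p+1) of \<open>h\<close> in \<open>S\<close>. What remains is a
      polynomial identity in y, \<open>VV\<close>, \<open>R\<close>, \<open>n\<close> and
      \<open>f\<close>.\<close>
    have t: "t * (a + 1) = a" using a_p(2) by (simp add: t_def)
    have t': "(a + 1) * S y = (a + 1) * (Q * VV y - 2 * a * y * R y - a\<^sup>2 * n y) + a * (f y * n y)"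
      unfolding S_def h_def Q_def t_def[symmetric] by (subst t[symmetric]) (simp add: algebra_simps)
    have "- (2 * y) * ((a + 1) * S y) +
       ((- 2 * y) * VV y + Q * DVV - 2 * a * (R y + y * DR) - a\<^sup>2 * (2 * R y) + 2 * f y * R y) * Q
      = - (2 * y) * ((a + 1) * S y) +
       ((- 2 * y) * VV y + Q * DVV - 2 * a * R y - a\<^sup>2 * (2 * R y) + 2 * f y * R y) * Q - 2 * a * y * (Q * DR)"
      by (simp add: algebra_simps)
    also have "\<dots> = 0"
      unfolding 1 2 t' by (simp add: algebra_simps power2_eq_square Q_def)
    finally have "rho p y * (- (2 * y) * ((a + 1) * S y) +
       ((- 2 * y) * VV y + Q * DVV - 2 * a * (R y + y * DR) - a\<^sup>2 * (2 * R y) + 2 * f y * R y) * Q) = 0"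
      by simp
    then show ?thesis
      unfolding 3 beta_def Q_def[symmetric] by (simp add: algebra_simps)
  qed
  ultimately show ?thesis by simp
qed

text \<open>The terms of W'' parallel to W drop out of the derivative of \<open>m\<close>. Only the
  first-order term 2 (a + 1) y W' / (1 - y^2) survives, and \<open>beta\<close> is its integrating
  factor.\<close>

lemma beta_m_deriv:
  assumes y: "y \<in> Iv"
  shows "((\<lambda>y. beta y * m y) has_real_derivative 0) (at y)"
proof -
  have q: "1 - y\<^sup>2 \<noteq> 0" using one_minus_square_pos[OF y] by simp
  let ?A1 = "2 * (a + 1) * y * v1 y + a * (a + 1) * u1 y - f y * u1 y"
  let ?A2 = "2 * (a + 1) * y * v2 y + a * (a + 1) * u2 y - f y * u2 y"
  have d: "(m has_real_derivative (v1 y * v2 y + ?A2 / (1 - y\<^sup>2) * u1 y) - (v2 y * v1 y + ?A1 / (1 - y\<^sup>2) * u2 y)) (at y)"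
    unfolding m_def[abs_def] by (intro DERIV_diff DERIV_mult u_deriv v_deriv y)
  have e: "(v1 y * v2 y + ?A2 / Q * u1 y) - (v2 y * v1 y + ?A1 / Q * u2 y) = 2 * (a + 1) * y * m y / Q"
    if "Q \<noteq> 0" for Q
    using that unfolding m_def by (simp add: field_simps)
  have "(m has_real_derivative 2 * (a + 1) * y * m y / (1 - y\<^sup>2)) (at y)"
    using d unfolding e[OF q] .
  from DERIV_mult[OF beta_deriv[OF y] this] q show ?thesis
    by (simp add: beta_def)
qed

lemma const_on_Iv:
  fixes g :: "real \<Rightarrow> real"
  assumes "\<And>y. y \<in> Iv \<Longrightarrow> (g has_real_derivative 0) (at y)"
  shows "\<exists>c. \<forall>y\<in>Iv. g y = c"
  using has_field_derivative_zero_constant[of Iv g] assms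
  by (auto intro: has_field_derivative_at_within)

end

subsection \<open>Vanishing of the conserved quantities\<close>

context stationary_ode
begin

lemma V_continuous: "continuous_on Iv V"
proof -
  have c: "continuous_on Iv (\<lambda>y. (1 - y\<^sup>2) *\<^sub>R V y)"
    using V_deriv by (meson continuous_at_imp_continuous_on has_vector_derivative_continuous)
  have "continuous_on Iv (\<lambda>y. inverse (1 - y\<^sup>2) *\<^sub>R ((1 - y\<^sup>2) *\<^sub>R V y))"
    by (rule continuous_on_scaleR[OF _ c]) (intro continuous_intros, use one_minus_square_pos in force)
  then show ?thesis
    by (rule continuous_on_eq) (use one_minus_square_pos in force)
qed

text \<open>Yields the Cauchy-Schwarz bounds on \<open>R\<close> and on \<open>m\<close>, and
  equality in the former once \<open>m\<close> is known to vanish.\<close>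

lemma Lagrange_identity: "(R y)\<^sup>2 + (m y)\<^sup>2 = n y * VV y"
  by (simp add: R_def m_def n_def VV_def power2_eq_square algebra_simps)

text \<open>Cauchy-Schwarz and the arithmetic-geometric mean inequality. The scale \<open>s\<close>
  stays free because \<open>n\<close> and \<open>VV\<close> have different natural weights near the
  boundary; it is later taken of order 1/(1 - y^2).\<close>

lemma abs_R_le: "s > 0 \<Longrightarrow> 2 * \<bar>R y\<bar> \<le> s * n y + VV y / s"
proof -
  assume s: "s > 0"
  have "(R y)\<^sup>2 \<le> n y * VV y"
    using Lagrange_identity[of y] zero_le_power2[of "m y"] by linarith
  also have "\<dots> \<le> ((s * n y + VV y / s) / 2)\<^sup>2"
  proof -
    have "0 \<le> ((s * n y - VV y / s) / 2)\<^sup>2" by simp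
    also have "\<dots> = ((s * n y + VV y / s) / 2)\<^sup>2 - n y * VV y"
      using s by (simp add: power2_eq_square field_simps)
    finally show ?thesis by simp
  qed
  finally have "\<bar>R y\<bar> \<le> (s * n y + VV y / s) / 2"
    using s n_nonneg[of y] VV_nonneg[of y] by (intro power2_le_imp_le[of "\<bar>R y\<bar>"]) auto
  then show ?thesis by simp
qed

text \<open>Comparable to |u|^2 + |u_x|^2, with constants depending on a; it dominates both
  invariants.\<close>

definition N where "N y = rho p y * (n y + (1 - y\<^sup>2)\<^sup>2 * VV y)"

text \<open>Hardy's inequality in differential form: if \<open>N\<close> stayed above \<open>e\<close>, then
  the function \<open>\<Psi>\<close> below, built from the bounded integral and a logarithm, would be decreasing,
  although its logarithmic term is unbounded near 1.\<close>

lemma N_small: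
  assumes M: "\<And>x. 1/2 \<le> x \<Longrightarrow> x < 1 \<Longrightarrow> integral {1/2..x} (\<lambda>y. rho p y * (1 - y\<^sup>2) * VV y) \<le> M"
    and e: "e > 0"
  shows "\<exists>y\<in>Iv. N y < e"
proof (rule ccontr)
  assume neg: "\<not> ?thesis"
  define J where "J y = rho p y * (1 - y\<^sup>2) * VV y" for y
  define I where "I x = integral {1/2..x} J" for x
  \<comment> \<open>Differentiating the weight in \<open>\<Psi>\<close> yields a term of at most -a
    rho n / (1 - x^2) for x > 1/2. One half of it absorbs the \<open>n\<close> part of 2 rho R at
    the price (2/a) J; the other half, together with (a/2) J, pays for the logarithm. The two prices
    add up to \<open>K\<close>.\<close>
  define K where "K = 2 / a + a / 2"
  define \<Psi> where "\<Psi> x = rho p x * n x - K * I x - a * e / 4 * ln (1 - x)" for x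
  have K: "K > 0" using a_pos by (simp add: K_def add_pos_pos)
  have Jc: "continuous_on Iv J"
    unfolding J_def VV_def using V_continuous rho_continuous by (intro continuous_intros)
  have I': "(I has_real_derivative J x) (at x)" if x: "1/2 < x" "x < 1" for x
  proof -
    have "(I has_vector_derivative J x) (at x within {1/2..(1 + x) / 2})"
      unfolding I_def using x
      by (intro integral_has_vector_derivative continuous_on_subset[OF Jc]) auto
    then show ?thesis
      using x by (simp add: at_within_Icc_at has_real_derivative_iff_has_vector_derivative)
  qed
  have \<Psi>': "\<exists>d. (\<Psi> has_real_derivative d) (at x) \<and> d \<le> 0" if x: "1/2 < x" "x < 1" for x
  proof -
    have xI: "x \<in> Iv" using x by auto
    define q where "q = 1 - x\<^sup>2"
    have q: "q > 0" using one_minus_square_pos[OF xI] by (simp add: q_def)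
    define r where "r = rho p x"
    have r: "r > 0" using rho_pos[OF xI] by (simp add: r_def)
    define d where "d = - (2 * a * x / q) * r * n x + 2 * R x * r - K * J x + a * e / 4 / (1 - x)"
    have "(\<Psi> has_real_derivative d) (at x)"
      unfolding \<Psi>_def[abs_def] d_def r_def q_def
      using x p by (auto intro!: derivative_eq_intros rho_has_deriv[OF xI] n_deriv[OF xI] I'[OF x] simp: a_def)
    moreover have "d \<le> 0"
    proof -
      have 1: "(2 * a * x / q) * r * n x \<ge> a * (r * n x / q)"
      proof -
        have "a * (r * n x / q) * 1 \<le> a * (r * n x / q) * (2 * x)"
          using a_pos r q n_nonneg[of x] x by (intro mult_left_mono) auto
        then show ?thesis by (simp add: mult_ac)
      qed
      have "2 * \<bar>R x\<bar> \<le> (a / (2 * q)) * n x + VV x / (a / (2 * q))"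
        using a_pos q by (intro abs_R_le) auto
      then have "2 * R x \<le> (a / (2 * q)) * n x + VV x / (a / (2 * q))"
        by linarith
      then have "2 * R x * r \<le> ((a / (2 * q)) * n x + VV x / (a / (2 * q))) * r"
        using r by (intro mult_right_mono) auto
      also have "\<dots> = a / 2 * (r * n x / q) + 2 / a * J x"
        using a_pos q by (simp add: J_def r_def[symmetric] q_def[symmetric] field_simps)
      finally have 2: "2 * R x * r \<le> a / 2 * (r * n x / q) + 2 / a * J x" .
      have Nx: "N x = q * (r * n x / q + J x)"
        unfolding N_def J_def r_def[symmetric] q_def[symmetric]
        using q by (simp add: power2_eq_square algebra_simps)
      have "e \<le> N x" using neg xI by force
      then have "e / q \<le> r * n x / q + J x"
        using q unfolding Nx by (simp add: pos_divide_le_eq mult.commute)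
      \<comment> \<open>From 1 - x^2 = (1 - x)(1 + x) with x < 1. The bound N >= e thereby produces
        a multiple of 1/(1 - x), the derivative of the logarithm; the factor 2 lost here and the
        factor a/2 from the remaining half explain the coefficient a e / 4.\<close>
      moreover have "e / (2 * (1 - x)) \<le> e / q"
      proof (rule divide_left_mono)
        show "q \<le> 2 * (1 - x)"
          using x mult_nonneg_nonneg[of "1 - x" "1 - x"] by (simp add: q_def power2_eq_square algebra_simps)
      qed (use e q x in auto)
      ultimately have "a / 2 * (e / (2 * (1 - x))) \<le> a / 2 * (r * n x / q + J x)"
        using a_pos by (intro mult_left_mono) auto
      then have 3: "a * e / 4 / (1 - x) \<le> a / 2 * (r * n x / q) + a / 2 * J x"
        using x by (simp add: distrib_left)
      have 4: "K * J x = 2 / a * J x + a / 2 * J x"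
        by (simp add: K_def distrib_right)
      have half: "a / 2 * z = a * z / 2" for z
        by simp
      have "- Y + t - k + g \<le> 0" if "u \<le> Y" "t \<le> u / 2 + j" "g \<le> u / 2 + j'" "k = j + j'"
        for Y t k g u j j' :: real
        using that by linarith
      from this[OF 1 2[unfolded half[of "r * n x / q"]] 3[unfolded half[of "r * n x / q"]] 4]
      show ?thesis
        by (simp add: d_def)
    qed
    ultimately show ?thesis by blast
  qed
  have Ic: "continuous_on {1/2..x} I" if "x < 1" for x
    unfolding I_def using that
    by (intro indefinite_integral_continuous_1 integrable_continuous_real continuous_on_subset[OF Jc]) auto
  have le: "\<Psi> x \<le> \<Psi> (1/2)" if x: "1/2 < x" "x < 1" for x
  proof (rule DERIV_nonpos_imp_decreasing_open[of "1/2" x \<Psi>])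
    show "\<exists>d. (\<Psi> has_real_derivative d) (at y) \<and> d \<le> 0" if "1/2 < y" "y < x" for y
      using \<Psi>'[of y] that x by auto
    have "continuous_on Iv n"
      by (intro continuous_at_imp_continuous_on ballI DERIV_isCont[OF n_deriv])
    then show "continuous_on {1/2..x} \<Psi>"
      unfolding \<Psi>_def[abs_def] using x
      by (intro continuous_intros Ic) (auto intro: continuous_on_subset[OF rho_continuous] elim: continuous_on_subset)
  qed (use x in simp)
  \<comment> \<open>At x = 1 - exp(-T) the logarithmic term equals a e T / 4, and \<open>T\<close>
    is chosen so that this exceeds what \<open>\<Psi> (1/2)\<close> and the bound on the integral
    allow. The lower bound 2 places x beyond 1/2.\<close>
  define T where "T = max 2 (4 / (a * e) * (\<Psi> (1/2) + K * M + 1))"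
  define x where "x = 1 - exp (- T)"
  have "exp (- T) < 1 / 2"
  proof -
    have "exp (- T) \<le> exp (- 2)" by (simp add: T_def)
    also have "exp (- 2 :: real) = inverse (exp 2)"
      by (rule exp_minus)
    also have "\<dots> \<le> inverse 3"
      using exp_ge_add_one_self[of 2] by (intro le_imp_inverse_le) simp_all
    also have "inverse 3 < (1 / 2 :: real)" by simp
    finally show ?thesis .
  qed
  then have x: "1/2 < x" "x < 1" by (auto simp: x_def)
  have "a * e / 4 * T \<le> \<Psi> (1/2) + K * M"
  proof -
    have "\<Psi> x = rho p x * n x - K * I x + a * e / 4 * T"
      by (simp add: \<Psi>_def x_def)
    moreover have "0 \<le> rho p x * n x"
      using n_nonneg rho_pos[of x p] x by simp
    moreover have "K * I x \<le> K * M"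
      using M[of x] x K unfolding I_def J_def by (intro mult_left_mono) auto
    ultimately show ?thesis using le[OF x] by linarith
  qed
  moreover have "\<Psi> (1/2) + K * M + 1 \<le> a * e / 4 * T"
  proof -
    have "a * e / 4 * (4 / (a * e) * (\<Psi> (1/2) + K * M + 1)) \<le> a * e / 4 * T"
      using a_pos e by (intro mult_left_mono) (auto simp: T_def)
    then show ?thesis using a_pos e by simp
  qed
  ultimately show False by simp
qed

lemma beta_m_le: "y \<in> Iv \<Longrightarrow> \<bar>beta y * m y\<bar> \<le> N y"
proof -
  assume y: "y \<in> Iv"
  define q where "q = 1 - y\<^sup>2"
  have q: "q > 0" using one_minus_square_pos[OF y] by (simp add: q_def)
  have r: "rho p y > 0" using rho_pos[OF y] .
  have "(q * m y)\<^sup>2 \<le> (n y + q\<^sup>2 * VV y)\<^sup>2"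
  proof -
    have "(m y)\<^sup>2 \<le> n y * VV y"
      using Lagrange_identity[of y] zero_le_power2[of "R y"] by linarith
    from mult_left_mono[OF this, of "q\<^sup>2"] have "(q * m y)\<^sup>2 \<le> n y * (q\<^sup>2 * VV y)"
      by (simp add: power_mult_distrib mult.left_commute)
    also have "\<dots> \<le> (n y + q\<^sup>2 * VV y)\<^sup>2"
    proof -
      have "A * B \<le> (A + B)\<^sup>2" if "0 \<le> A" "0 \<le> B" for A B :: real
        using that by (simp add: power2_eq_square algebra_simps)
      then show ?thesis using n_nonneg[of y] VV_nonneg[of y] by simp
    qed
    finally show ?thesis .
  qed
  then have "\<bar>q * m y\<bar> \<le> n y + q\<^sup>2 * VV y"
    using n_nonneg[of y] VV_nonneg[of y] by (simp add: abs_le_square_iff[symmetric])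
  then have "rho p y * \<bar>q * m y\<bar> \<le> N y"
    unfolding N_def q_def[symmetric] using r by (intro mult_left_mono) auto
  then show ?thesis
    using r by (simp add: beta_def q_def[symmetric] abs_mult mult.assoc)
qed

text \<open>The quadratic terms are bounded by \<open>N\<close> directly. The nonlinear one is (rho
  n)^((p+1)/2), which lies below rho n as soon as rho n <= N <= 1.\<close>

lemma beta_S_le:
  assumes y: "y \<in> Iv" and N1: "N y \<le> 1"
  shows "\<bar>beta y * S y\<bar> \<le> (1 + a + a\<^sup>2 + 2 / (p + 1)) * N y"
proof -
  define q where "q = 1 - y\<^sup>2"
  have q: "q > 0" "q \<le> 1" using one_minus_square_pos[OF y] by (simp_all add: q_def)
  define r where "r = rho p y"
  have r: "r > 0" using rho_pos[OF y] by (simp add: r_def)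
  have N: "N y = r * n y + r * (q\<^sup>2 * VV y)"
    by (simp add: N_def r_def q_def distrib_left)
  have parts: "0 \<le> r * n y" "0 \<le> r * (q\<^sup>2 * VV y)"
    using r n_nonneg VV_nonneg by simp_all
  then have N0: "0 \<le> N y" "r * n y \<le> N y" "r * (q\<^sup>2 * VV y) \<le> N y"
    using N by linarith+
  have "\<bar>beta y * S y\<bar> = r * \<bar>q\<^sup>2 * VV y - 2 * a * y * (q * R y) - a\<^sup>2 * (q * n y) + 2 / (p + 1) * (q * h y)\<bar>"
  proof -
    have "beta y * S y = r * (q\<^sup>2 * VV y - 2 * a * y * (q * R y) - a\<^sup>2 * (q * n y) + 2 / (p + 1) * (q * h y))"
      unfolding beta_def S_def r_def[symmetric] q_def[symmetric]
      by (simp add: algebra_simps power2_eq_square)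
    then show ?thesis using r by (simp add: abs_mult)
  qed
  also have "\<dots> \<le> r * (q\<^sup>2 * VV y + a * (n y + q\<^sup>2 * VV y) + a\<^sup>2 * n y + 2 / (p + 1) * (q * h y))"
  proof (rule mult_left_mono)
    have 1: "\<bar>2 * a * y * (q * R y)\<bar> \<le> a * (n y + q\<^sup>2 * VV y)"
    proof -
      have "2 * \<bar>R y\<bar> \<le> 1 / q * n y + VV y / (1 / q)"
        using q by (intro abs_R_le) auto
      then have "q * (2 * \<bar>R y\<bar>) \<le> q * (1 / q * n y + VV y / (1 / q))"
        using q by (intro mult_left_mono) auto
      also have "\<dots> = n y + q\<^sup>2 * VV y"
        using q by (simp add: field_simps power2_eq_square)
      finally have *: "q * (2 * \<bar>R y\<bar>) \<le> n y + q\<^sup>2 * VV y" .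
      have "\<bar>2 * a * y * (q * R y)\<bar> = \<bar>y\<bar> * (a * (q * (2 * \<bar>R y\<bar>)))"
        using a_pos q by (simp add: abs_mult mult_ac)
      also have "\<dots> \<le> 1 * (a * (q * (2 * \<bar>R y\<bar>)))"
        using y a_pos q by (intro mult_right_mono) auto
      also have "\<dots> \<le> a * (n y + q\<^sup>2 * VV y)"
        using * a_pos by (simp add: mult_left_mono)
      finally show ?thesis .
    qed
    have 2: "\<bar>a\<^sup>2 * (q * n y)\<bar> \<le> a\<^sup>2 * n y"
      using q n_nonneg[of y] by (simp add: abs_mult mult_left_mono mult_left_le_one_le)
    have 3: "0 \<le> 2 / (p + 1) * (q * h y)"
      using p q n_nonneg[of y] f_nonneg[of y] by (simp add: h_def)
    have 4: "0 \<le> q\<^sup>2 * VV y" using VV_nonneg by simp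
    show "\<bar>q\<^sup>2 * VV y - 2 * a * y * (q * R y) - a\<^sup>2 * (q * n y) + 2 / (p + 1) * (q * h y)\<bar>
      \<le> q\<^sup>2 * VV y + a * (n y + q\<^sup>2 * VV y) + a\<^sup>2 * n y + 2 / (p + 1) * (q * h y)"
      using 1 2 3 4 by linarith
  qed (use r in simp)
  also have "\<dots> = r * (q\<^sup>2 * VV y) + a * N y + a\<^sup>2 * (r * n y) + 2 / (p + 1) * (r * q * h y)"
    unfolding N by (simp add: algebra_simps)
  also have "r * q * h y \<le> N y"
  proof -
    \<comment> \<open>Both sides are powers of 1 - y^2: rho (1 - y^2) has exponent a + 1 =
      (p+1)/(p-1), which is (p+1)/2 times the exponent of rho.\<close>
    have "r * q = q powr ((p + 1) / (p - 1))"
      unfolding a_p(1) r_def rho_def q_def[symmetric] a_def[symmetric] using q by (simp add: powr_add)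
    also have "\<dots> = r powr ((p + 1) / 2)"
    proof -
      have "2 / z * (x / 2) = x / z" for x z :: real by simp
      then show ?thesis
        unfolding r_def rho_def q_def[symmetric] by (simp only: powr_powr)
    qed
    finally have "r * q * h y = (r * n y) powr ((p + 1) / 2)"
      unfolding h_eq using r n_nonneg[of y] by (simp add: powr_mult)
    also have "\<dots> \<le> (r * n y) powr 1"
      using parts N0 N1 p by (intro powr_mono') auto
    also have "\<dots> \<le> N y" using parts N0 by simp
    finally show ?thesis .
  qed
  then have "r * (q\<^sup>2 * VV y) + a * N y + a\<^sup>2 * (r * n y) + 2 / (p + 1) * (r * q * h y)
     \<le> N y + a * N y + a\<^sup>2 * N y + 2 / (p + 1) * N y"
    using N0 a_pos p by (intro add_mono mult_left_mono) auto
  also have "\<dots> = (1 + a + a\<^sup>2 + 2 / (p + 1)) * N y"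
    by (simp add: algebra_simps)
  finally show ?thesis by simp
qed

text \<open>\<open>beta y * S y\<close> and \<open>beta y * m y\<close> are constants bounded by
  multiples of \<open>N\<close> at points where \<open>N\<close> is arbitrarily small, so they are
  zero; \<open>beta\<close> is positive.\<close>

lemma S_m_zero:
  assumes M: "\<And>x. 1/2 \<le> x \<Longrightarrow> x < 1 \<Longrightarrow> integral {1/2..x} (\<lambda>y. rho p y * (1 - y\<^sup>2) * VV y) \<le> M"
    and y: "y \<in> Iv"
  shows "S y = 0" "m y = 0"
proof -
  obtain c where c: "\<forall>y\<in>Iv. beta y * S y = c"
    using const_on_Iv[OF beta_S_deriv] by blast
  obtain d where d: "\<forall>y\<in>Iv. beta y * m y = d"
    using const_on_Iv[OF beta_m_deriv] by blast
  have "\<bar>d\<bar> \<le> e" if "e > 0" for e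
    using N_small[OF M that] beta_m_le d by force
  then have "d = 0"
    by (metis abs_le_zero_iff dense_ge)
  define K where "K = 1 + a + a\<^sup>2 + 2 / (p + 1)"
  have K: "K > 0" using a_pos p by (simp add: K_def add_pos_pos)
  have "\<bar>c\<bar> \<le> e" if e: "e > 0" for e
  proof -
    obtain x where x: "x \<in> Iv" "N x < min 1 (e / K)"
      using N_small[OF M, of "min 1 (e / K)"] e K by auto
    then have "\<bar>beta x * S x\<bar> \<le> K * N x"
      unfolding K_def by (intro beta_S_le) auto
    also have "\<dots> \<le> K * (e / K)"
      using x K by (intro mult_left_mono) auto
    finally show ?thesis using c x K by simp
  qed
  then have "c = 0"
    by (metis abs_le_zero_iff dense_ge)
  show "S y = 0" "m y = 0"
    using c d \<open>c = 0\<close> \<open>d = 0\<close> beta_pos[OF y] y by force+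
qed

end

subsection \<open>Classification of the regular solutions\<close>

locale stationary_ode_finite = stationary_ode +
  assumes S_zero: "\<And>y. y \<in> Iv \<Longrightarrow> S y = 0" and m_zero: "\<And>y. y \<in> Iv \<Longrightarrow> m y = 0"
begin

lemma VV_eq: "y \<in> Iv \<Longrightarrow> (1 - y\<^sup>2) * VV y = 2 * a * y * R y + a\<^sup>2 * n y - 2 / (p + 1) * h y"
  using S_zero[of y] by (simp add: S_def)

lemma R_square: "y \<in> Iv \<Longrightarrow> (R y)\<^sup>2 = n y * VV y"
  using Lagrange_identity[of y] m_zero[of y] by simp

text \<open>rho (q R - a y n), with q = 1 - y^2, is the inner product of u and u_x. Zero energy
  gives |u_x| <= a |u|, so it is at most a |u|^2; the term a y n accounts for the other half of the
  factor 2.\<close>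

lemma abs_R_le_n:
  assumes y: "y \<in> Iv"
  shows "\<bar>R y\<bar> \<le> 2 * a * n y / (1 - y\<^sup>2)"
proof -
  define q where "q = 1 - y\<^sup>2"
  have q: "q > 0" using one_minus_square_pos[OF y] by (simp add: q_def)
  have q1: "1 - q = y\<^sup>2" by (simp add: q_def)
  have h: "2 / (p + 1) * h y \<ge> 0"
    using p n_nonneg[of y] f_nonneg[of y] by (simp add: h_def)
  have "(q * R y - a * y * n y)\<^sup>2 = n y * (q * (q * VV y - 2 * a * y * R y) + a\<^sup>2 * y\<^sup>2 * n y)"
    using R_square[OF y] by (simp add: power2_diff power_mult_distrib algebra_simps) (simp add: power2_eq_square)
  also have "\<dots> = n y * (a\<^sup>2 * n y - q * (2 / (p + 1) * h y))"
    unfolding q_def VV_eq[OF y] by (simp add: algebra_simps)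
  also have "\<dots> \<le> n y * (a\<^sup>2 * n y)"
  proof (rule mult_left_mono)
    have "0 \<le> q * (2 / (p + 1) * h y)"
      by (rule mult_nonneg_nonneg[OF less_imp_le[OF q] h])
    then show "a\<^sup>2 * n y - q * (2 / (p + 1) * h y) \<le> a\<^sup>2 * n y"
      by linarith
  qed (rule n_nonneg)
  also have "\<dots> = (a * n y)\<^sup>2"
    by (simp add: power2_eq_square)
  finally have "\<bar>q * R y - a * y * n y\<bar> \<le> a * n y"
    using a_pos n_nonneg[of y] by (simp add: abs_le_square_iff[symmetric])
  moreover have "\<bar>a * y * n y\<bar> \<le> a * n y"
  proof -
    have "\<bar>a * y * n y\<bar> = \<bar>y\<bar> * (a * n y)"
      using a_pos n_nonneg[of y] by (simp add: abs_mult)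
    also have "\<dots> \<le> 1 * (a * n y)"
      using a_pos n_nonneg[of y] y by (intro mult_right_mono) auto
    finally show ?thesis by simp
  qed
  ultimately have "\<bar>q * R y\<bar> \<le> 2 * a * n y"
    by linarith
  then show ?thesis
    using q by (simp add: abs_mult q_def[symmetric] pos_le_divide_eq mult.commute)
qed

text \<open>A Gronwall argument: |n'| <= 4 a n / (1 - y^2), so a zero spreads in both directions. It
  replaces uniqueness for the initial value problem.\<close>

lemma n_zero_propagates:
  assumes y0: "y0 \<in> Iv" "n y0 = 0" and y: "y \<in> Iv"
  shows "n y = 0"
proof -
  \<comment> \<open>This is ((1 + x)/(1 - x))^(2 a s), with logarithmic derivative 4 a s / (1 -
    x^2). For s = 1 the product with \<open>n\<close> is nondecreasing and carries the zero to the
    left; for s = -1 it is nonincreasing and carries it to the right.\<close>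
  define g where "g s x = exp (s * (2 * a * (ln (1 + x) - ln (1 - x))))" for s x :: real
  have gpos: "g s x > 0" for s x by (simp add: g_def)
  have D: "((\<lambda>x. n x * g s x) has_real_derivative (2 * R x + s * (4 * a * n x / (1 - x\<^sup>2))) * g s x) (at x)"
    if x: "x \<in> Iv" for x s
  proof -
    have "(g s has_real_derivative g s x * (s * (2 * a * (1 / (1 + x) + 1 / (1 - x))))) (at x)"
      unfolding g_def using x by (auto intro!: derivative_eq_intros)
    from DERIV_mult[OF n_deriv[OF x] this]
    have d: "((\<lambda>x. n x * g s x) has_real_derivative
        2 * R x * g s x + g s x * (s * (2 * a * (1 / (1 + x) + 1 / (1 - x)))) * n x) (at x)" .
    have e: "1 / (1 + x) + 1 / (1 - x) = 2 / (1 - x\<^sup>2)"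
    proof -
      have "1 + x \<noteq> 0" "1 - x \<noteq> 0" using x by auto
      moreover have "1 - x\<^sup>2 = (1 + x) * (1 - x)" by (simp add: power2_eq_square algebra_simps)
      ultimately show ?thesis by (simp add: add_frac_eq)
    qed
    show ?thesis using d unfolding e by (simp add: algebra_simps)
  qed
  have le: "\<bar>2 * R x\<bar> \<le> 4 * a * n x / (1 - x\<^sup>2)" if "x \<in> Iv" for x
    using abs_R_le_n[OF that] by simp
  show ?thesis
  proof (cases "y \<le> y0")
    case True
    have "n y * g 1 y \<le> n y0 * g 1 y0"
    proof (rule DERIV_nonneg_imp_nondecreasing[OF True])
      fix x assume "y \<le> x" "x \<le> y0"
      then have x: "x \<in> Iv" using y y0 by auto
      have "0 \<le> (2 * R x + 1 * (4 * a * n x / (1 - x\<^sup>2))) * g 1 x"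
        using le[OF x] gpos[of 1 x] by (intro mult_nonneg_nonneg) auto
      then show "\<exists>d. ((\<lambda>x. n x * g 1 x) has_real_derivative d) (at x) \<and> d \<ge> 0"
        using D[OF x] by blast
    qed
    then show ?thesis
      using y0 gpos[of 1 y] n_nonneg[of y] by (simp add: mult_le_0_iff)
  next
    case False
    then have "y0 \<le> y" by simp
    have "n y * g (-1) y \<le> n y0 * g (-1) y0"
    proof (rule DERIV_nonpos_imp_nonincreasing[OF \<open>y0 \<le> y\<close>])
      fix x assume "y0 \<le> x" "x \<le> y"
      then have x: "x \<in> Iv" using y y0 by auto
      have "(2 * R x + (-1) * (4 * a * n x / (1 - x\<^sup>2))) * g (-1) x \<le> 0"
        using le[OF x] gpos[of "-1" x] by (intro mult_nonpos_nonneg) auto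
      then show "\<exists>d. ((\<lambda>x. n x * g (-1) x) has_real_derivative d) (at x) \<and> d \<le> 0"
        using D[OF x] by blast
    qed
    then show ?thesis
      using y0 gpos[of "-1" y] n_nonneg[of y] by (simp add: mult_le_0_iff)
  qed
qed

section \<open>Solutions without zeros\<close>

context
  assumes n_pos: "\<And>y. y \<in> Iv \<Longrightarrow> n y > 0"
begin

definition b where "b = (p - 1) / 2"

lemma b: "b > 0" "b * a = 1" "b + 1 = b * (a + 1)"
  using p a_p(3,4) by (simp_all add: b_def)

text \<open>This is |W|^(-b). As the kappa functions are multiples of (1 + delta y)^(-a) and a b =
  1, it is the power that turns them into affine functions.\<close>

definition Z where "Z y = n y powr (- b / 2)"

lemma Z_pos: "y \<in> Iv \<Longrightarrow> Z y > 0"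
  using n_pos[of y] by (simp add: Z_def)

lemma Z_deriv:
  assumes y: "y \<in> Iv"
  shows "(Z has_real_derivative - b * (Z y * R y / n y)) (at y)"
  unfolding Z_def[abs_def]
  using n_pos[OF y] by (auto intro!: derivative_eq_intros n_deriv[OF y] simp: powr_diff)

text \<open>Up to the factor \<open>- b\<close> this is the derivative of \<open>Z\<close>, so the
  second derivative of \<open>Z\<close> vanishes. Zero energy turns the equation into R' = (b + 2)
  VV, and zero angular momentum gives R^2 = n VV; with these the terms of the quotient rule
  cancel.\<close>

lemma Z_deriv2:
  assumes y: "y \<in> Iv"
  shows "((\<lambda>y. Z y * R y / n y) has_real_derivative 0) (at y)"
proof -
  define q where "q = 1 - y\<^sup>2"
  have q: "q > 0" using one_minus_square_pos[OF y] by (simp add: q_def)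
  have n: "n y > 0" using n_pos[OF y] .
  define DR where "DR = VV y + (2 * (a + 1) * y * R y + a * (a + 1) * n y - f y * n y) / q"
  have D: "((\<lambda>y. Z y * R y / n y) has_real_derivative
     ((- b * (Z y * R y / n y) * R y + DR * Z y) * n y - Z y * R y * (2 * R y)) / (n y * n y)) (at y)"
    using R_deriv[OF y] n
    by (intro DERIV_divide DERIV_mult Z_deriv n_deriv y) (simp_all add: DR_def q_def)
  define t where "t = 2 / (p + 1)"
  have t: "(b + 1) * t = 1"
    using p by (simp add: t_def b_def field_simps)
  have qDR: "q * DR = q * VV y + (2 * (a + 1) * y * R y + a * (a + 1) * n y - f y * n y)"
    using q by (simp add: DR_def distrib_left)
  have qV: "q * VV y = 2 * a * y * R y + a\<^sup>2 * n y - t * (f y * n y)"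
    using VV_eq[OF y] by (simp add: q_def t_def h_def)
  have "(b + 1) * (q * VV y) = q * DR - q * VV y"
  proof -
    have "(b + 1) * (q * VV y) = (b + 1) * a * (2 * y * R y) + (b + 1) * a * (a * n y) - (b + 1) * t * (f y * n y)"
      unfolding qV by (simp add: algebra_simps power2_eq_square)
    also have "(b + 1) * a = a + 1"
      using b by (simp add: algebra_simps)
    finally show ?thesis
      unfolding t qDR by (simp add: algebra_simps)
  qed
  then have "q * (DR - (b + 2) * VV y) = 0"
    by (simp add: algebra_simps)
  then have DR: "DR = (b + 2) * VV y"
    using q by simp
  have "(- b * (Z y * R y / n y) * R y + DR * Z y) * n y - Z y * R y * (2 * R y)
      = Z y * (DR * n y - (b + 2) * (R y)\<^sup>2)"
    using n by (simp add: field_simps power2_eq_square)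
  also have "\<dots> = 0"
    unfolding DR R_square[OF y] by simp
  finally show ?thesis
    using D by simp
qed

text \<open>\<open>A\<close> and \<open>B\<close> are the value and the slope of \<open>Z\<close> at
  0. Zero energy at y = 0 relates them and leaves a one-parameter family; positivity of the
  resulting value of A^2 - B^2 keeps the slope below the value.\<close>

lemma Z_linear:
  obtains A B where "\<And>y. y \<in> Iv \<Longrightarrow> Z y = A + B * y" "A > 0" "\<bar>B\<bar> < A"
    "A\<^sup>2 - B\<^sup>2 = (p - 1)\<^sup>2 / (2 * (p + 1))"
proof -
  obtain c where c: "\<forall>y\<in>Iv. Z y * R y / n y = c"
    using const_on_Iv[OF Z_deriv2] by blast
  define B where "B = - b * c"
  have "((\<lambda>y. Z y - B * y) has_real_derivative 0) (at y)" if y: "y \<in> Iv" for y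
    using Z_deriv[OF y] c y by (auto intro!: derivative_eq_intros simp: B_def)
  then obtain A where A: "\<forall>y\<in>Iv. Z y - B * y = A"
    using const_on_Iv by blast
  then have Z: "Z y = A + B * y" if "y \<in> Iv" for y
    using that by (metis diff_eq_eq)
  have A0: "A = Z 0" using Z[of 0] by simp
  then have Apos: "A > 0" using Z_pos[of 0] by simp
  define t where "t = 2 / (p + 1)"
  have n: "n 0 > 0" using n_pos[of 0] by simp
  have "VV 0 = a\<^sup>2 * n 0 - t * (f 0 * n 0)"
    using VV_eq[of 0] by (simp add: t_def h_def)
  then have VVn: "VV 0 / n 0 = a\<^sup>2 - t * f 0"
    using n by (simp add: field_simps)
  \<comment> \<open>Here the two powers of |W| cancel, so the nonlinear term contributes a pure
    constant to A^2 - B^2.\<close>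
  have fZ: "f 0 * (Z 0)\<^sup>2 = 1"
  proof -
    have "(Z 0)\<^sup>2 = n 0 powr (- b)"
      using n by (simp add: Z_def powr_powr flip: powr_numeral)
    then show ?thesis
      using n by (simp add: f_eq b_def powr_minus)
  qed
  have "B\<^sup>2 = b\<^sup>2 * (Z 0)\<^sup>2 * (VV 0 / n 0)"
  proof -
    have "c = Z 0 * R 0 / n 0" using c by simp
    then have "B\<^sup>2 = b\<^sup>2 * (Z 0)\<^sup>2 * ((R 0)\<^sup>2 / (n 0)\<^sup>2)"
      by (simp add: B_def power_mult_distrib power_divide)
    also have "(R 0)\<^sup>2 / (n 0)\<^sup>2 = VV 0 / n 0"
      using R_square[of 0] n by (simp add: power2_eq_square)
    finally show ?thesis .
  qed
  also have "\<dots> = (b * a)\<^sup>2 * A\<^sup>2 - b\<^sup>2 * t * (f 0 * (Z 0)\<^sup>2)"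
    unfolding VVn A0 by (simp add: power_mult_distrib algebra_simps)
  finally have "B\<^sup>2 = (b * a)\<^sup>2 * A\<^sup>2 - b\<^sup>2 * t"
    unfolding fZ by simp
  then have AB: "A\<^sup>2 - B\<^sup>2 = b\<^sup>2 * t"
    using b by simp
  also have "\<dots> = (p - 1)\<^sup>2 / (2 * (p + 1))"
    by (simp add: b_def t_def power_divide)
  finally have eq: "A\<^sup>2 - B\<^sup>2 = (p - 1)\<^sup>2 / (2 * (p + 1))" .
  also have "\<dots> > 0" using p by simp
  finally have "\<bar>B\<bar> < A"
    using Apos by (intro power2_less_imp_less[of "\<bar>B\<bar>"]) simp_all
  then show ?thesis
    using that[of A B] Z Apos eq by blast
qed

text \<open>The derivative of W/|W| is a multiple of \<open>m\<close>, hence zero; the quotient is a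
  constant of modulus 1.\<close>

lemma phase_constant:
  obtains \<theta> :: real where "\<And>y. y \<in> Iv \<Longrightarrow> W y = exp (\<i> * of_real \<theta>) * of_real (sqrt (n y))"
proof -
  have D: "((\<lambda>y. u y / sqrt (n y)) has_real_derivative (u' * n y - u y * R y) / (n y * sqrt (n y))) (at y)"
    if y: "y \<in> Iv" and u: "(u has_real_derivative u') (at y)" for y u u'
  proof -
    have n: "n y > 0" using n_pos[OF y] .
    have "((\<lambda>y. sqrt (n y)) has_real_derivative R y / sqrt (n y)) (at y)"
      using n by (auto intro!: derivative_eq_intros n_deriv[OF y] simp: field_simps)
    from DERIV_divide[OF u this] n
    have "((\<lambda>y. u y / sqrt (n y)) has_real_derivative
        (u' * sqrt (n y) - u y * (R y / sqrt (n y))) / (sqrt (n y) * sqrt (n y))) (at y)" by simp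
    moreover have "(u' * s - u y * (r / s)) / (s * s) = (u' * (s * s) - u y * r) / ((s * s) * s)" if "s > 0" for s r
      using that by (simp add: field_simps)
    from this[of "sqrt (n y)" "R y"] have "(u' * sqrt (n y) - u y * (R y / sqrt (n y))) / (sqrt (n y) * sqrt (n y))
       = (u' * n y - u y * R y) / (n y * sqrt (n y))"
      using n by simp
    ultimately show ?thesis by simp
  qed
  have z1: "v1 y * n y - u1 y * R y = 0" and z2: "v2 y * n y - u2 y * R y = 0" if "y \<in> Iv" for y
  proof -
    have "v1 y * n y - u1 y * R y = - u2 y * m y" "v2 y * n y - u2 y * R y = u1 y * m y"
      by (simp_all add: n_def R_def m_def power2_eq_square algebra_simps)
    then show "v1 y * n y - u1 y * R y = 0" "v2 y * n y - u2 y * R y = 0"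
      using m_zero[OF that] by simp_all
  qed
  obtain c1 where c1: "\<forall>y\<in>Iv. u1 y / sqrt (n y) = c1"
    using const_on_Iv[of "\<lambda>y. u1 y / sqrt (n y)"] D[OF _ u_deriv(1)] z1 by force
  obtain c2 where c2: "\<forall>y\<in>Iv. u2 y / sqrt (n y) = c2"
    using const_on_Iv[of "\<lambda>y. u2 y / sqrt (n y)"] D[OF _ u_deriv(2)] z2 by force
  have W: "W y = Complex c1 c2 * of_real (sqrt (n y))" if "y \<in> Iv" for y
  proof (rule complex_eqI)
    have "sqrt (n y) > 0" using n_pos[OF that] by simp
    moreover have "u1 y / sqrt (n y) = c1" "u2 y / sqrt (n y) = c2"
      using c1 c2 that by blast+
    ultimately show "Re (W y) = Re (Complex c1 c2 * of_real (sqrt (n y)))"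
      "Im (W y) = Im (Complex c1 c2 * of_real (sqrt (n y)))"
      by (auto simp: field_simps)
  qed
  have "cmod (Complex c1 c2) = 1"
  proof -
    have "sqrt (n 0) = cmod (Complex c1 c2) * sqrt (n 0)"
      using W[of 0] cmod_W[of 0] n_nonneg[of 0] by (simp add: norm_mult)
    then show ?thesis using n_pos[of 0] by simp
  qed
  then have e: "exp (\<i> * of_real (Arg2pi (Complex c1 c2))) = Complex c1 c2"
    by (simp only: complex_norm_eq_1_exp)
  show ?thesis
    by (rule that[of "Arg2pi (Complex c1 c2)"]) (simp only: e W)
qed

lemma W_eq_kappa:
  "\<exists>\<delta>\<in>{-1<..<1}. \<exists>\<theta>::real. \<forall>y\<in>Iv. W y = exp (\<i> * of_real \<theta>) * of_real (kappa p \<delta> y)"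
proof -
  obtain A B where Z: "\<And>y. y \<in> Iv \<Longrightarrow> Z y = A + B * y" and A: "A > 0" and B: "\<bar>B\<bar> < A"
    and AB: "A\<^sup>2 - B\<^sup>2 = (p - 1)\<^sup>2 / (2 * (p + 1))"
    using Z_linear by blast
  obtain \<theta> where \<theta>: "\<And>y. y \<in> Iv \<Longrightarrow> W y = exp (\<i> * of_real \<theta>) * of_real (sqrt (n y))"
    using phase_constant by blast
  \<comment> \<open>Normalises A + B y to A (1 + delta y). The relation between A and B becomes A^2
    (1 - delta^2) = kappa0^(-(p-1)), and raising it to the power -a/2 gives the amplitude in
    \<open>kappa\<close>.\<close>
  define \<delta> where "\<delta> = B / A"
  have \<delta>: "\<bar>\<delta>\<bar> < 1" using A B by (simp add: \<delta>_def abs_divide)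
  have \<delta>2: "1 - \<delta>\<^sup>2 > 0" using \<delta> by (simp add: abs_square_less_1)
  define D where "D = (p - 1)\<^sup>2 / (2 * (p + 1))"
  have D: "D > 0" using p by (simp add: D_def)
  have "A\<^sup>2 * (1 - \<delta>\<^sup>2) = D"
    using A AB by (simp add: \<delta>_def D_def power_divide right_diff_distrib)
  then have A2: "A\<^sup>2 = D / (1 - \<delta>\<^sup>2)"
    using \<delta>2 by (simp add: field_simps)
  have "A powr (- a) = (A\<^sup>2) powr (- a / 2)"
    using A by (simp add: powr_powr flip: powr_numeral)
  also have "\<dots> = D powr (- a / 2) / (1 - \<delta>\<^sup>2) powr (- a / 2)"
    unfolding A2 using D \<delta>2 by (simp add: powr_divide)
  also have "\<dots> = kappa0 p * (1 - \<delta>\<^sup>2) powr (1 / (p - 1))"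
  proof -
    have "- (2 / z) / 2 = - (1 / z)" for z :: real by simp
    from this[of "p - 1"] have e: "- a / 2 = - (1 / (p - 1))" by (simp only: a_def)
    have "2 * (p + 1) / (p - 1)\<^sup>2 = inverse D" by (simp add: D_def)
    then have "kappa0 p = D powr (- (1 / (p - 1)))"
      using D by (simp add: kappa0_def powr_minus inverse_powr)
    then show ?thesis
      unfolding e by (simp add: powr_minus divide_inverse)
  qed
  finally have Ap: "A powr (- a) = kappa0 p * (1 - \<delta>\<^sup>2) powr (1 / (p - 1))" .
  have "sqrt (n y) = kappa p \<delta> y" if y: "y \<in> Iv" for y
  proof -
    have n: "n y > 0" using n_pos[OF y] .
    have pos: "1 + \<delta> * y > 0"
    proof -
      have "\<bar>\<delta> * y\<bar> < 1"
        using abs_mult_less[of \<delta> 1 y 1] \<delta> y by (simp add: abs_mult abs_less_iff[of y])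
      then show ?thesis by linarith
    qed
    have "sqrt (n y) = n y powr (b * a / 2)"
      using n b by (simp add: powr_half_sqrt)
    also have "\<dots> = Z y powr (- a)"
      using n by (simp add: Z_def powr_powr)
    also have "Z y = A * (1 + \<delta> * y)"
      using Z[OF y] A by (simp add: \<delta>_def field_simps)
    also have "(A * (1 + \<delta> * y)) powr (- a) = A powr (- a) * (1 + \<delta> * y) powr (- a)"
      using A pos by (simp add: powr_mult)
    also have "\<dots> = kappa p \<delta> y"
      unfolding Ap kappa_def by (simp add: powr_minus divide_inverse a_def)
    finally show ?thesis .
  qed
  then show ?thesis
    using \<theta> \<delta> by (intro bexI[of _ \<delta>] exI[of _ \<theta>]) (auto simp: abs_less_iff)
qed

end

lemma classification:
  "(\<forall>y\<in>Iv. W y = 0) \<or>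
   (\<exists>\<delta>\<in>{-1<..<1}. \<exists>\<theta>::real. \<forall>y\<in>Iv. W y = exp (\<i> * of_real \<theta>) * of_real (kappa p \<delta> y))"
proof (cases "\<exists>y0\<in>Iv. n y0 = 0")
  case True
  then have "n y = 0" if "y \<in> Iv" for y
    using n_zero_propagates that by blast
  then have "\<forall>y\<in>Iv. W y = 0"
    using cmod_W by (metis norm_eq_zero real_sqrt_zero)
  then show ?thesis ..
next
  case False
  then have "n y > 0" if "y \<in> Iv" for y
    using n_nonneg[of y] that by (metis less_eq_real_def)
  then show ?thesis
    using W_eq_kappa by blast
qed

end

subsection \<open>Solutions in the weighted Sobolev space\<close>

text \<open>Supplies the bound \<open>M\<close> for Hardy's inequality: the integrand is the
  derivative part of the density of the norm, and the rest of that density is nonnegative.\<close>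

lemma H0_integral_bound:
  assumes w: "w \<in> H0 p"
    and V: "AE y in lebesgue. y \<in> Iv \<longrightarrow> weak_deriv w y = V y" and Vc: "continuous_on Iv V"
    and x: "1/2 \<le> x" "x < 1"
  shows "integral {1/2..x} (\<lambda>y. rho p y * (1 - y\<^sup>2) * (cmod (V y))\<^sup>2) \<le> enn2real (H0_norm_sq p w)"
proof -
  let ?J = "\<lambda>y. rho p y * (1 - y\<^sup>2) * (cmod (V y))\<^sup>2"
  have sub: "{1/2..x} \<subseteq> Iv" using x by auto
  have "continuous_on Iv ?J"
    by (intro continuous_intros rho_continuous Vc)
  then have "?J integrable_on {1/2..x}"
    using sub by (intro integrable_continuous_real) (rule continuous_on_subset)
  then have hi: "(?J has_integral integral {1/2..x} ?J) {1/2..x}"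
    by (rule integrable_integral)
  have nonneg: "0 \<le> ?J y" if "y \<in> {1/2..x}" for y
    using rho_pos[of y p] one_minus_square_pos[of y] that sub by auto
  have "ennreal (integral {1/2..x} ?J) = (\<integral>\<^sup>+y. indicator {1/2..x} y * ?J y \<partial>lebesgue)"
    unfolding nn_integral_completion by (rule nn_integral_has_integral_lebesgue[OF nonneg hi, symmetric])
  also have "\<dots> \<le> H0_norm_sq p w"
    unfolding H0_norm_sq_def
  proof (rule nn_integral_mono_AE)
    show "AE y in lebesgue. ennreal (indicator {1/2..x} y * ?J y) \<le>
      ennreal (((cmod (weak_deriv w y))\<^sup>2 * (1 - y\<^sup>2) + (cmod (w y))\<^sup>2) * rho p y) * indicator Iv y"
      using V
    proof eventually_elim
      case (elim y)
      show ?case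
      proof (cases "y \<in> {1/2..x}")
        case True
        then have y: "y \<in> Iv" using sub by blast
        have "?J y \<le> ((cmod (weak_deriv w y))\<^sup>2 * (1 - y\<^sup>2) + (cmod (w y))\<^sup>2) * rho p y"
          using elim y rho_pos[OF y, of p] by (simp add: algebra_simps)
        then show ?thesis using True y by (simp add: ennreal_leI)
      qed simp
    qed
  qed
  finally have "ennreal (integral {1/2..x} ?J) \<le> H0_norm_sq p w" .
  moreover have "H0_norm_sq p w < \<infinity>" using w by (simp add: H0_def)
  moreover have "0 \<le> integral {1/2..x} ?J"
    using hi nonneg by (rule has_integral_nonneg)
  ultimately show ?thesis
    using enn2real_mono[of "ennreal (integral {1/2..x} ?J)" "H0_norm_sq p w"] by simp
qed

lemma stationary_solution_classification:
  assumes p: "p > 1" and w: "w \<in> H0 p" and eq: "stationary_solution p w"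
  obtains W where "AE y in lebesgue. y \<in> Iv \<longrightarrow> w y = W y" "continuous_on Iv W"
    "(\<forall>y\<in>Iv. W y = 0) \<or>
     (\<exists>\<delta>\<in>{-1<..<1}. \<exists>\<theta>::real. \<forall>y\<in>Iv. W y = exp (\<i> * of_real \<theta>) * of_real (kappa p \<delta> y))"
proof -
  have "w \<in> H1_loc" using w by (simp add: H0_def)
  from stationary_regularity[OF p this eq] obtain W V where
    wW: "AE y in lebesgue. y \<in> Iv \<longrightarrow> w y = W y" and
    V: "AE y in lebesgue. y \<in> Iv \<longrightarrow> weak_deriv w y = V y" and
    W': "\<And>y. y \<in> Iv \<Longrightarrow> (W has_vector_derivative V y) (at y)" and
    V': "\<And>y. y \<in> Iv \<Longrightarrow> ((\<lambda>y. (1 - y\<^sup>2) *\<^sub>R V y) has_vector_derivative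
       (2 * (2 / (p - 1)) * y) *\<^sub>R V y + (2 / (p - 1) * (2 / (p - 1) + 1)) *\<^sub>R W y
       - (cmod (W y) powr (p - 1)) *\<^sub>R W y) (at y)"
    by blast
  interpret stationary_ode p "2 / (p - 1)" W V
    by standard (use p W' V' in auto)
  have "VV y = (cmod (V y))\<^sup>2" for y
    by (simp add: VV_def cmod_power2)
  then have M: "integral {1/2..x} (\<lambda>y. rho p y * (1 - y\<^sup>2) * VV y) \<le> enn2real (H0_norm_sq p w)"
    if "1/2 \<le> x" "x < 1" for x
    using H0_integral_bound[OF w V V_continuous that] by simp
  interpret stationary_ode_finite p "2 / (p - 1)" W V
  proof
    fix y :: real assume y: "y \<in> Iv"
    show "S y = 0"
      by (rule S_m_zero(1)[OF _ y]) (rule M)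
    show "m y = 0"
      by (rule S_m_zero(2)[OF _ y]) (rule M)
  qed
  have "continuous_on Iv W"
    using W' by (meson continuous_at_imp_continuous_on has_vector_derivative_continuous)
  then show ?thesis
    using that wW classification by blast
qed

text \<open>The set where the functions differ is open, and a nonempty open set is not a null
  set.\<close>

lemma continuous_AE_eq_imp_eq:
  fixes f g :: "real \<Rightarrow> complex"
  assumes "continuous_on Iv f" "continuous_on Iv g" "AE y in lebesgue. y \<in> Iv \<longrightarrow> f y = g y" "y \<in> Iv"
  shows "f y = g y"
proof (rule ccontr)
  assume ne: "f y \<noteq> g y"
  obtain N where N: "negligible N" "\<And>y. y \<in> Iv \<Longrightarrow> y \<notin> N \<Longrightarrow> f y = g y"
    using AE_Iv_negligible[OF assms(3)] by blast
  let ?U = "{x \<in> Iv. f x - g x \<in> - {0}}"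
  have "open ?U"
    using continuous_open_preimage[of Iv "\<lambda>x. f x - g x" "- {0}"] assms(1,2)
    by (auto intro!: continuous_intros simp: vimage_def Int_def)
  moreover have "y \<in> ?U" using ne assms(4) by simp
  moreover have "?U \<subseteq> N" using N(2) by force
  ultimately show False
    using open_not_negligible[of ?U] N(1) negligible_subset by blast
qed

subsection \<open>Energy of the stationary solutions\<close>

lemma weak_deriv_AE_eq:
  assumes d: "\<And>y. y \<in> Iv \<Longrightarrow> (w has_vector_derivative g y) (at y)" and g: "continuous_on Iv g"
  shows "AE y in lebesgue. y \<in> Iv \<longrightarrow> weak_deriv w y = g y"
proof -
  have "has_weak_deriv w g"
    using d g by (rule has_weak_derivI_C1)
  moreover from this have "has_weak_deriv w (weak_deriv w)"
    unfolding weak_deriv_def by (rule someI[of "has_weak_deriv w"])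
  ultimately show ?thesis
    by (intro weak_deriv_unique)
qed

text \<open>The energy contains \<open>weak_deriv\<close>, a chosen representative that is known
  only almost everywhere. Completeness of Lebesgue measure makes the integrand \<open>g\<close>
  measurable because it agrees almost everywhere with the continuous \<open>f\<close>.\<close>

lemma set_integral_Iv_cong_AE:
  fixes f g :: "real \<Rightarrow> real"
  assumes f: "continuous_on {-1..1} f" and ae: "AE y in lebesgue. y \<in> Iv \<longrightarrow> g y = f y"
  shows "(LINT y:Iv|lebesgue. g y) = integral {-1..1} f"
proof -
  have "f absolutely_integrable_on Iv"
    using absolutely_integrable_continuous_real[OF f] by (simp add: absolutely_integrable_on_Icc_iff_Ioo)
  then have int: "integrable lebesgue (\<lambda>y. indicator Iv y *\<^sub>R f y)"
    and eq: "(LINT y:Iv|lebesgue. f y) = integral {-1..1} f"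
    by (simp_all add: set_integrable_def set_lebesgue_integral_eq_integral(2) integral_open_interval_real)
  have m: "(\<lambda>y. indicator Iv y *\<^sub>R f y) \<in> borel_measurable lebesgue"
    using int by (rule borel_measurable_integrable)
  have ae': "AE y in lebesgue. indicator Iv y *\<^sub>R f y = indicator Iv y *\<^sub>R g y"
    using ae by eventually_elim (auto simp: indicator_def)
  have "(LINT y:Iv|lebesgue. f y) = (LINT y:Iv|lebesgue. g y)"
    unfolding set_lebesgue_integral_def
    by (rule integral_cong_AE[OF m borel_measurable_AE[OF m ae'] ae'])
  then show ?thesis
    using eq by simp
qed

lemma energy_zero: "p > 1 \<Longrightarrow> energy p (\<lambda>_. 0) (\<lambda>_. 0) = 0"
proof -
  assume p: "p > 1"
  have "AE y in lebesgue. y \<in> Iv \<longrightarrow> weak_deriv (\<lambda>_. 0) y = 0"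
    by (rule weak_deriv_AE_eq) auto
  then have "energy p (\<lambda>_. 0) (\<lambda>_. 0) = integral {-1..1 :: real} (\<lambda>_. 0 :: real)"
    unfolding energy_def using p
    by (intro set_integral_Iv_cong_AE) (auto elim!: eventually_mono)
  then show ?thesis by simp
qed

lemma rho_continuous_Icc: "p > 1 \<Longrightarrow> continuous_on {-1..1} (rho p)"
proof -
  assume p: "p > 1"
  have "0 \<le> 1 - y\<^sup>2" if "y \<in> {-1..1}" for y :: real
    using that by (simp add: abs_square_le_1 abs_le_iff)
  then show ?thesis
    unfolding rho_def using p by (intro continuous_on_powr' continuous_intros) auto
qed

section \<open>Pointwise properties of the kappa functions\<close>

lemma kappa_denom_pos:
  fixes \<delta> y :: real
  assumes "\<delta> \<in> {-1<..<1}" "y \<in> {-1..1}"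
  shows "1 + \<delta> * y > 0"
proof -
  have "\<bar>\<delta> * y\<bar> \<le> \<bar>\<delta>\<bar> * 1"
    using assms(2) unfolding abs_mult by (intro mult_left_mono) auto
  then show ?thesis using assms(1) by auto
qed

lemma kappa_pos:
  assumes "p > 1" "\<delta> \<in> {-1<..<1}" "y \<in> {-1..1}"
  shows "kappa p \<delta> y > 0"
  using kappa_denom_pos[OF assms(2,3)] one_minus_square_pos[OF assms(2)] assms(1)
  by (simp add: kappa_def kappa0_def)

lemma kappa_has_deriv:
  assumes "1 + \<delta> * y > 0"
  shows "(kappa p \<delta> has_real_derivative - (2 / (p - 1)) * \<delta> * kappa p \<delta> y / (1 + \<delta> * y)) (at y)"
proof -
  let ?a = "2 / (p - 1)"
  define C where "C = kappa0 p * (1 - \<delta>\<^sup>2) powr (1 / (p - 1))"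
  have k: "kappa p \<delta> = (\<lambda>y. C * (1 + \<delta> * y) powr (- ?a))"
    by (simp add: kappa_def C_def fun_eq_iff powr_minus divide_inverse)
  show ?thesis
    unfolding k using assms
    by (auto intro!: derivative_eq_intros simp: powr_diff)
qed

lemma kappa_continuous:
  assumes "\<delta> \<in> {-1<..<1}"
  shows "continuous_on {-1..1} (kappa p \<delta>)"
  by (intro continuous_at_imp_continuous_on ballI DERIV_isCont[OF kappa_has_deriv] kappa_denom_pos[OF assms])

lemma kappa_powr:
  assumes p: "p > 1" and \<delta>: "\<delta> \<in> {-1<..<1}" and y: "y \<in> {-1..1}"
  defines "a \<equiv> 2 / (p - 1)"
  shows "kappa p \<delta> y powr (p - 1) = (p + 1) * a\<^sup>2 / 2 * (1 - \<delta>\<^sup>2) / (1 + \<delta> * y)\<^sup>2"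
    and "(kappa p \<delta> y)\<^sup>2 = (kappa0 p)\<^sup>2 * (1 - \<delta>\<^sup>2) powr a / (1 + \<delta> * y) powr (2 * a)"
proof -
  have Z: "1 + \<delta> * y > 0" using kappa_denom_pos[OF \<delta> y] .
  have d: "1 - \<delta>\<^sup>2 > 0" using one_minus_square_pos[OF \<delta>] .
  have "kappa0 p powr (p - 1) = 2 * (p + 1) / (p - 1)\<^sup>2"
    using p by (simp add: kappa0_def powr_powr)
  also have "\<dots> = (p + 1) * a\<^sup>2 / 2"
  proof -
    have "2 * x / z = x * (4 / z) / 2" for x z :: real by simp
    moreover have "a\<^sup>2 = 4 / (p - 1)\<^sup>2" by (simp add: a_def power_divide)
    ultimately show ?thesis by (simp only:)
  qed
  finally have k0: "kappa0 p powr (p - 1) = (p + 1) * a\<^sup>2 / 2" .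
  have k0pos: "kappa0 p > 0" using p by (simp add: kappa0_def)
  have "kappa p \<delta> y powr (p - 1) = kappa0 p powr (p - 1) *
     (((1 - \<delta>\<^sup>2) powr (1 / (p - 1))) powr (p - 1) / ((1 + \<delta> * y) powr (2 / (p - 1))) powr (p - 1))"
    unfolding kappa_def using k0pos d Z by (simp add: powr_mult powr_divide)
  also have "((1 - \<delta>\<^sup>2) powr (1 / (p - 1))) powr (p - 1) = 1 - \<delta>\<^sup>2"
    using p d by (simp add: powr_powr)
  also have "((1 + \<delta> * y) powr (2 / (p - 1))) powr (p - 1) = (1 + \<delta> * y)\<^sup>2"
  proof -
    have "2 / z * z = 2" if "z \<noteq> 0" for z :: real
      using that by simp
    then have e: "2 / (p - 1) * (p - 1) = 2"
      using p by (metis diff_gt_0_iff_gt less_irrefl)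
    show ?thesis unfolding powr_powr e using Z by simp
  qed
  finally show "kappa p \<delta> y powr (p - 1) = (p + 1) * a\<^sup>2 / 2 * (1 - \<delta>\<^sup>2) / (1 + \<delta> * y)\<^sup>2"
    unfolding k0 by simp
  have "((1 - \<delta>\<^sup>2) powr (1 / (p - 1)))\<^sup>2 = (1 - \<delta>\<^sup>2) powr a"
    using d by (simp add: power2_eq_square a_def flip: powr_add)
  moreover have "((1 + \<delta> * y) powr (2 / (p - 1)))\<^sup>2 = (1 + \<delta> * y) powr (2 * a)"
    using Z by (simp add: power2_eq_square a_def flip: powr_add)
  ultimately show "(kappa p \<delta> y)\<^sup>2 = (kappa0 p)\<^sup>2 * (1 - \<delta>\<^sup>2) powr a / (1 + \<delta> * y) powr (2 * a)"
    by (simp add: kappa_def power_mult_distrib power_divide)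
qed

text \<open>The energy integrand with the derivative of \<open>kappa\<close> inserted; the phase has
  modulus 1 and disappears.\<close>

definition kappa_density :: "real \<Rightarrow> real \<Rightarrow> real \<Rightarrow> real" where
  "kappa_density p \<delta> y = (1 / 2 * (2 / (p - 1) * \<delta> * kappa p \<delta> y / (1 + \<delta> * y))\<^sup>2 * (1 - y\<^sup>2)
      + (p + 1) / (p - 1)\<^sup>2 * (kappa p \<delta> y)\<^sup>2
      - 1 / (p + 1) * kappa p \<delta> y powr (p + 1)) * rho p y"

lemma kappa_density_continuous:
  assumes p: "p > 1" and \<delta>: "\<delta> \<in> {-1<..<1}"
  shows "continuous_on {-1..1} (kappa_density p \<delta>)"
proof -
  have "1 + \<delta> * y \<noteq> 0" "kappa p \<delta> y \<noteq> 0" if "y \<in> {-1..1}" for y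
    using kappa_denom_pos[OF \<delta> that] kappa_pos[OF p \<delta> that] by simp_all
  then show ?thesis
    unfolding kappa_density_def
    by (intro continuous_intros continuous_on_powr kappa_continuous[OF \<delta>] rho_continuous_Icc[OF p]) auto
qed

lemma energy_eq_integral_density:
  assumes p: "p > 1" and \<delta>: "\<delta> \<in> {-1<..<1}"
  shows "energy p (\<lambda>y. exp (\<i> * of_real \<theta>) * of_real (kappa p \<delta> y)) (\<lambda>_. 0)
    = integral {-1..1} (kappa_density p \<delta>)"
proof -
  define k' where "k' y = - (2 / (p - 1)) * \<delta> * kappa p \<delta> y / (1 + \<delta> * y)" for y
  let ?w = "\<lambda>y. exp (\<i> * complex_of_real \<theta>) * of_real (kappa p \<delta> y)"
  have Iv: "y \<in> {-1..1}" if "y \<in> Iv" for y using that by auto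
  have "AE y in lebesgue. y \<in> Iv \<longrightarrow> weak_deriv ?w y = exp (\<i> * of_real \<theta>) * of_real (k' y)"
  proof (rule weak_deriv_AE_eq)
    fix y assume y: "y \<in> Iv"
    have "(kappa p \<delta> has_vector_derivative k' y) (at y)"
      using kappa_has_deriv[OF kappa_denom_pos[OF \<delta> Iv[OF y]], of p]
      unfolding has_real_derivative_iff_has_vector_derivative k'_def .
    then have "((\<lambda>y. complex_of_real (kappa p \<delta> y)) has_vector_derivative of_real (k' y)) (at y)"
      by (rule bounded_linear.has_vector_derivative[OF bounded_linear_of_real])
    then show "(?w has_vector_derivative exp (\<i> * of_real \<theta>) * of_real (k' y)) (at y)"
      by (rule has_vector_derivative_mult_right)
  next
    have "continuous_on Iv (kappa p \<delta>)"
      using kappa_continuous[OF \<delta>] by (rule continuous_on_subset) auto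
    moreover have "1 + \<delta> * y \<noteq> 0" if "y \<in> Iv" for y
      using kappa_denom_pos[OF \<delta> Iv[OF that]] by simp
    ultimately show "continuous_on Iv (\<lambda>y. exp (\<i> * of_real \<theta>) * of_real (k' y))"
      unfolding k'_def by (intro continuous_intros) auto
  qed
  then have "AE y in lebesgue. y \<in> Iv \<longrightarrow>
     (1 / 2 * (cmod 0)\<^sup>2 + 1 / 2 * (cmod (weak_deriv ?w y))\<^sup>2 * (1 - y\<^sup>2)
      + (p + 1) / (p - 1)\<^sup>2 * (cmod (?w y))\<^sup>2
      - 1 / (p + 1) * cmod (?w y) powr (p + 1)) * rho p y = kappa_density p \<delta> y"
  proof eventually_elim
    case (elim y)
    show ?case
    proof
      assume y: "y \<in> Iv"
      have "cmod (?w y) = kappa p \<delta> y"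
        using kappa_pos[OF p \<delta> Iv[OF y]] by (simp add: norm_mult)
      moreover have "(cmod (weak_deriv ?w y))\<^sup>2 = (2 / (p - 1) * \<delta> * kappa p \<delta> y / (1 + \<delta> * y))\<^sup>2"
      proof -
        have "(cmod (exp (\<i> * of_real \<theta>) * of_real t))\<^sup>2 = t\<^sup>2" for t :: real
          by (simp add: norm_mult)
        then have "(cmod (weak_deriv ?w y))\<^sup>2 = (k' y)\<^sup>2"
          using elim y by simp
        then show ?thesis by (simp add: k'_def)
      qed
      ultimately show "(1 / 2 * (cmod 0)\<^sup>2 + 1 / 2 * (cmod (weak_deriv ?w y))\<^sup>2 * (1 - y\<^sup>2)
      + (p + 1) / (p - 1)\<^sup>2 * (cmod (?w y))\<^sup>2
      - 1 / (p + 1) * cmod (?w y) powr (p + 1)) * rho p y = kappa_density p \<delta> y"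
        unfolding kappa_density_def by simp
    qed
  qed
  then show ?thesis
    unfolding energy_def by (rule set_integral_Iv_cong_AE[OF kappa_density_continuous[OF p \<delta>]])
qed

text \<open>With y = tanh x and delta = tanh c this map is the translation x -> x + c, the symmetry
  of the autonomous equation that carries the constant solution to
  \<open>kappa p \<delta>\<close>.\<close>

lemma moebius_has_deriv:
  fixes \<delta> y :: real
  assumes "1 + \<delta> * y \<noteq> 0"
  shows "((\<lambda>y. (y + \<delta>) / (1 + \<delta> * y)) has_real_derivative (1 - \<delta>\<^sup>2) / (1 + \<delta> * y)\<^sup>2) (at y)"
  using assms by (auto intro!: derivative_eq_intros simp: power2_eq_square algebra_simps)

lemma moebius_one_minus_square:
  fixes \<delta> y :: real
  assumes "1 + \<delta> * y \<noteq> 0"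
  shows "1 - ((y + \<delta>) / (1 + \<delta> * y))\<^sup>2 = (1 - \<delta>\<^sup>2) * (1 - y\<^sup>2) / (1 + \<delta> * y)\<^sup>2"
proof -
  have "1 - (x / z)\<^sup>2 = (z\<^sup>2 - x\<^sup>2) / z\<^sup>2" if "z \<noteq> 0" for x z :: real
    using that by (simp add: power_divide diff_divide_distrib)
  moreover have "(1 + \<delta> * y)\<^sup>2 - (y + \<delta>)\<^sup>2 = (1 - \<delta>\<^sup>2) * (1 - y\<^sup>2)"
    by (simp add: power2_eq_square algebra_simps)
  ultimately show ?thesis
    using assms by simp
qed

lemma integral_kappa_density:
  assumes p: "p > 1" and \<delta>: "\<delta> \<in> {-1<..<1}"
  shows "integral {-1..1} (kappa_density p \<delta>) = 1 / (p - 1) * (kappa0 p)\<^sup>2 * integral {-1..1} (rho p)"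
proof -
  define a where "a = 2 / (p - 1)"
  have a: "a > 0" using p by (simp add: a_def)
  define G where "G x = integral {-1..x} (rho p)" for x
  define X where "X y = (y + \<delta>) / (1 + \<delta> * y)" for y
  \<comment> \<open>An explicit primitive of the density. The first summand is rho (1 - y^2) kappa
    kappa' / 2, the boundary term left when the gradient part is integrated by parts using the
    stationary equation. The derivative of the second is the remaining density (1/2 - 1/(p+1))
    kappa^(p+1) rho.\<close>
  define F where "F y = - (a * \<delta> / 2) * (rho p y * (1 - y\<^sup>2) * ((kappa p \<delta> y)\<^sup>2 / (1 + \<delta> * y)))
    + a / 2 * (kappa0 p)\<^sup>2 * G (X y)" for y
  have Z: "1 + \<delta> * y > 0" if "y \<in> {-1..1}" for y
    using kappa_denom_pos[OF \<delta> that] .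
  have d: "1 - \<delta>\<^sup>2 > 0" using one_minus_square_pos[OF \<delta>] .
  have X_in: "X y \<in> {-1..1}" if y: "y \<in> {-1..1}" for y
  proof -
    have "0 \<le> 1 - y\<^sup>2"
      using y by (simp add: abs_square_le_1 abs_le_iff)
    then have "0 \<le> 1 - (X y)\<^sup>2"
      using d Z[OF y] moebius_one_minus_square[of \<delta> y] unfolding X_def by simp
    then show ?thesis by (simp add: abs_square_le_1 abs_le_iff)
  qed
  have X_Iv: "X y \<in> Iv" if y: "y \<in> Iv" for y
  proof -
    have "0 < 1 - (X y)\<^sup>2"
      using d one_minus_square_pos[OF y] Z[of y] y moebius_one_minus_square[of \<delta> y] unfolding X_def by simp
    then show ?thesis by (simp add: abs_square_less_1 abs_less_iff)
  qed
  have rc: "continuous_on {-1..1} (rho p)" using p by (rule rho_continuous_Icc)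
  have Gc: "continuous_on {-1..1} G"
    unfolding G_def by (intro indefinite_integral_continuous_1 integrable_continuous_real rc)
  have G': "(G has_real_derivative rho p x) (at x)" if x: "x \<in> Iv" for x
    using integral_has_vector_derivative[OF rc, of x] x unfolding G_def
    by (simp add: has_real_derivative_iff_has_vector_derivative at_within_Icc_at)
  have Fc: "continuous_on {-1..1} F"
  proof -
    have "continuous_on {-1..1} X"
      unfolding X_def using Z by (intro continuous_intros) force
    then have "continuous_on {-1..1} (\<lambda>y. G (X y))"
      by (rule continuous_on_compose2[OF Gc]) (use X_in in auto)
    then show ?thesis
      unfolding F_def using Z by (intro continuous_intros rc kappa_continuous[OF \<delta>]) force+
  qed
  have F': "(F has_real_derivative kappa_density p \<delta> y) (at y)" if y: "y \<in> Iv" for y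
  proof -
    have y1: "y \<in> {-1..1}" using y by auto
    define z where "z = 1 + \<delta> * y"
    have z: "z > 0" using Z[OF y1] by (simp add: z_def)
    define q where "q = 1 - y\<^sup>2"
    have q: "q > 0" using one_minus_square_pos[OF y] by (simp add: q_def)
    define k where "k = kappa p \<delta> y"
    define Y where "Y = rho p y * k\<^sup>2 / z\<^sup>2"
    have k': "(kappa p \<delta> has_real_derivative - a * \<delta> * k / z) (at y)"
      using kappa_has_deriv[of \<delta> y p] z by (simp add: a_def k_def z_def)
    have z': "((\<lambda>y. 1 + \<delta> * y) has_real_derivative \<delta>) (at y)"
      by (auto intro!: derivative_eq_intros)
    have 1: "((\<lambda>y. (kappa p \<delta> y)\<^sup>2 / (1 + \<delta> * y)) has_real_derivative - (2 * a + 1) * \<delta> * k\<^sup>2 / z\<^sup>2) (at y)"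
    proof -
      have "((\<lambda>y. (kappa p \<delta> y)\<^sup>2) has_real_derivative - 2 * a * \<delta> * k\<^sup>2 / z) (at y)"
      proof -
        have e: "(- a * \<delta> * k / z) * k + (- a * \<delta> * k / z) * k = - 2 * a * \<delta> * k\<^sup>2 / z"
          using z by (simp add: field_simps power2_eq_square)
        show ?thesis
          using DERIV_mult[OF k' k'] unfolding k_def[symmetric] e by (simp add: power2_eq_square)
      qed
      from DERIV_divide[OF this z'] z
      have "((\<lambda>y. (kappa p \<delta> y)\<^sup>2 / (1 + \<delta> * y)) has_real_derivative
          ((- 2 * a * \<delta> * k\<^sup>2 / z) * z - k\<^sup>2 * \<delta>) / (z * z)) (at y)"
        by (simp add: z_def k_def)
      moreover have "((- 2 * a * \<delta> * k\<^sup>2 / z) * z - k\<^sup>2 * \<delta>) / (z * z) = - (2 * a + 1) * \<delta> * k\<^sup>2 / z\<^sup>2"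
        using z by (simp add: power2_eq_square algebra_simps)
      ultimately show ?thesis by simp
    qed
    have "((\<lambda>y. rho p y * (1 - y\<^sup>2) * ((kappa p \<delta> y)\<^sup>2 / (1 + \<delta> * y))) has_real_derivative
        (- (2 * (a + 1) * y) * rho p y) * (k\<^sup>2 / z) + (- (2 * a + 1) * \<delta> * k\<^sup>2 / z\<^sup>2) * (rho p y * q)) (at y)"
      using DERIV_mult[OF rho_weight_has_deriv[OF y, of p] 1] by (simp add: a_def k_def z_def q_def)
    moreover have "(- (2 * (a + 1) * y) * rho p y) * (k\<^sup>2 / z) + (- (2 * a + 1) * \<delta> * k\<^sup>2 / z\<^sup>2) * (rho p y * q)
       = Y * (- (2 * (a + 1) * y) * z - (2 * a + 1) * \<delta> * q)"
      using z by (simp add: Y_def power2_eq_square field_simps)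
    ultimately have 2: "((\<lambda>y. rho p y * (1 - y\<^sup>2) * ((kappa p \<delta> y)\<^sup>2 / (1 + \<delta> * y))) has_real_derivative
       Y * (- (2 * (a + 1) * y) * z - (2 * a + 1) * \<delta> * q)) (at y)" by simp
    have "(X has_real_derivative (1 - \<delta>\<^sup>2) / z\<^sup>2) (at y)"
      using moebius_has_deriv[of \<delta> y] z unfolding X_def[abs_def] z_def by simp
    from DERIV_chain2[OF G'[OF X_Iv[OF y]] this]
    have 3: "((\<lambda>y. G (X y)) has_real_derivative rho p (X y) * ((1 - \<delta>\<^sup>2) / z\<^sup>2)) (at y)" .
    have 4: "(kappa0 p)\<^sup>2 * (rho p (X y) * ((1 - \<delta>\<^sup>2) / z\<^sup>2)) = Y * (1 - \<delta>\<^sup>2)"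
    proof -
      have "1 - (X y)\<^sup>2 = (1 - \<delta>\<^sup>2) * q / z\<^sup>2"
        using moebius_one_minus_square[of \<delta> y] z by (simp add: X_def z_def q_def)
      then have "rho p (X y) = ((1 - \<delta>\<^sup>2) * q / z\<^sup>2) powr a"
        by (simp add: rho_def a_def)
      also have "\<dots> = (1 - \<delta>\<^sup>2) powr a * rho p y / z powr (2 * a)"
        using d q z by (simp add: powr_mult powr_divide rho_def a_def q_def powr_powr flip: powr_numeral)
      finally have "(kappa0 p)\<^sup>2 * rho p (X y) = rho p y * k\<^sup>2"
        using kappa_powr(2)[OF p \<delta> y1] by (simp add: k_def a_def z_def)
      then show ?thesis by (simp add: Y_def)
    qed
    have "(F has_real_derivative - (a * \<delta> / 2) * (Y * (- (2 * (a + 1) * y) * z - (2 * a + 1) * \<delta> * q))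
        + a / 2 * (kappa0 p)\<^sup>2 * (rho p (X y) * ((1 - \<delta>\<^sup>2) / z\<^sup>2))) (at y)"
      unfolding F_def[abs_def] by (intro DERIV_add DERIV_cmult 2 3)
    also have "- (a * \<delta> / 2) * (Y * (- (2 * (a + 1) * y) * z - (2 * a + 1) * \<delta> * q))
        + a / 2 * (kappa0 p)\<^sup>2 * (rho p (X y) * ((1 - \<delta>\<^sup>2) / z\<^sup>2))
      = a / 2 * Y * (2 * (a + 1) * \<delta> * y * z + (2 * a + 1) * \<delta>\<^sup>2 * q + (1 - \<delta>\<^sup>2))"
    proof -
      have "a / 2 * (kappa0 p)\<^sup>2 * (rho p (X y) * ((1 - \<delta>\<^sup>2) / z\<^sup>2)) = a / 2 * (Y * (1 - \<delta>\<^sup>2))"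
        unfolding 4[symmetric] by simp
      then show ?thesis by (simp add: algebra_simps power2_eq_square)
    qed
    also have "\<dots> = a / 2 * Y * (a * \<delta>\<^sup>2 * q + (a + 1) * z\<^sup>2 - a * (1 - \<delta>\<^sup>2))"
      by (simp add: z_def q_def power2_eq_square algebra_simps)
    also have "\<dots> = kappa_density p \<delta> y"
    proof -
      have kp: "k powr (p + 1) = k\<^sup>2 * ((p + 1) * a\<^sup>2 / 2 * (1 - \<delta>\<^sup>2) / z\<^sup>2)"
      proof -
        have "k powr (p + 1) = k powr (2 + (p - 1))"
          by (rule arg_cong[where f="(powr) k"]) simp
        also have "\<dots> = k\<^sup>2 * k powr (p - 1)"
          using kappa_pos[OF p \<delta> y1] unfolding powr_add k_def by simp
        finally show ?thesis
          using kappa_powr(1)[OF p \<delta> y1] by (simp add: k_def a_def z_def)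
      qed
      have c: "(p + 1) / (p - 1)\<^sup>2 = a * (a + 1) / 2"
      proof -
        have "2 / z * (x / z) / 2 = x / z\<^sup>2" for x z :: real
          by (simp add: power2_eq_square)
        moreover have "a + 1 = (p + 1) / (p - 1)"
          using p by (simp add: a_def field_simps)
        ultimately show ?thesis by (simp only: a_def)
      qed
      have "1 / (p + 1) * k powr (p + 1) = k\<^sup>2 * (a\<^sup>2 / 2 * (1 - \<delta>\<^sup>2) / z\<^sup>2)"
        unfolding kp using p by simp
      then have "kappa_density p \<delta> y = (1 / 2 * (a * \<delta> * k / z)\<^sup>2 * q + a * (a + 1) / 2 * k\<^sup>2
          - k\<^sup>2 * (a\<^sup>2 / 2 * (1 - \<delta>\<^sup>2) / z\<^sup>2)) * rho p y"
        unfolding kappa_density_def c by (simp add: a_def k_def z_def q_def)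
      also have "\<dots> = a / 2 * Y * (a * \<delta>\<^sup>2 * q + (a + 1) * z\<^sup>2 - a * (1 - \<delta>\<^sup>2))"
        using z by (simp add: Y_def field_simps power2_eq_square)
      finally show ?thesis by simp
    qed
    finally show ?thesis .
  qed
  have "(kappa_density p \<delta> has_integral (F 1 - F (-1))) {-1..1}"
    using F' by (intro fundamental_theorem_of_calculus_interior Fc)
      (auto simp: has_real_derivative_iff_has_vector_derivative)
  \<comment> \<open>The end points are fixed by the map and the first summand of \<open>F\<close>
    vanishes there, so the value of the integral no longer involves \<open>\<delta>\<close>.\<close>
  moreover have "X 1 = 1" "X (-1) = -1"
    using Z[of 1] Z[of "-1"] by (auto simp: X_def field_simps)
  ultimately have "integral {-1..1} (kappa_density p \<delta>) = a / 2 * (kappa0 p)\<^sup>2 * (G 1 - G (-1))"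
    by (simp add: integral_unique F_def right_diff_distrib)
  moreover have "a / 2 = 1 / (p - 1)"
  proof -
    have "2 / z / 2 = 1 / z" for z :: real by simp
    then show ?thesis by (simp only: a_def)
  qed
  ultimately show ?thesis
    by (simp only:) (simp add: G_def)
qed

lemma integral_rho_pos: "p > 1 \<Longrightarrow> integral {-1..1} (rho p) > 0"
proof -
  assume p: "p > 1"
  have "0 \<le> rho p y" for y by (simp add: rho_def)
  moreover have "rho p 0 = 1" by (simp add: rho_def)
  ultimately have "integral {-1..1} (rho p) \<noteq> 0"
    using integral_eq_0_iff[OF rho_continuous_Icc[OF p]] by force
  moreover have "integral {-1..1} (rho p) \<ge> 0"
    by (intro integral_nonneg integrable_continuous_real rho_continuous_Icc[OF p]) (simp add: rho_def)
  ultimately show ?thesis by linarith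
qed

lemma kappa_0: "kappa p 0 y = kappa0 p"
  by (simp add: kappa_def)

lemma energy_kappa:
  assumes p: "p > 1" and \<delta>: "\<delta> \<in> {-1<..<1}"
  shows "energy p (\<lambda>y. exp (\<i> * of_real \<theta>) * of_real (kappa p \<delta> y)) (\<lambda>_. 0)
    = 1 / (p - 1) * (kappa0 p)\<^sup>2 * integral {-1..1} (rho p)"
  unfolding energy_eq_integral_density[OF assms] integral_kappa_density[OF assms] ..

lemma energy_kappa0:
  assumes "p > 1"
  shows "energy p (\<lambda>_. of_real (kappa0 p)) (\<lambda>_. 0) = 1 / (p - 1) * (kappa0 p)\<^sup>2 * integral {-1..1} (rho p)"
  using energy_kappa[OF assms, of 0 0] by (simp add: kappa_0)

lemma energy_kappa0_pos: "p > 1 \<Longrightarrow> energy p (\<lambda>_. of_real (kappa0 p)) (\<lambda>_. 0) > 0"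
proof -
  assume p: "p > 1"
  then have "kappa0 p > 0" by (simp add: kappa0_def)
  then show ?thesis
    using p integral_rho_pos[OF p] by (simp add: energy_kappa0)
qed

text \<open>Elements of \<open>H0 p\<close> are functions, not classes. Part (i) is therefore given
  twice: almost everywhere for an arbitrary representative, and at every point for a continuous
  one.\<close>

theorem proposition2:
  fixes p :: real
  assumes "p > 1"
  shows
    "(\<forall>w \<in> H0 p. stationary_solution p w \<longrightarrow>
        ((AE y in lebesgue. y \<in> Iv \<longrightarrow> w y = 0) \<or>
         (\<exists>\<delta>\<in>{-1<..<1}. \<exists>\<theta>::real. AE y in lebesgue. y \<in> Iv \<longrightarrow>
            w y = exp (\<i> * of_real \<theta>) * of_real (kappa p \<delta> y))) \<and>
        (continuous_on Iv w \<longrightarrow>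
         ((\<forall>y\<in>Iv. w y = 0) \<or>
          (\<exists>\<delta>\<in>{-1<..<1}. \<exists>\<theta>::real. \<forall>y\<in>Iv.
             w y = exp (\<i> * of_real \<theta>) * of_real (kappa p \<delta> y)))))
     \<and> energy p (\<lambda>_. 0) (\<lambda>_. 0) = 0
     \<and> (\<forall>\<delta>\<in>{-1<..<1}. \<forall>\<theta>::real.
          energy p (\<lambda>y. exp (\<i> * of_real \<theta>) * of_real (kappa p \<delta> y)) (\<lambda>_. 0)
            = energy p (\<lambda>_. of_real (kappa0 p)) (\<lambda>_. 0)
          \<and> energy p (\<lambda>_. of_real (kappa0 p)) (\<lambda>_. 0) > 0)"
proof (intro conjI ballI impI allI)
  fix w assume w: "w \<in> H0 p" and eq: "stationary_solution p w"
  from stationary_solution_classification[OF assms w eq] obtain W where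
    wW: "AE y in lebesgue. y \<in> Iv \<longrightarrow> w y = W y" and Wc: "continuous_on Iv W" and
    W: "(\<forall>y\<in>Iv. W y = 0) \<or>
     (\<exists>\<delta>\<in>{-1<..<1}. \<exists>\<theta>::real. \<forall>y\<in>Iv. W y = exp (\<i> * of_real \<theta>) * of_real (kappa p \<delta> y))"
    by blast
  have ae: "AE y in lebesgue. y \<in> Iv \<longrightarrow> w y = u y" if "\<forall>y\<in>Iv. W y = u y" for u
    using wW by eventually_elim (use that in auto)
  from W show "(AE y in lebesgue. y \<in> Iv \<longrightarrow> w y = 0) \<or>
         (\<exists>\<delta>\<in>{-1<..<1}. \<exists>\<theta>::real. AE y in lebesgue. y \<in> Iv \<longrightarrow>
            w y = exp (\<i> * of_real \<theta>) * of_real (kappa p \<delta> y))"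
    using ae by meson
  assume "continuous_on Iv w"
  then have "w y = W y" if "y \<in> Iv" for y
    using continuous_AE_eq_imp_eq[OF _ Wc wW that] by blast
  with W show "(\<forall>y\<in>Iv. w y = 0) \<or>
          (\<exists>\<delta>\<in>{-1<..<1}. \<exists>\<theta>::real. \<forall>y\<in>Iv.
             w y = exp (\<i> * of_real \<theta>) * of_real (kappa p \<delta> y))"
    by simp
next
  show "energy p (\<lambda>_. 0) (\<lambda>_. 0) = 0"
    using assms by (rule energy_zero)
next
  fix \<delta> \<theta> :: real assume "\<delta> \<in> {-1<..<1}"
  then show "energy p (\<lambda>y. exp (\<i> * of_real \<theta>) * of_real (kappa p \<delta> y)) (\<lambda>_. 0)
            = energy p (\<lambda>_. of_real (kappa0 p)) (\<lambda>_. 0)"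
    using assms by (simp add: energy_kappa energy_kappa0)
  show "energy p (\<lambda>_. of_real (kappa0 p)) (\<lambda>_. 0) > 0"
    using assms by (rule energy_kappa0_pos)
qed

end
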